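(* Let $0<\beta<1$, let $k\ge1$ and let $(j_i,l_i)$, $1\le i\le k$, be a fixed family of pairs of replica indexes with $1\le j_i<l_i$. For any integer $n\ge\left[\frac{k+1}{2}\right]$, the quantity $$\nu\left(\prod_{i=1}^k\sigma_N^{j_i}\sigma_N^{l_i}R_{j_i,l_i}\right)$$ can be written as a finite sum of terms of the type $$K(\beta,I)\,\frac{1}{N^j}\,\nu\left(\prod_{i=1}^r\sigma_N^{j'_i}\sigma_N^{l'_i}R_{j'_i,l'_i}\right)$$ with integers $j,r\ge0$ satisfying $j+\frac r2\ge\frac k2$, plus a remainder of order $O\left(\frac{1}{N^{n+\frac12}}\right)$ as $N\to\infty$. Here $I=\{(j'_i,l'_i),1\le i\le r\}$ is the family of indexes (with $j'_i<l'_i$) appearing in the given term, and $K(\beta,I)$ denotes a constant depending on $\beta$ and on $I$ (and not on $N$). Moreover, for every term in this sum with $j+\frac r2=\frac k2$ one has $j>0$.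
   Context: Sherrington-Kirkpatrick model. For $N\ge1$ let $\Sigma_N=\{-1,1\}^N$, and for $\sigma=(\sigma_1,\dots,\sigma_N)\in\Sigma_N$ let $$-H_N(\sigma)=\frac{1}{N^{1/2}}\sum_{1\le i<j\le N}g_{i,j}\sigma_i\sigma_j,$$ where $\{g_{i,j};1\le i<j\le N\}$ are independent standard Gaussian random variables on a probability space, with expectation denoted $\mathbf{E}$. For the inverse temperature $\beta>0$ let $Z_N=\sum_{\sigma\in\Sigma_N}\exp(-\beta H_N(\sigma))$. For $n\ge1$ and $f:\Sigma_N^n\to\mathbb{R}$ put $$\langle f\rangle=Z_N^{-n}\sum_{\sigma^1,\dots,\sigma^n\in\Sigma_N}f(\sigma^1,\dots,\sigma^n)\exp\Big(-\beta\sum_{l\le n}H_N(\sigma^l)\Big),\qquad \nu(f)=\mathbf{E}\langle f\rangle.$$ The overlap of two replicas $\sigma^l,\sigma^{l'}$ ($l<l'$) is $R_{l,l'}=\frac1N\sum_{i\le N}\sigma_i^l\sigma_i^{l'}$; $\sigma_N^l$ is the last spin of the $l$-th replica. $[x]$ denotes the integer part of $x$. An empty product ($r=0$) equals $1$, so that a term with $r=0$ is of the form $K(\beta,I)/N^j$. The finite collection of terms, their exponents, index families and constants do not depend on $N$; neither does the constant in the $O(\cdot)$ (it may depend on $\beta$, $n$ and the initial indexes). *)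

theory Defs
  imports "HOL-Probability.Probability"
begin

definition spin_configs :: "nat \<Rightarrow> (nat \<Rightarrow> real) set" where
  "spin_configs N = {1..N} \<rightarrow>\<^sub>E {-1, 1}"

definition site_pairs :: "nat \<Rightarrow> (nat \<times> nat) set" where
  "site_pairs N = {(i, j). 1 \<le> i \<and> i < j \<and> j \<le> N}"

definition gaussian_disorder :: "nat \<Rightarrow> 'w measure \<Rightarrow> (nat \<times> nat \<Rightarrow> 'w \<Rightarrow> real) \<Rightarrow> bool" where
  "gaussian_disorder N M g \<longleftrightarrow>
     prob_space M \<and>
     prob_space.indep_vars M (\<lambda>_. borel) g (site_pairs N) \<and>
     (\<forall>p\<in>site_pairs N. distributed M lborel (g p) (\<lambda>x. ennreal (std_normal_density x)))"

text \<open>In the definitions up to \<open>gibbs_average\<close>, \<open>a\<close> is one realization of the couplings.\<close>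

definition hamiltonian :: "nat \<Rightarrow> (nat \<times> nat \<Rightarrow> real) \<Rightarrow> (nat \<Rightarrow> real) \<Rightarrow> real" where
  "hamiltonian N a \<sigma> = - ((1 / sqrt (real N)) * (\<Sum>(i, j)\<in>site_pairs N. a (i, j) * \<sigma> i * \<sigma> j))"

definition partition_function :: "real \<Rightarrow> nat \<Rightarrow> (nat \<times> nat \<Rightarrow> real) \<Rightarrow> real" where
  "partition_function \<beta> N a = (\<Sum>\<sigma>\<in>spin_configs N. exp (- \<beta> * hamiltonian N a \<sigma>))"

definition replica_configs :: "nat \<Rightarrow> nat \<Rightarrow> (nat \<Rightarrow> nat \<Rightarrow> real) set" where
  "replica_configs N m = {1..m} \<rightarrow>\<^sub>E spin_configs N"

definition gibbs_average ::
    "real \<Rightarrow> nat \<Rightarrow> (nat \<times> nat \<Rightarrow> real) \<Rightarrow> nat \<Rightarrow> ((nat \<Rightarrow> nat \<Rightarrow> real) \<Rightarrow> real) \<Rightarrow> real" where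
  "gibbs_average \<beta> N a m f =
     (1 / partition_function \<beta> N a ^ m) *
     (\<Sum>s\<in>replica_configs N m. f s * exp (- \<beta> * (\<Sum>l=1..m. hamiltonian N a (s l))))"

definition nu ::
    "real \<Rightarrow> nat \<Rightarrow> 'w measure \<Rightarrow> (nat \<times> nat \<Rightarrow> 'w \<Rightarrow> real) \<Rightarrow> nat \<Rightarrow>
     ((nat \<Rightarrow> nat \<Rightarrow> real) \<Rightarrow> real) \<Rightarrow> real" where
  "nu \<beta> N M g m f = prob_space.expectation M (\<lambda>w. gibbs_average \<beta> N (\<lambda>p. g p w) m f)"

definition overlap :: "nat \<Rightarrow> (nat \<Rightarrow> real) \<Rightarrow> (nat \<Rightarrow> real) \<Rightarrow> real" where
  "overlap N \<sigma> \<tau> = (1 / real N) * (\<Sum>i=1..N. \<sigma> i * \<tau> i)"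

definition replica_pairs :: "(nat \<times> nat) list \<Rightarrow> bool" where
  "replica_pairs I \<longleftrightarrow> (\<forall>(j, l)\<in>set I. 1 \<le> j \<and> j < l)"

definition spin_overlap_prod :: "nat \<Rightarrow> (nat \<times> nat) list \<Rightarrow> (nat \<Rightarrow> nat \<Rightarrow> real) \<Rightarrow> real" where
  "spin_overlap_prod N I s = (\<Prod>(j, l)\<leftarrow>I. s j N * s l N * overlap N (s j) (s l))"

text \<open>A number of replicas that suffices for the product over \<open>I\<close> when \<open>replica_pairs I\<close>.
  Adding further replicas, on which the product does not depend, does not change \<open>nu\<close>.\<close>

definition num_replicas :: "(nat \<times> nat) list \<Rightarrow> nat" where
  "num_replicas I = Max (insert 1 (snd ` set I))"

definition nu_prod ::
    "real \<Rightarrow> nat \<Rightarrow> 'w measure \<Rightarrow> (nat \<times> nat \<Rightarrow> 'w \<Rightarrow> real) \<Rightarrow> (nat \<times> nat) list \<Rightarrow> real" where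
  "nu_prod \<beta> N M g I = nu \<beta> N M g (num_replicas I) (spin_overlap_prod N I)"

end

theory Submission
  imports Defs "HOL-Real_Asymp.Real_Asymp"
begin

text \<open>
  Scale the couplings of the last spin by \<open>\<surd>t\<close> and let \<open>\<nu>\<^sub>t\<close> be the resulting average, so that
  \<open>\<nu>\<^sub>1 = \<nu>\<close>. By Gaussian integration by parts, differentiating in \<open>t\<close> the average of a product of
  factors \<open>\<epsilon>\<^sub>j \<epsilon>\<^sub>l R\<^sup>-\<^sub>j\<^sub>l\<close>, where \<open>\<epsilon>\<close> is the last spin and \<open>R\<^sup>-\<close> the overlap without it, gives a
  combination of such products with one more factor. Expand \<open>\<nu>\<^sub>0\<close> around \<open>t = 1\<close>. If some replica
  occurs an odd number of times then \<open>\<nu>\<^sub>0\<close> vanishes by flipping its last spin, which expresses the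
  product through longer ones. If every replica occurs an even number of times, site symmetry allows
  one factor to be dropped; the first derivative of the shorter product contains \<open>\<beta>\<^sup>2\<close> times the original
  one, its other terms are odd, and one divides by \<open>1 - \<beta>\<^sup>2\<close>.

  The Taylor remainder only has to decay like some positive power of \<open>N\<close> that grows with the order.
  For this \<open>\<nu>\<^sub>t (\<bar>R\<^sup>-\<bar> \<ge> N powr (- 1/8)) \<le> C exp (- c \<surd>N)\<close> is enough, and it follows from the second
  moment of the partition function \<open>Z\<close> (bounded relative to the square of its mean for \<open>\<beta> < 1\<close>)
  together with the concentration bound \<open>E Z\<^sup>\<theta> \<sqdot> E Z\<^sup>-\<^sup>\<theta> \<le> exp (\<theta>\<^sup>2 N)\<close>.
\<close>

section \<open>Gibbs averages over replicas\<close>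

text \<open>The bookkeeping is by the weight \<open>2 * j + r\<close>, in which one factor
  \<open>1 / N\<close> counts for two overlaps. Passing between the two overlaps replaces factors by
  \<open>- 1 / N\<close>, so each such correction raises the weight and has \<open>j > 0\<close>.
  All other terms that are kept have more than \<open>k\<close> factors. Weight exactly
  \<open>k\<close> arises only from corrections to a product shortened by one factor, and this is
  the reason for \<open>j > 0\<close> in that case.

  Expanding at \<open>t = 1\<close> makes every coefficient an average under the original measure;
  the value at \<open>t = 0\<close> enters only by being zero. Hence the Taylor order is at least
  \<open>8 * (n + 1)\<close>, and the surplus terms are kept, since they are admissible.

  For large overlaps, the second moment controls only the numerator of a Gibbs probability. The
  negative moment of \<open>Z\<close> is what excludes an untypically small denominator.\<close>

lemma finite_site_pairs [simp]: "finite (site_pairs N)"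
  by (rule finite_subset[of _ "{..N} \<times> {..N}"]) (auto simp: site_pairs_def)

lemma finite_spin_configs [simp]: "finite (spin_configs N)"
  by (auto simp: spin_configs_def intro!: finite_PiE)

lemma spin_configs_nonempty [simp]: "spin_configs N \<noteq> {}"
  by (auto simp: spin_configs_def PiE_eq_empty_iff)

lemma finite_replica_configs [simp]: "finite (replica_configs N m)"
  by (auto simp: replica_configs_def intro!: finite_PiE)

lemma replica_configsD: "s \<in> replica_configs N m \<Longrightarrow> l \<in> {1..m} \<Longrightarrow> s l \<in> spin_configs N"
  by (auto simp: replica_configs_def)

lemma spin_configsD: "\<sigma> \<in> spin_configs N \<Longrightarrow> i \<in> {1..N} \<Longrightarrow> \<sigma> i = -1 \<or> \<sigma> i = 1"
  by (auto simp: spin_configs_def)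

lemma spin_square: "\<sigma> \<in> spin_configs N \<Longrightarrow> i \<in> {1..N} \<Longrightarrow> \<sigma> i * \<sigma> i = 1"
  using spin_configsD[of \<sigma> N i] by auto

lemma abs_spin: "\<sigma> \<in> spin_configs N \<Longrightarrow> i \<in> {1..N} \<Longrightarrow> \<bar>\<sigma> i\<bar> = 1"
  using spin_configsD[of \<sigma> N i] by auto

definition pair_spin :: "nat \<times> nat \<Rightarrow> (nat \<Rightarrow> real) \<Rightarrow> real" where
  "pair_spin p \<sigma> = \<sigma> (fst p) * \<sigma> (snd p)"

definition boltzmann :: "real \<Rightarrow> nat \<Rightarrow> (nat \<times> nat \<Rightarrow> real) \<Rightarrow> (nat \<Rightarrow> real) \<Rightarrow> real" where
  "boltzmann \<beta> N a \<sigma> = exp (- \<beta> * hamiltonian N a \<sigma>)"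

lemma boltzmann_eq:
  "boltzmann \<beta> N a \<sigma> = exp (\<beta> / sqrt (real N) * (\<Sum>p\<in>site_pairs N. a p * pair_spin p \<sigma>))"
  by (simp add: boltzmann_def hamiltonian_def pair_spin_def case_prod_unfold mult.assoc)

lemma boltzmann_pos [simp]: "boltzmann \<beta> N a \<sigma> > 0"
  by (simp add: boltzmann_def)

lemma boltzmann_nonneg [simp]: "boltzmann \<beta> N a \<sigma> \<ge> 0"
  by (simp add: boltzmann_def)

lemma partition_function_eq: "partition_function \<beta> N a = (\<Sum>\<sigma>\<in>spin_configs N. boltzmann \<beta> N a \<sigma>)"
  by (simp add: partition_function_def boltzmann_def)

lemma partition_function_pos [simp]: "partition_function \<beta> N a > 0"
  unfolding partition_function_eq by (intro sum_pos) auto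

lemma partition_function_neq_0 [simp]: "partition_function \<beta> N a \<noteq> 0"
  using partition_function_pos[of \<beta> N a] by linarith

lemma gibbs_average_eq:
  "gibbs_average \<beta> N a m f =
     (\<Sum>s\<in>replica_configs N m. f s * (\<Prod>l=1..m. boltzmann \<beta> N a (s l))) / partition_function \<beta> N a ^ m"
proof -
  have "exp (- \<beta> * (\<Sum>l=1..m. hamiltonian N a (s l))) = (\<Prod>l=1..m. boltzmann \<beta> N a (s l))" for s
    unfolding boltzmann_def by (simp add: sum_distrib_left flip: exp_sum)
  then show ?thesis
    by (simp add: gibbs_average_def)
qed

lemma gibbs_average_cong:
  "(\<And>s. s \<in> replica_configs N m \<Longrightarrow> f s = h s) \<Longrightarrow> gibbs_average \<beta> N a m f = gibbs_average \<beta> N a m h"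
  unfolding gibbs_average_eq by (metis (no_types, lifting) sum.cong)

lemma gibbs_average_add:
  "gibbs_average \<beta> N a m (\<lambda>s. f s + h s) = gibbs_average \<beta> N a m f + gibbs_average \<beta> N a m h"
  unfolding gibbs_average_eq by (simp add: distrib_right sum.distrib add_divide_distrib)

lemma gibbs_average_cmult:
  "gibbs_average \<beta> N a m (\<lambda>s. c * f s) = c * gibbs_average \<beta> N a m f"
  unfolding gibbs_average_eq by (simp add: sum_distrib_left mult.assoc)

lemma gibbs_average_sum:
  "gibbs_average \<beta> N a m (\<lambda>s. \<Sum>i\<in>A. f i s) = (\<Sum>i\<in>A. gibbs_average \<beta> N a m (f i))"
  unfolding gibbs_average_eq sum_distrib_right by (subst sum.swap) (simp add: sum_divide_distrib)

lemma gibbs_average_mono: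
  "(\<And>s. s \<in> replica_configs N m \<Longrightarrow> f s \<le> h s) \<Longrightarrow> gibbs_average \<beta> N a m f \<le> gibbs_average \<beta> N a m h"
  unfolding gibbs_average_eq
  by (intro divide_right_mono sum_mono mult_right_mono prod_nonneg) (auto simp: less_imp_le)

lemma gibbs_average_const [simp]: "gibbs_average \<beta> N a m (\<lambda>_. c) = c"
proof -
  have "(\<Sum>s\<in>replica_configs N m. \<Prod>l=1..m. boltzmann \<beta> N a (s l))
      = (\<Prod>l=1..m. partition_function \<beta> N a)"
    unfolding replica_configs_def partition_function_eq by (subst prod_sum_PiE) auto
  then show ?thesis
    unfolding gibbs_average_eq by (simp flip: sum_distrib_left)
qed

lemma gibbs_average_abs_le:
  "\<bar>gibbs_average \<beta> N a m f\<bar> \<le> gibbs_average \<beta> N a m (\<lambda>s. \<bar>f s\<bar>)"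
proof -
  have "gibbs_average \<beta> N a m f \<le> gibbs_average \<beta> N a m (\<lambda>s. \<bar>f s\<bar>)"
    by (rule gibbs_average_mono) auto
  moreover have "gibbs_average \<beta> N a m (\<lambda>s. (-1) * f s) \<le> gibbs_average \<beta> N a m (\<lambda>s. \<bar>f s\<bar>)"
    by (rule gibbs_average_mono) auto
  ultimately show ?thesis
    unfolding gibbs_average_cmult by linarith
qed

text \<open>A crude bound that depends on \<open>N\<close>. It serves integrability, dominated
  convergence and differentiation at fixed \<open>N\<close>, never an estimate uniform in
  \<open>N\<close>.\<close>

definition replica_sum_abs :: "nat \<Rightarrow> nat \<Rightarrow> ((nat \<Rightarrow> nat \<Rightarrow> real) \<Rightarrow> real) \<Rightarrow> real" where
  "replica_sum_abs N m f = (\<Sum>s\<in>replica_configs N m. \<bar>f s\<bar>)"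

lemma gibbs_average_abs_bound: "\<bar>gibbs_average \<beta> N a m f\<bar> \<le> replica_sum_abs N m f"
proof -
  have "gibbs_average \<beta> N a m (\<lambda>s. \<bar>f s\<bar>) \<le> gibbs_average \<beta> N a m (\<lambda>_. replica_sum_abs N m f)"
    unfolding replica_sum_abs_def
    by (rule gibbs_average_mono) (rule member_le_sum, auto)
  then show ?thesis
    using gibbs_average_abs_le[of \<beta> N a m f] by simp
qed

text \<open>Replica functions are total in the replica index, so being a function of
  \<open>m\<close> replicas is expressed as an invariance. Quantifying over all \<open>s\<close>,
  not only over configurations, lets replicas be overwritten freely.\<close>

definition depends_on_first :: "nat \<Rightarrow> ((nat \<Rightarrow> nat \<Rightarrow> real) \<Rightarrow> real) \<Rightarrow> bool" where
  "depends_on_first m f \<longleftrightarrow> (\<forall>s s'. (\<forall>l\<in>{1..m}. s l = s' l) \<longrightarrow> f s = f s')"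

lemma sum_replica_configs_Suc:
  "(\<Sum>s\<in>replica_configs N (Suc m). F s)
     = (\<Sum>s\<in>replica_configs N m. \<Sum>\<sigma>\<in>spin_configs N. F (s(Suc m := \<sigma>)))"
proof -
  have "replica_configs N (Suc m)
      = (\<lambda>(y, g). g(Suc m := y)) ` (spin_configs N \<times> replica_configs N m)"
    unfolding replica_configs_def atLeastAtMostSuc_conv[of 1 m, OF le_add1[of 1 m, unfolded plus_1_eq_Suc]] PiE_insert_eq
    by (rule refl)
  moreover have "inj_on (\<lambda>(y, g). g(Suc m := y)) (spin_configs N \<times> replica_configs N m)"
    unfolding replica_configs_def by (rule inj_combinator) simp
  ultimately have "(\<Sum>s\<in>replica_configs N (Suc m). F s)
      = (\<Sum>(y, g)\<in>spin_configs N \<times> replica_configs N m. F (g(Suc m := y)))"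
    by (simp add: sum.reindex case_prod_unfold)
  also have "\<dots> = (\<Sum>s\<in>replica_configs N m. \<Sum>\<sigma>\<in>spin_configs N. F (s(Suc m := \<sigma>)))"
    by (subst sum.cartesian_product[symmetric]) (rule sum.swap)
  finally show ?thesis .
qed

text \<open>The weights are a product over replicas, so a replica seen only by \<open>h\<close> sums
  out on its own. Read backwards, this turns the logarithmic derivative of the normalisation into
  one more replica.\<close>

lemma gibbs_average_Suc:
  assumes "depends_on_first m f"
  shows "gibbs_average \<beta> N a (Suc m) (\<lambda>s. f s * h (s (Suc m)))
       = gibbs_average \<beta> N a m f * ((\<Sum>\<sigma>\<in>spin_configs N. h \<sigma> * boltzmann \<beta> N a \<sigma>) / partition_function \<beta> N a)"
proof -
  have f: "f (s(Suc m := \<sigma>)) = f s" for s \<sigma>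
    using assms by (auto simp: depends_on_first_def)
  have *: "(\<Prod>l=1..m. boltzmann \<beta> N a (if l = Suc m then \<sigma> else s l))
      = (\<Prod>l=1..m. boltzmann \<beta> N a (s l))" for s \<sigma>
    by (intro prod.cong) auto
  show ?thesis
    unfolding gibbs_average_eq sum_replica_configs_Suc
    by (simp add: f * sum_distrib_left sum_distrib_right mult_ac flip: sum_divide_distrib)
qed

lemma gibbs_average_Suc_ignore:
  assumes "depends_on_first m f"
  shows "gibbs_average \<beta> N a (Suc m) f = gibbs_average \<beta> N a m f"
  using gibbs_average_Suc[OF assms, where h = "\<lambda>_. 1"] by (simp flip: partition_function_eq)

lemma depends_on_first_mono: "depends_on_first m f \<Longrightarrow> m \<le> m' \<Longrightarrow> depends_on_first m' f"
  unfolding depends_on_first_def by (meson atLeastAtMost_iff order_trans)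

lemma gibbs_average_more_replicas:
  assumes "depends_on_first m f" "m \<le> m'"
  shows "gibbs_average \<beta> N a m' f = gibbs_average \<beta> N a m f"
  using assms(2)
proof (induction m' rule: dec_induct)
  case (step k)
  then show ?case
    using gibbs_average_Suc_ignore[OF depends_on_first_mono[OF assms(1)]] by simp
qed simp

text \<open>The factor created by differentiating along an energy direction \<open>V\<close>: each
  of the \<open>m\<close> weights brings \<open>V\<close> on its own replica, and the denominator
  \<open>Z ^ m\<close> brings minus \<open>m\<close> times the mean of \<open>V\<close>, realised on
  replica \<open>m + 1\<close>.\<close>

definition replica_diff ::
    "nat \<Rightarrow> ((nat \<Rightarrow> real) \<Rightarrow> real) \<Rightarrow> ((nat \<Rightarrow> nat \<Rightarrow> real) \<Rightarrow> real) \<Rightarrow> (nat \<Rightarrow> nat \<Rightarrow> real) \<Rightarrow> real" where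
  "replica_diff m V f s = f s * ((\<Sum>l=1..m. V (s l)) - real m * V (s (Suc m)))"

lemma depends_on_first_replica_diff:
  assumes "depends_on_first m f"
  shows "depends_on_first (Suc m) (replica_diff m V f)"
  unfolding depends_on_first_def
proof (intro allI impI)
  fix s s' :: "nat \<Rightarrow> nat \<Rightarrow> real"
  assume *: "\<forall>l\<in>{1..Suc m}. s l = s' l"
  then have "f s = f s'"
    using assms by (auto simp: depends_on_first_def)
  moreover have "(\<Sum>l=1..m. V (s l)) = (\<Sum>l=1..m. V (s' l))"
    using * by (intro sum.cong) auto
  ultimately show "replica_diff m V f s = replica_diff m V f s'"
    using * by (auto simp: replica_diff_def)
qed

lemma boltzmann_has_derivative:
  assumes "\<And>p. p \<in> site_pairs N \<Longrightarrow> ((\<lambda>x. A x p) has_real_derivative A' p) (at x)"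
  shows "((\<lambda>x. boltzmann \<beta> N (A x) \<sigma>) has_real_derivative
    boltzmann \<beta> N (A x) \<sigma> * (\<beta> / sqrt (real N) * (\<Sum>p\<in>site_pairs N. A' p * pair_spin p \<sigma>))) (at x)"
  unfolding boltzmann_eq
  by (rule DERIV_fun_exp, rule DERIV_cmult, rule DERIV_sum, rule DERIV_cmult_right, rule assms)

text \<open>The quotient rule for an arbitrary curve of couplings. The generality is needed because
  it is applied both to moving a single coupling, for integration by parts, and to moving
  \<open>t\<close>.\<close>

lemma gibbs_average_has_derivative:
  assumes A: "\<And>p. p \<in> site_pairs N \<Longrightarrow> ((\<lambda>x. A x p) has_real_derivative A' p) (at x)"
    and f: "depends_on_first m f"
  defines "V \<equiv> \<lambda>\<sigma>. \<Sum>p\<in>site_pairs N. A' p * pair_spin p \<sigma>"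
  shows "((\<lambda>x. gibbs_average \<beta> N (A x) m f) has_real_derivative
    \<beta> / sqrt (real N) * gibbs_average \<beta> N (A x) (Suc m) (replica_diff m V f)) (at x)"
proof -
  define c where "c = \<beta> / sqrt (real N)"
  define Z where "Z = (\<lambda>x. partition_function \<beta> N (A x))"
  define Z' where "Z' = (\<Sum>\<sigma>\<in>spin_configs N. boltzmann \<beta> N (A x) \<sigma> * (c * V \<sigma>))"
  define F where "F = (\<lambda>x. \<Sum>s\<in>replica_configs N m. f s * (\<Prod>l=1..m. boltzmann \<beta> N (A x) (s l)))"
  define F' where "F' = (\<Sum>s\<in>replica_configs N m. f s * ((\<Prod>l=1..m. boltzmann \<beta> N (A x) (s l)) * (\<Sum>l=1..m. c * V (s l))))"
  have b: "((\<lambda>x. boltzmann \<beta> N (A x) \<sigma>) has_real_derivative boltzmann \<beta> N (A x) \<sigma> * (c * V \<sigma>)) (at x)" for \<sigma>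
    unfolding c_def V_def by (rule boltzmann_has_derivative) (rule A)
  have Z: "(Z has_real_derivative Z') (at x)"
    unfolding Z_def Z'_def partition_function_eq by (rule DERIV_sum) (rule b)
  have prod: "((\<lambda>x. \<Prod>l=1..m. boltzmann \<beta> N (A x) (s l)) has_real_derivative
     (\<Prod>l=1..m. boltzmann \<beta> N (A x) (s l)) * (\<Sum>l=1..m. c * V (s l))) (at x)" for s
  proof (induction m)
    case (Suc m)
    show ?case
      using DERIV_mult[OF b[of "s (Suc m)"] Suc] by (simp add: algebra_simps)
  qed simp
  have F: "(F has_real_derivative F') (at x)"
    unfolding F_def F'_def by (intro DERIV_sum DERIV_cmult prod)
  have Zpos: "Z x > 0" by (simp add: Z_def)
  have *: "((\<lambda>x. F x / Z x ^ m) has_real_derivative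
      (F' * Z x ^ m - F x * (real m * Z x ^ (m - 1) * Z')) / (Z x ^ m * Z x ^ m)) (at x)"
    by (rule derivative_eq_intros F Z refl)+ (use Zpos in \<open>auto simp: mult_ac\<close>)
  have "(F' * Z x ^ m - F x * (real m * Z x ^ (m - 1) * Z')) / (Z x ^ m * Z x ^ m)
      = F' / Z x ^ m - real m * (F x / Z x ^ m) * (Z' / Z x)"
  proof (cases m)
    case 0
    then show ?thesis by simp
  next
    case (Suc k)
    then show ?thesis using Zpos by (simp add: field_simps)
  qed
  also have "F' / Z x ^ m = c * gibbs_average \<beta> N (A x) m (\<lambda>s. f s * (\<Sum>l=1..m. V (s l)))"
    unfolding gibbs_average_eq F'_def Z_def by (simp add: mult_ac flip: sum_distrib_left)
  \<comment> \<open>An idle replica is added so that both parts of the derivative live on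
    \<open>m + 1\<close> replicas and can be merged.\<close>
  also have "\<dots> = c * gibbs_average \<beta> N (A x) (Suc m) (\<lambda>s. f s * (\<Sum>l=1..m. V (s l)))"
  proof -
    have "(\<Sum>l=1..m. V (s l)) = (\<Sum>l=1..m. V (s' l))" if "\<forall>l\<in>{1..m}. s l = s' l" for s s' :: "nat \<Rightarrow> nat \<Rightarrow> real"
      using that by (intro sum.cong) auto
    then have "depends_on_first m (\<lambda>s. f s * (\<Sum>l=1..m. V (s l)))"
      using f unfolding depends_on_first_def by metis
    then show ?thesis by (simp add: gibbs_average_Suc_ignore)
  qed
  also have "F x / Z x ^ m = gibbs_average \<beta> N (A x) m f"
    unfolding gibbs_average_eq F_def Z_def ..
  also have "real m * gibbs_average \<beta> N (A x) m f * (Z' / Z x)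
      = c * (real m * (gibbs_average \<beta> N (A x) m f * ((\<Sum>\<sigma>\<in>spin_configs N. V \<sigma> * boltzmann \<beta> N (A x) \<sigma>) / Z x)))"
    unfolding Z'_def by (simp add: sum_distrib_left mult_ac)
  also have "gibbs_average \<beta> N (A x) m f * ((\<Sum>\<sigma>\<in>spin_configs N. V \<sigma> * boltzmann \<beta> N (A x) \<sigma>) / Z x)
      = gibbs_average \<beta> N (A x) (Suc m) (\<lambda>s. f s * V (s (Suc m)))"
    unfolding Z_def by (rule gibbs_average_Suc[OF f, symmetric])
  also have "c * gibbs_average \<beta> N (A x) (Suc m) (\<lambda>s. f s * (\<Sum>l=1..m. V (s l)))
      - c * (real m * gibbs_average \<beta> N (A x) (Suc m) (\<lambda>s. f s * V (s (Suc m))))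
      = c * gibbs_average \<beta> N (A x) (Suc m) (\<lambda>s. f s * (\<Sum>l=1..m. V (s l)) + (- real m) * (f s * V (s (Suc m))))"
    unfolding gibbs_average_add gibbs_average_cmult by (simp add: algebra_simps)
  also have "(\<lambda>s. f s * (\<Sum>l=1..m. V (s l)) + (- real m) * (f s * V (s (Suc m)))) = replica_diff m V f"
    by (simp add: fun_eq_iff replica_diff_def algebra_simps)
  finally show ?thesis
    using * unfolding F_def Z_def gibbs_average_eq c_def by simp
qed

lemma sum_replica_configs_two:
  fixes w :: "(nat \<Rightarrow> real) \<Rightarrow> real"
  assumes "x \<in> {1..m}" "y \<in> {1..m}" "x \<noteq> y"
  shows "(\<Sum>s\<in>replica_configs N m. F (s x) (s y) * (\<Prod>l=1..m. w (s l)))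
    = (\<Sum>\<sigma>\<in>spin_configs N. \<Sum>\<tau>\<in>spin_configs N. F \<sigma> \<tau> * (w \<sigma> * w \<tau>)) * (\<Sum>\<sigma>\<in>spin_configs N. w \<sigma>) ^ (m - 2)"
proof -
  let ?S = "spin_configs N"
  \<comment> \<open>Indicators pin the replicas \<open>x\<close> and \<open>y\<close> to
    \<open>\<sigma>\<close> and \<open>\<tau>\<close>. They are absorbed into the single-replica
    weights, so the sum over all replicas still factorises.\<close>
  define u where "u = (\<lambda>\<sigma> \<tau> l \<rho>. w \<rho> * ((if l = x then of_bool (\<rho> = \<sigma>) else 1) * (if l = y then of_bool (\<rho> = \<tau>) else 1) :: real))"
  have u: "(\<Prod>l=1..m. u \<sigma> \<tau> l (s l)) = (\<Prod>l=1..m. w (s l)) * (of_bool (s x = \<sigma>) * of_bool (s y = \<tau>))" for s \<sigma> \<tau>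
    unfolding u_def prod.distrib using assms by (simp add: prod.delta)
  have "(\<Sum>s\<in>replica_configs N m. F (s x) (s y) * (\<Prod>l=1..m. w (s l)))
      = (\<Sum>s\<in>replica_configs N m. \<Sum>\<sigma>\<in>?S. \<Sum>\<tau>\<in>?S. F \<sigma> \<tau> * (\<Prod>l=1..m. u \<sigma> \<tau> l (s l)))"
  proof (intro sum.cong refl)
    fix s assume "s \<in> replica_configs N m"
    then have "s x \<in> ?S" "s y \<in> ?S" using assms replica_configsD by blast+
    then show "F (s x) (s y) * (\<Prod>l=1..m. w (s l)) = (\<Sum>\<sigma>\<in>?S. \<Sum>\<tau>\<in>?S. F \<sigma> \<tau> * (\<Prod>l=1..m. u \<sigma> \<tau> l (s l)))"
      unfolding u of_bool_def by (simp add: if_distrib[of "(*) _"] sum.delta cong: if_cong)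
  qed
  also have "\<dots> = (\<Sum>\<sigma>\<in>?S. \<Sum>\<tau>\<in>?S. F \<sigma> \<tau> * (\<Sum>s\<in>replica_configs N m. \<Prod>l=1..m. u \<sigma> \<tau> l (s l)))"
    by (subst sum.swap, intro sum.cong refl, subst sum.swap) (simp add: sum_distrib_left)
  also have "\<dots> = (\<Sum>\<sigma>\<in>?S. \<Sum>\<tau>\<in>?S. F \<sigma> \<tau> * (w \<sigma> * w \<tau> * (\<Sum>\<rho>\<in>?S. w \<rho>) ^ (m - 2)))"
  proof (intro sum.cong refl arg_cong2[of _ _ _ _ "(*)"])
    fix \<sigma> \<tau> assume st: "\<sigma> \<in> ?S" "\<tau> \<in> ?S"
    have "(\<Sum>s\<in>replica_configs N m. \<Prod>l=1..m. u \<sigma> \<tau> l (s l)) = (\<Prod>l=1..m. \<Sum>\<rho>\<in>?S. u \<sigma> \<tau> l \<rho>)"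
      unfolding replica_configs_def by (subst prod_sum_PiE) auto
    also have "\<dots> = (\<Sum>\<rho>\<in>?S. u \<sigma> \<tau> x \<rho>) * ((\<Sum>\<rho>\<in>?S. u \<sigma> \<tau> y \<rho>) * (\<Prod>l\<in>{1..m} - {x} - {y}. \<Sum>\<rho>\<in>?S. u \<sigma> \<tau> l \<rho>))"
      using assms by (subst prod.remove[of _ x], simp, simp, subst prod.remove[of _ y]) auto
    also have "(\<Prod>l\<in>{1..m} - {x} - {y}. \<Sum>\<rho>\<in>?S. u \<sigma> \<tau> l \<rho>) = (\<Prod>l\<in>{1..m} - {x} - {y}. \<Sum>\<rho>\<in>?S. w \<rho>)"
      by (intro prod.cong) (auto simp: u_def)
    also have "\<dots> = (\<Sum>\<rho>\<in>?S. w \<rho>) ^ (m - 2)"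
      using assms by (simp add: card_Diff_singleton numeral_2_eq_2)
    also have "(\<Sum>\<rho>\<in>?S. u \<sigma> \<tau> x \<rho>) = w \<sigma>"
      using assms st by (simp add: u_def)
    also have "(\<Sum>\<rho>\<in>?S. u \<sigma> \<tau> y \<rho>) = w \<tau>"
      using assms st by (simp add: u_def)
    finally show "(\<Sum>s\<in>replica_configs N m. \<Prod>l=1..m. u \<sigma> \<tau> l (s l)) = w \<sigma> * w \<tau> * (\<Sum>\<rho>\<in>?S. w \<rho>) ^ (m - 2)"
      by (simp add: mult_ac)
  qed
  finally show ?thesis
    by (simp add: sum_distrib_right sum_distrib_left mult_ac)
qed

text \<open>The other \<open>m - 2\<close> replicas cancel against powers of the partition function.
  What remains is a double sum of the kind that second moments control.\<close>

lemma gibbs_average_two: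
  assumes "x \<in> {1..m}" "y \<in> {1..m}" "x \<noteq> y"
  shows "gibbs_average \<beta> N a m (\<lambda>s. F (s x) (s y))
    = (\<Sum>\<sigma>\<in>spin_configs N. \<Sum>\<tau>\<in>spin_configs N. F \<sigma> \<tau> * (boltzmann \<beta> N a \<sigma> * boltzmann \<beta> N a \<tau>))
       / (partition_function \<beta> N a)\<^sup>2"
proof -
  have "m = (m - 2) + 2"
    using assms by auto
  then have "partition_function \<beta> N a ^ m = partition_function \<beta> N a ^ (m - 2) * (partition_function \<beta> N a)\<^sup>2"
    by (metis power_add)
  then show ?thesis
    unfolding gibbs_average_eq sum_replica_configs_two[OF assms] partition_function_eq[symmetric]
    by simp
qed

section \<open>Standard Gaussian product measures\<close>

definition std_gauss :: "real measure" where
  "std_gauss = density lborel (\<lambda>x. ennreal (std_normal_density x))"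

lemma sets_std_gauss [simp, measurable_cong]: "sets std_gauss = sets borel"
  by (simp add: std_gauss_def)

lemma space_std_gauss [simp]: "space std_gauss = UNIV"
  by (simp add: std_gauss_def)

interpretation std_gauss: prob_space std_gauss
  unfolding std_gauss_def by (rule prob_space_normal_density) simp

interpretation gauss_prod: product_prob_space "\<lambda>_. std_gauss" I for I :: "'i set"
  by unfold_locales

abbreviation gauss :: "'i set \<Rightarrow> ('i \<Rightarrow> real) measure" where
  "gauss I \<equiv> PiM I (\<lambda>_. std_gauss)"

lemma integrable_std_gauss_iff:
  fixes f :: "real \<Rightarrow> real"
  assumes [measurable]: "f \<in> borel_measurable borel"
  shows "integrable std_gauss f \<longleftrightarrow> integrable lborel (\<lambda>x. std_normal_density x * f x)"
  unfolding std_gauss_def by (subst integrable_density) auto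

lemma integral_std_gauss:
  fixes f :: "real \<Rightarrow> real"
  assumes [measurable]: "f \<in> borel_measurable borel"
  shows "integral\<^sup>L std_gauss f = integral\<^sup>L lborel (\<lambda>x. std_normal_density x * f x)"
  unfolding std_gauss_def by (subst integral_density) auto

text \<open>Completing the square: an exponential tilt only shifts the mean, so exponential moments
  reduce to the total mass of a normal density.\<close>

lemma std_normal_density_exp:
  "std_normal_density x * exp (c * x) = exp (c\<^sup>2 / 2) * normal_density c 1 x"
proof -
  have "- x\<^sup>2 / 2 + c * x = c\<^sup>2 / 2 + - (x - c)\<^sup>2 / 2"
    by (simp add: power2_eq_square field_simps)
  then show ?thesis
    by (simp add: normal_density_def exp_add[symmetric])
qed

lemma integrable_std_gauss_exp [simp]: "integrable std_gauss (\<lambda>x. exp (c * x))"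
  by (simp add: integrable_std_gauss_iff std_normal_density_exp)

lemma integral_std_gauss_exp: "(\<integral>x. exp (c * x) \<partial>std_gauss) = exp (c\<^sup>2 / 2)"
  by (simp add: integral_std_gauss std_normal_density_exp)

lemma integrable_std_gauss_exp_abs [simp]: "integrable std_gauss (\<lambda>x. exp (c * \<bar>x\<bar>))"
proof (rule Bochner_Integration.integrable_bound)
  show "integrable std_gauss (\<lambda>x. exp (c * x) + exp ((- c) * x))"
    by (intro Bochner_Integration.integrable_add integrable_std_gauss_exp)
  have "norm (exp (c * \<bar>x\<bar>)) \<le> norm (exp (c * x) + exp ((- c) * x))" for x :: real
    by (cases "x \<ge> 0") (auto simp: abs_of_nonneg add_nonneg_nonneg)
  then show "AE x in std_gauss. norm (exp (c * \<bar>x\<bar>)) \<le> norm (exp (c * x) + exp ((- c) * x))"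
    by simp
qed auto

lemma integrable_std_gauss_id [simp]: "integrable std_gauss (\<lambda>x. x)"
proof (rule Bochner_Integration.integrable_bound)
  show "integrable std_gauss (\<lambda>x. exp (1 * \<bar>x\<bar>))"
    by (rule integrable_std_gauss_exp_abs)
  show "AE x in std_gauss. norm x \<le> norm (exp (1 * \<bar>x\<bar>))"
  proof (rule AE_I2)
    fix x :: real
    show "norm x \<le> norm (exp (1 * \<bar>x\<bar>))"
      using exp_ge_add_one_self[of "\<bar>x\<bar>"] by (simp del: exp_ge_add_one_self)
  qed
qed auto

text \<open>The density has derivative \<open>- x * std_normal_density x\<close>, so the weighted
  difference of the two integrands is the derivative of \<open>std_normal_density x * F x\<close>,
  which vanishes at both ends because \<open>F\<close> is bounded.\<close>

lemma std_gauss_integration_by_parts: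
  fixes F F' :: "real \<Rightarrow> real"
  assumes deriv: "\<And>x. (F has_real_derivative F' x) (at x)"
    and cont: "\<And>x. isCont F' x"
    and bF: "\<And>x. \<bar>F x\<bar> \<le> B" and bF': "\<And>x. \<bar>F' x\<bar> \<le> B"
  shows "(\<integral>x. x * F x \<partial>std_gauss) = (\<integral>x. F' x \<partial>std_gauss)"
proof -
  have contF: "isCont F x" for x
    using deriv by (rule DERIV_isCont)
  have [measurable]: "F \<in> borel_measurable borel" "F' \<in> borel_measurable borel"
    using contF cont by (auto intro!: borel_measurable_continuous_onI continuous_at_imp_continuous_on)
  have iF': "integrable std_gauss F'"
    by (rule std_gauss.integrable_const_bound[of _ B]) (use bF' in auto)
  have iF: "integrable std_gauss (\<lambda>x. x * F x)"
    by (rule Bochner_Integration.integrable_bound[of _ "\<lambda>x. B * x"])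
       (use bF in \<open>auto simp: abs_mult mult.commute[of "\<bar>_\<bar>" "\<bar>F _\<bar>"] intro!: always_eventually mult_right_mono intro: order_trans[OF _ abs_ge_self]\<close>)
  let ?h = "\<lambda>x. std_normal_density x * F x"
  let ?h' = "\<lambda>x. std_normal_density x * F' x - std_normal_density x * (x * F x)"
  have "(std_normal_density has_real_derivative - x * std_normal_density x) (at x)" for x
    unfolding normal_density_def by (auto intro!: derivative_eq_intros simp: field_simps)
  then have h: "(?h has_real_derivative ?h' x) (at x)" for x
    by (rule DERIV_cong[OF DERIV_mult[OF _ deriv]]) (simp add: algebra_simps)
  have h': "integrable lborel ?h'"
    using iF iF' by (intro Bochner_Integration.integrable_diff) (simp_all add: integrable_std_gauss_iff)
  have "0 \<le> B" using bF[of 0] by linarith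
  have lim: "(?h \<longlongrightarrow> 0) at_top" "(?h \<longlongrightarrow> 0) at_bot"
  proof -
    have *: "(?h \<longlongrightarrow> 0) F" if "(std_normal_density \<longlongrightarrow> 0) F" for F
    proof (rule Lim_null_comparison)
      show "((\<lambda>x. std_normal_density x * B) \<longlongrightarrow> 0) F"
        using that by (rule tendsto_mult_left_zero)
      have "norm (?h x) \<le> std_normal_density x * B" for x
        using bF[of x] by (simp add: abs_mult mult_left_mono)
      then show "\<forall>\<^sub>F x in F. norm (?h x) \<le> std_normal_density x * B"
        by (intro always_eventually) blast
    qed
    have "(std_normal_density \<longlongrightarrow> 0) at_top" "(std_normal_density \<longlongrightarrow> 0) at_bot"
      unfolding normal_density_def by real_asymp+
    then show "(?h \<longlongrightarrow> 0) at_top" "(?h \<longlongrightarrow> 0) at_bot"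
      by (auto intro: *)
  qed
  have "(LBINT x=-\<infinity>..\<infinity>. ?h' x) = 0 - 0"
  proof (rule interval_integral_FTC_integrable[where F = ?h])
    show "(?h has_vector_derivative ?h' x) (at x)" for x
      using h by (simp add: has_real_derivative_iff_has_vector_derivative)
    show "isCont ?h' x" for x
      unfolding normal_density_def using contF cont by (auto intro!: continuous_intros)
    show "set_integrable lborel (einterval (- \<infinity>) \<infinity>) ?h'"
      using h' by (simp add: set_integrable_def)
    show "((?h \<circ> real_of_ereal) \<longlongrightarrow> 0) (at_right (- \<infinity>))" "((?h \<circ> real_of_ereal) \<longlongrightarrow> 0) (at_left \<infinity>)"
      using lim by (simp_all add: ereal_tendsto_simps)
  qed simp
  then have "integral\<^sup>L lborel ?h' = 0"
    by (simp add: interval_lebesgue_integral_def set_lebesgue_integral_def)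
  then show ?thesis
    using iF iF' by (simp add: integral_std_gauss integrable_std_gauss_iff)
qed

section \<open>Finite products of the standard Gaussian\<close>

lemma prob_space_gauss: "prob_space (gauss I)"
  by (intro prob_space_PiM std_gauss.prob_space_axioms)

lemma integrable_gauss_bounded:
  fixes F :: "('i \<Rightarrow> real) \<Rightarrow> real"
  assumes "F \<in> borel_measurable (gauss I)" "\<And>a. \<bar>F a\<bar> \<le> B"
  shows "integrable (gauss I) F"
  by (rule gauss_prod.integrable_const_bound[of _ B]) (use assms in auto)

lemma integrable_gauss_component:
  assumes "p \<in> I"
  shows "integrable (gauss I) (\<lambda>a. a p)"
proof -
  have "integrable (distr (gauss I) std_gauss (\<lambda>a. a p)) (\<lambda>x. x)"
    using assms by (subst gauss_prod.PiM_component) auto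
  then show ?thesis
    using assms by (subst (asm) integrable_distr_eq) auto
qed

text \<open>Fubini isolates the coordinate \<open>p\<close>; the one-dimensional identity then
  applies with the other coordinates frozen.\<close>

lemma gauss_integration_by_parts:
  fixes F F' :: "('i \<Rightarrow> real) \<Rightarrow> real"
  assumes "finite I" "p \<in> I"
    and F [measurable]: "F \<in> borel_measurable (gauss I)" and F' [measurable]: "F' \<in> borel_measurable (gauss I)"
    and deriv: "\<And>a x. ((\<lambda>x. F (a(p := x))) has_real_derivative F' (a(p := x))) (at x)"
    and cont: "\<And>a x. isCont (\<lambda>x. F' (a(p := x))) x"
    and bF: "\<And>a. \<bar>F a\<bar> \<le> B" and bF': "\<And>a. \<bar>F' a\<bar> \<le> B"
  shows "(\<integral>a. a p * F a \<partial>gauss I) = (\<integral>a. F' a \<partial>gauss I)"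
proof -
  obtain J where I: "I = insert p J" and J: "finite J" "p \<notin> J"
    using assms(1,2) by (metis finite_insert mk_disjoint_insert)
  have iF': "integrable (gauss I) F'"
    by (rule integrable_gauss_bounded[OF F' bF'])
  have iF: "integrable (gauss I) (\<lambda>a. a p * F a)"
  proof (rule Bochner_Integration.integrable_bound)
    show "integrable (gauss I) (\<lambda>a. B * a p)"
      using integrable_gauss_component[OF assms(2)] by simp
    show "AE a in gauss I. norm (a p * F a) \<le> norm (B * a p)"
      using bF by (auto simp: abs_mult mult.commute[of _ "\<bar>F _\<bar>"] intro!: always_eventually mult_right_mono intro: order_trans[OF _ abs_ge_self])
    show "(\<lambda>a. a p * F a) \<in> borel_measurable (gauss I)"
      using assms(2) by measurable
  qed
  have "(\<integral>a. a p * F a \<partial>gauss I) = (\<integral>a. \<integral>x. x * F (a(p := x)) \<partial>std_gauss \<partial>gauss J)"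
    using gauss_prod.product_integral_insert[OF J, of "\<lambda>a. a p * F a"] iF
    by (simp add: I)
  also have "\<dots> = (\<integral>a. \<integral>x. F' (a(p := x)) \<partial>std_gauss \<partial>gauss J)"
    by (intro Bochner_Integration.integral_cong refl std_gauss_integration_by_parts[where B = B] deriv cont bF bF')
  also have "\<dots> = (\<integral>a. F' a \<partial>gauss I)"
    using gauss_prod.product_integral_insert[OF J, of F'] iF' by (simp add: I)
  finally show ?thesis .
qed

lemma integrable_gauss_exp_sum:
  assumes "finite I"
  shows "integrable (gauss I) (\<lambda>a. exp (\<Sum>p\<in>I. c p * a p))"
proof -
  have "integrable (gauss I) (\<lambda>a. \<Prod>p\<in>I. exp (c p * a p))"
    by (intro gauss_prod.product_integrable_prod assms integrable_std_gauss_exp)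
  then show ?thesis using assms by (simp add: exp_sum)
qed

lemma integral_gauss_exp_sum:
  assumes "finite I"
  shows "(\<integral>a. exp (\<Sum>p\<in>I. c p * a p) \<partial>gauss I) = exp ((\<Sum>p\<in>I. (c p)\<^sup>2) / 2)"
proof -
  have "(\<integral>a. (\<Prod>p\<in>I. exp (c p * a p)) \<partial>gauss I) = (\<Prod>p\<in>I. \<integral>x. exp (c p * x) \<partial>std_gauss)"
    by (intro gauss_prod.product_integral_prod assms integrable_std_gauss_exp)
  then show ?thesis using assms by (simp add: exp_sum integral_std_gauss_exp sum_divide_distrib)
qed

text \<open>The mean value inequality bounds the difference quotients by \<open>B\<close>, so
  dominated convergence applies along every sequence tending to \<open>t\<close>.\<close>

lemma has_derivative_integral_dominated:
  fixes f f' :: "real \<Rightarrow> 'a \<Rightarrow> real"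
  assumes S: "open S" "convex S" "t \<in> S"
    and int: "\<And>x. x \<in> S \<Longrightarrow> integrable M (f x)"
    and meas: "f' t \<in> borel_measurable M"
    and deriv: "\<And>x a. x \<in> S \<Longrightarrow> a \<in> space M \<Longrightarrow> ((\<lambda>x. f x a) has_real_derivative f' x a) (at x)"
    and bound: "\<And>x a. x \<in> S \<Longrightarrow> a \<in> space M \<Longrightarrow> \<bar>f' x a\<bar> \<le> B a"
    and B: "integrable M B"
  shows "((\<lambda>x. \<integral>a. f x a \<partial>M) has_real_derivative (\<integral>a. f' t a \<partial>M)) (at t)"
proof -
  have lip: "\<bar>f x a - f t a\<bar> \<le> B a * \<bar>x - t\<bar>" if "x \<in> S" "a \<in> space M" for x a
  proof -
    have "norm (f x a - f t a) \<le> B a * norm (x - t)"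
      by (rule field_differentiable_bound[OF S(2), where f = "\<lambda>x. f x a" and f' = "\<lambda>x. f' x a"])
         (use that S(3) bound deriv in \<open>auto intro: has_field_derivative_at_within\<close>)
    then show ?thesis by simp
  qed
  have "((\<lambda>x. ((\<integral>a. f x a \<partial>M) - (\<integral>a. f t a \<partial>M)) / (x - t)) \<longlongrightarrow> (\<integral>a. f' t a \<partial>M)) (at t)"
    unfolding tendsto_at_iff_sequentially
  proof (intro allI impI, unfold o_def)
    fix X :: "nat \<Rightarrow> real"
    assume X: "\<forall>i. X i \<in> UNIV - {t}" "X \<longlonglongrightarrow> t"
    have "eventually (\<lambda>i. X i \<in> S) sequentially"
      using X(2) S(1,3) by (rule topological_tendstoD)
    then obtain n0 where n0: "\<And>i. i \<ge> n0 \<Longrightarrow> X i \<in> S"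
      by (auto simp: eventually_sequentially)
    let ?X = "\<lambda>i. X (i + n0)"
    have XS: "?X i \<in> S" and Xt: "?X i \<noteq> t" for i using n0 X by auto
    have "(\<lambda>i. \<integral>a. (f (?X i) a - f t a) / (?X i - t) \<partial>M) \<longlonglongrightarrow> (\<integral>a. f' t a \<partial>M)"
    proof (rule integral_dominated_convergence[OF meas _ B])
      show "(\<lambda>a. (f (?X i) a - f t a) / (?X i - t)) \<in> borel_measurable M" for i
        using int[OF XS[of i]] int[OF S(3)] by measurable
      show "AE a in M. norm ((f (?X i) a - f t a) / (?X i - t)) \<le> B a" for i
        using lip[OF XS[of i]] Xt[of i] by (auto simp: abs_divide divide_le_eq)
      show "AE a in M. (\<lambda>i. (f (?X i) a - f t a) / (?X i - t)) \<longlonglongrightarrow> f' t a"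
      proof (rule AE_I2)
        fix a assume "a \<in> space M"
        then have "((\<lambda>x. (f x a - f t a) / (x - t)) \<longlongrightarrow> f' t a) (at t)"
          using deriv[OF S(3)] by (simp add: has_field_derivative_iff)
        moreover have "?X \<longlonglongrightarrow> t"
          using X(2) by (rule LIMSEQ_ignore_initial_segment)
        ultimately show "(\<lambda>i. (f (?X i) a - f t a) / (?X i - t)) \<longlonglongrightarrow> f' t a"
          unfolding tendsto_at_iff_sequentially using Xt by (auto simp: o_def)
      qed
    qed
    moreover have "(\<integral>a. (f (?X i) a - f t a) / (?X i - t) \<partial>M)
        = ((\<integral>a. f (?X i) a \<partial>M) - (\<integral>a. f t a \<partial>M)) / (?X i - t)" for i
      using int[OF XS[of i]] int[OF S(3)] by (simp only: integral_divide_zero Bochner_Integration.integral_diff)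
    ultimately have "(\<lambda>i. ((\<integral>a. f (?X i) a \<partial>M) - (\<integral>a. f t a \<partial>M)) / (?X i - t)) \<longlonglongrightarrow> (\<integral>a. f' t a \<partial>M)"
      by (simp only:)
    then show "(\<lambda>i. ((\<integral>a. f (X i) a \<partial>M) - (\<integral>a. f t a \<partial>M)) / (X i - t)) \<longlonglongrightarrow> (\<integral>a. f' t a \<partial>M)"
      by (rule LIMSEQ_offset)
  qed
  then show ?thesis
    by (simp add: has_field_derivative_iff)
qed

text \<open>Symmetrise the double integral of \<open>F x / F y\<close>: with \<open>r\<close> this
  ratio, \<open>r + 1 / r\<close> is largest at the ends of its range and is there
  \<open>2 * cosh (c * (x - y))\<close>, whose mean over two independent Gaussians is
  \<open>2 * exp (c\<^sup>2)\<close>. Bounding the ratio without symmetrising would lose a term of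
  first order in \<open>c\<close>, too much when multiplied over order N^2 couplings with
  \<open>c\<close> of order N^(-1/2).\<close>

lemma std_gauss_product_with_inverse:
  fixes F :: "real \<Rightarrow> real"
  assumes [measurable]: "F \<in> borel_measurable borel"
    and pos: "\<And>x. F x > 0" and ratio: "\<And>x y. F x \<le> exp (c * \<bar>x - y\<bar>) * F y"
  shows "integrable std_gauss F" "integrable std_gauss (\<lambda>x. 1 / F x)"
    and "(\<integral>x. F x \<partial>std_gauss) * (\<integral>x. 1 / F x \<partial>std_gauss) \<le> exp (c\<^sup>2)"
proof -
  have ratio': "1 / F x \<le> exp (c * \<bar>x - y\<bar>) * (1 / F y)" for x y
    using ratio[of y x] pos[of x] pos[of y] by (simp add: field_simps abs_minus_commute)
  show i1: "integrable std_gauss F"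
    by (rule Bochner_Integration.integrable_bound[of _ "\<lambda>x. F 0 * exp (c * \<bar>x\<bar>)"])
       (use ratio[of _ 0] pos in \<open>auto simp: abs_of_pos less_imp_le mult.commute intro!: always_eventually\<close>)
  show i2: "integrable std_gauss (\<lambda>x. 1 / F x)"
    by (rule Bochner_Integration.integrable_bound[of _ "\<lambda>x. 1 / F 0 * exp (c * \<bar>x\<bar>)"])
       (use ratio'[of _ 0] pos in \<open>auto simp: abs_of_pos less_imp_le mult.commute intro!: always_eventually\<close>)
  define A where "A = (\<integral>x. F x \<partial>std_gauss)"
  define B where "B = (\<integral>x. 1 / F x \<partial>std_gauss)"
  have sym: "F x / F y + F y / F x \<le> exp (c * x) * exp ((- c) * y) + exp ((- c) * x) * exp (c * y)" for x y
  proof -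
    define r where "r = F x / F y"
    define e where "e = exp (c * \<bar>x - y\<bar>)"
    have r: "r > 0" "r \<le> e" "1 / r \<le> e" and e: "e > 0"
      using pos ratio[of x y] ratio[of y x] by (auto simp: r_def e_def field_simps abs_minus_commute)
    \<comment> \<open>Both factors are nonnegative because \<open>r\<close> and \<open>1 / r\<close>
      are at most \<open>e\<close>; expanding the product gives the maximality of
      \<open>r + 1 / r\<close> at \<open>r = e\<close>.\<close>
    have "0 \<le> (e - r) * (1 - 1 / (r * e))"
      using r e by (intro mult_nonneg_nonneg) (auto simp: field_simps)
    also have "\<dots> = e + 1 / e - (r + 1 / r)"
      using r e by (simp add: field_simps)
    finally have "r + 1 / r \<le> e + 1 / e" by simp
    also have "e + 1 / e = exp (c * (x - y)) + exp (- (c * (x - y)))"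
      by (auto simp: e_def abs_if exp_minus field_simps exp_diff)
    also have "\<dots> = exp (c * x) * exp ((- c) * y) + exp ((- c) * x) * exp (c * y)"
      by (simp add: exp_add[symmetric] algebra_simps)
    finally show ?thesis by (simp add: r_def)
  qed
  have inner: "F x * B + 1 / F x * A \<le> exp (c\<^sup>2 / 2) * (exp (c * x) + exp ((- c) * x))" for x
  proof -
    have "F x * B + 1 / F x * A = (\<integral>y. F x * (1 / F y) + 1 / F x * F y \<partial>std_gauss)"
      unfolding A_def B_def
      by (simp only: integral_mult_right_zero Bochner_Integration.integral_add integrable_mult_right i1 i2)
    also have "\<dots> \<le> (\<integral>y. exp (c * x) * exp ((- c) * y) + exp ((- c) * x) * exp (c * y) \<partial>std_gauss)"
      using sym[of x] by (intro integral_mono Bochner_Integration.integrable_add integrable_mult_right i1 i2 integrable_std_gauss_exp) simp_all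
    also have "\<dots> = exp (c * x) * exp ((- c)\<^sup>2 / 2) + exp ((- c) * x) * exp (c\<^sup>2 / 2)"
      by (subst Bochner_Integration.integral_add)
         (simp_all only: integral_mult_right_zero integral_std_gauss_exp integrable_mult_right integrable_std_gauss_exp)
    finally show ?thesis by (simp add: algebra_simps)
  qed
  have "A * B + B * A = (\<integral>x. F x * B + 1 / F x * A \<partial>std_gauss)"
    unfolding A_def B_def
    by (simp only: integral_mult_right_zero integral_mult_left_zero Bochner_Integration.integral_add
        integrable_mult_right integrable_mult_left i1 i2)
  also have "\<dots> \<le> (\<integral>x. exp (c\<^sup>2 / 2) * (exp (c * x) + exp ((- c) * x)) \<partial>std_gauss)"
    by (intro integral_mono Bochner_Integration.integrable_add integrable_mult_right integrable_mult_left i1 i2 integrable_std_gauss_exp inner)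
  also have "\<dots> = exp (c\<^sup>2 / 2) * (exp (c\<^sup>2 / 2) + exp ((- c)\<^sup>2 / 2))"
    by (simp only: integral_mult_right_zero Bochner_Integration.integral_add integrable_std_gauss_exp integral_std_gauss_exp)
  also have "\<dots> = exp (c\<^sup>2) + exp (c\<^sup>2)"
    by (simp add: algebra_simps flip: exp_add)
  finally show "(\<integral>x. F x \<partial>std_gauss) * (\<integral>x. 1 / F x \<partial>std_gauss) \<le> exp (c\<^sup>2)"
    unfolding A_def B_def by (simp add: mult.commute)
qed

text \<open>Coordinates are switched from \<open>b\<close> to \<open>a\<close> one at a time, each
  switch costing its own exponential factor.\<close>

lemma coordinatewise_ratio_bound:
  fixes F :: "('i \<Rightarrow> real) \<Rightarrow> real"
  assumes "finite J" "J \<subseteq> I"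
    and ratio: "\<And>a p x y. p \<in> I \<Longrightarrow> F (a(p := x)) \<le> exp (c p * \<bar>x - y\<bar>) * F (a(p := y))"
  shows "F (\<lambda>p. if p \<in> J then a p else b p) \<le> exp (\<Sum>p\<in>J. c p * \<bar>a p - b p\<bar>) * F b"
  using assms(1,2)
proof (induction J rule: finite_induct)
  case empty
  then show ?case by simp
next
  case (insert q J)
  let ?g = "\<lambda>p. if p \<in> J then a p else b p"
  have "(\<lambda>p. if p \<in> insert q J then a p else b p) = ?g(q := a q)" "?g = ?g(q := b q)"
    using insert.hyps by (auto simp: fun_eq_iff)
  then have "F (\<lambda>p. if p \<in> insert q J then a p else b p) \<le> exp (c q * \<bar>a q - b q\<bar>) * F ?g"
    using ratio[of q ?g "a q" "b q"] insert.prems by simp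
  also have "\<dots> \<le> exp (c q * \<bar>a q - b q\<bar>) * (exp (\<Sum>p\<in>J. c p * \<bar>a p - b p\<bar>) * F b)"
    using insert by (intro mult_left_mono) auto
  finally show ?case
    using insert.hyps by (simp add: exp_add mult.assoc)
qed

lemma integrable_gauss_ratio:
  fixes F :: "('i \<Rightarrow> real) \<Rightarrow> real"
  assumes "finite I" and meas: "F \<in> borel_measurable (gauss I)" and pos: "\<And>a. F a > 0"
    and ratio: "\<And>a p x y. p \<in> I \<Longrightarrow> F (a(p := x)) \<le> exp (c p * \<bar>x - y\<bar>) * F (a(p := y))"
  shows "integrable (gauss I) F"
proof (rule Bochner_Integration.integrable_bound)
  \<comment> \<open>Points of the product space are \<open>undefined\<close> off \<open>I\<close>.
    With the same default in \<open>b\<close>, switching all coordinates of \<open>I\<close> gives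
    back \<open>a\<close> itself.\<close>
  define b :: "'i \<Rightarrow> real" where "b = (\<lambda>p. if p \<in> I then 0 else undefined)"
  have "integrable (gauss I) (\<lambda>a. (\<Prod>p\<in>I. exp (c p * \<bar>a p\<bar>)))"
    by (intro gauss_prod.product_integrable_prod assms(1) integrable_std_gauss_exp_abs)
  then show "integrable (gauss I) (\<lambda>a. F b * (\<Prod>p\<in>I. exp (c p * \<bar>a p\<bar>)))"
    by simp
  show "AE a in gauss I. norm (F a) \<le> norm (F b * (\<Prod>p\<in>I. exp (c p * \<bar>a p\<bar>)))"
  proof (rule AE_I2)
    fix a assume "a \<in> space (gauss I)"
    then have "a = (\<lambda>p. if p \<in> I then a p else b p)"
      by (auto simp: space_PiM PiE_def extensional_def b_def fun_eq_iff)
    then have "F a \<le> exp (\<Sum>p\<in>I. c p * \<bar>a p - b p\<bar>) * F b"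
      using coordinatewise_ratio_bound[OF assms(1) subset_refl ratio, of a b] by simp
    also have "(\<Sum>p\<in>I. c p * \<bar>a p - b p\<bar>) = (\<Sum>p\<in>I. c p * \<bar>a p\<bar>)"
      by (simp add: b_def)
    finally show "norm (F a) \<le> norm (F b * (\<Prod>p\<in>I. exp (c p * \<bar>a p\<bar>)))"
      using pos[of a] pos[of b] assms(1) by (simp add: exp_sum abs_mult abs_prod mult.commute)
  qed
qed (rule meas)

text \<open>The one-dimensional bound tensorises. Averaging out one coordinate preserves the ratio
  condition in the others, and the mean of \<open>1 / F\<close> over that coordinate is at most
  \<open>exp ((c p)\<^sup>2)\<close> divided by the mean of \<open>F\<close> over it.\<close>

lemma gauss_product_with_inverse:
  fixes F :: "('i \<Rightarrow> real) \<Rightarrow> real"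
  assumes "finite I" and "\<And>p. c p \<ge> 0" and "F \<in> borel_measurable (gauss I)" and "\<And>a. F a > 0"
    and "\<And>a p x y. p \<in> I \<Longrightarrow> F (a(p := x)) \<le> exp (c p * \<bar>x - y\<bar>) * F (a(p := y))"
  shows "(\<integral>a. F a \<partial>gauss I) * (\<integral>a. 1 / F a \<partial>gauss I) \<le> exp (\<Sum>p\<in>I. (c p)\<^sup>2)"
  using assms
proof (induction I arbitrary: F rule: finite_induct)
  case empty
  then show ?case
    by (simp add: PiM_empty lebesgue_integral_count_space_finite less_imp_neq[THEN not_sym])
next
  case (insert p J)
  note [measurable] = insert.prems(2)
  have pos: "F a > 0" for a by (rule insert.prems)
  have ratio: "F (a(q := x)) \<le> exp (c q * \<bar>x - y\<bar>) * F (a(q := y))" if "q \<in> insert p J" for a q x y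
    by (rule insert.prems(4)[OF that])
  have ratio': "1 / F (a(q := x)) \<le> exp (c q * \<bar>x - y\<bar>) * (1 / F (a(q := y)))" if "q \<in> insert p J" for a q x y
    using ratio[OF that, of a y x] pos[of "a(q := x)"] pos[of "a(q := y)"] by (simp add: field_simps abs_minus_commute)
  have int: "integrable (gauss (insert p J)) F" "integrable (gauss (insert p J)) (\<lambda>a. 1 / F a)"
    using insert.hyps(1) ratio ratio' pos
    by (auto intro!: integrable_gauss_ratio[where c = c and F = F] integrable_gauss_ratio[where c = c and F = "\<lambda>a. 1 / F a"])
  have m [measurable]: "(\<lambda>(a, x). F (a(p := x))) \<in> borel_measurable (gauss J \<Otimes>\<^sub>M std_gauss)"
    using measurable_compose[OF measurable_add_dim insert.prems(2)] by (simp add: case_prod_unfold)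
  define r where "r = (\<lambda>a x. F (a(p := x)))"
  have r [measurable]: "r a \<in> borel_measurable borel" if "a \<in> space (gauss J)" for a
    using measurable_compose[OF measurable_Pair1'[OF that] m] by (simp add: r_def cong: measurable_cong_sets)
  have one: "integrable std_gauss (r a)" "integrable std_gauss (\<lambda>x. 1 / r a x)"
    "(\<integral>x. r a x \<partial>std_gauss) * (\<integral>x. 1 / r a x \<partial>std_gauss) \<le> exp ((c p)\<^sup>2)"
    if "a \<in> space (gauss J)" for a
  proof -
    have "0 < r a x" "r a x \<le> exp (c p * \<bar>x - y\<bar>) * r a y" for x y
      using ratio[of p a] pos by (auto simp: r_def)
    note * = std_gauss_product_with_inverse[OF r[OF that] this]
    show "integrable std_gauss (r a)" "integrable std_gauss (\<lambda>x. 1 / r a x)"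
      "(\<integral>x. r a x \<partial>std_gauss) * (\<integral>x. 1 / r a x \<partial>std_gauss) \<le> exp ((c p)\<^sup>2)"
      by (fact *)+
  qed
  \<comment> \<open>The induction hypothesis asks for positivity and the ratio bound at every
    function, also outside the product space, where \<open>r a\<close> is not known to be
    measurable. The value 1 there satisfies both.\<close>
  define G where "G = (\<lambda>a. if a \<in> space (gauss J) then \<integral>x. r a x \<partial>std_gauss else 1)"
  have "G \<in> borel_measurable (gauss J) \<longleftrightarrow> (\<lambda>a. \<integral>x. r a x \<partial>std_gauss) \<in> borel_measurable (gauss J)"
    by (intro measurable_cong) (simp add: G_def)
  then have Gm: "G \<in> borel_measurable (gauss J)"
    using m by (simp add: r_def)
  have Gpos: "G a > 0" for a
    using std_gauss.expectation_greater[of "r a" 0] one(1) pos by (auto simp: G_def r_def)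
  have Gratio: "G (a(q := x)) \<le> exp (c q * \<bar>x - y\<bar>) * G (a(q := y))" if "q \<in> J" for a q x y
  proof (cases "a(q := x) \<in> space (gauss J)")
    case True
    then have True': "a(q := y) \<in> space (gauss J)"
      using that by (auto simp: space_PiM PiE_def extensional_def split: if_splits)
    have "q \<noteq> p" using that insert.hyps by auto
    then have "r (a(q := x)) z \<le> exp (c q * \<bar>x - y\<bar>) * r (a(q := y)) z" for z
      using that ratio[of q "a(p := z)" x y] by (simp add: r_def fun_upd_twist[of q p])
    then have "(\<integral>z. r (a(q := x)) z \<partial>std_gauss) \<le> (\<integral>z. exp (c q * \<bar>x - y\<bar>) * r (a(q := y)) z \<partial>std_gauss)"
      by (intro integral_mono integrable_mult_right one True True')
    then show ?thesis
      using True True' by (simp add: G_def)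
  next
    case False
    then have "a(q := y) \<notin> space (gauss J)"
      using that by (auto simp: space_PiM PiE_def extensional_def split: if_splits)
    with False show ?thesis
      using insert.prems(1)[of q] by (simp add: G_def)
  qed
  have Ginv: "integrable (gauss J) (\<lambda>a. 1 / G a)"
  proof (rule integrable_gauss_ratio[where c = c])
    show "1 / G (a(q := x)) \<le> exp (c q * \<bar>x - y\<bar>) * (1 / G (a(q := y)))" if "q \<in> J" for a q x y
      using Gratio[OF that, of a y x] Gpos[of "a(q := x)"] Gpos[of "a(q := y)"]
      by (simp add: field_simps abs_minus_commute)
  qed (use Gm Gpos insert.hyps in auto)
  have "(\<integral>a. F a \<partial>gauss (insert p J)) = (\<integral>a. G a \<partial>gauss J)"
    using gauss_prod.product_integral_insert[OF insert.hyps int(1)]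
    by (simp add: G_def r_def cong: Bochner_Integration.integral_cong)
  moreover have "(\<integral>a. 1 / F a \<partial>gauss (insert p J)) \<le> (\<integral>a. exp ((c p)\<^sup>2) * (1 / G a) \<partial>gauss J)"
    unfolding gauss_prod.product_integral_insert[OF insert.hyps int(2)]
  proof (rule integral_mono')
    fix a assume a: "a \<in> space (gauss J)"
    show "(\<integral>x. 1 / F (a(p := x)) \<partial>std_gauss) \<le> exp ((c p)\<^sup>2) * (1 / G a)"
      using one(3)[OF a] Gpos[of a] a by (simp add: G_def r_def field_simps)
    show "0 \<le> exp ((c p)\<^sup>2) * (1 / G a)"
      using Gpos[of a] by simp
  qed (rule integrable_mult_right[OF Ginv])
  moreover have "0 \<le> (\<integral>a. G a \<partial>gauss J)"
    using Gpos by (simp add: less_imp_le)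
  ultimately have "(\<integral>a. F a \<partial>gauss (insert p J)) * (\<integral>a. 1 / F a \<partial>gauss (insert p J))
      \<le> exp ((c p)\<^sup>2) * ((\<integral>a. G a \<partial>gauss J) * (\<integral>a. 1 / G a \<partial>gauss J))"
    by (simp only: integral_mult_right_zero mult.left_commute[of "exp _"] mult_left_mono)
  also have "\<dots> \<le> exp ((c p)\<^sup>2) * exp (\<Sum>p\<in>J. (c p)\<^sup>2)"
    using insert.IH[OF insert.prems(1) Gm Gpos Gratio] by simp
  finally show ?case
    using insert.hyps by (simp add: exp_add)
qed

section \<open>Interpolating the couplings of the last spin\<close>

text \<open>Pairs are increasing, so \<open>snd p = N\<close> selects the couplings of the last
  spin. With \<open>sqrt t\<close> their variance is linear in \<open>t\<close>, and the factor
  \<open>1 / sqrt t\<close> of the chain rule cancels after integration by parts.\<close>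

definition interp :: "nat \<Rightarrow> real \<Rightarrow> (nat \<times> nat \<Rightarrow> real) \<Rightarrow> nat \<times> nat \<Rightarrow> real" where
  "interp N t a p = (if snd p = N then sqrt t * a p else a p)"

lemma interp_1 [simp]: "interp N 1 a = a"
  by (simp add: interp_def fun_eq_iff)

text \<open>The couplings are integrated against their canonical product law. Terms and constants
  derived from it cannot depend on the probability spaces, which may vary with
  \<open>N\<close>.\<close>

definition nu_interp ::
    "real \<Rightarrow> nat \<Rightarrow> real \<Rightarrow> nat \<Rightarrow> ((nat \<Rightarrow> nat \<Rightarrow> real) \<Rightarrow> real) \<Rightarrow> real" where
  "nu_interp \<beta> N t m f = (\<integral>a. gibbs_average \<beta> N (interp N t a) m f \<partial>gauss (site_pairs N))"

lemma measurable_boltzmann_interp [measurable]: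
  "(\<lambda>a. boltzmann \<beta> N (interp N t a) \<sigma>) \<in> borel_measurable (gauss (site_pairs N))"
proof -
  have "(\<lambda>a. interp N t a p) \<in> borel_measurable (gauss (site_pairs N))" if "p \<in> site_pairs N" for p
    unfolding interp_def using that by measurable
  then show ?thesis
    unfolding boltzmann_eq
    by (intro measurable_compose[OF _ borel_measurable_exp] borel_measurable_times borel_measurable_sum) auto
qed

lemma measurable_partition_function_interp [measurable]:
  "(\<lambda>a. partition_function \<beta> N (interp N t a)) \<in> borel_measurable (gauss (site_pairs N))"
  unfolding partition_function_eq by measurable

lemma measurable_gibbs_average_interp [measurable]:
  "(\<lambda>a. gibbs_average \<beta> N (interp N t a) m f) \<in> borel_measurable (gauss (site_pairs N))"
  unfolding gibbs_average_eq by measurable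

lemma integrable_gibbs_average_interp [simp]:
  "integrable (gauss (site_pairs N)) (\<lambda>a. gibbs_average \<beta> N (interp N t a) m f)"
  by (rule integrable_gauss_bounded[OF _ gibbs_average_abs_bound]) measurable

lemma nu_interp_cong:
  "(\<And>s. s \<in> replica_configs N m \<Longrightarrow> f s = h s) \<Longrightarrow> nu_interp \<beta> N t m f = nu_interp \<beta> N t m h"
  unfolding nu_interp_def by (rule Bochner_Integration.integral_cong[OF refl]) (rule gibbs_average_cong)

lemma nu_interp_more_replicas:
  "depends_on_first m f \<Longrightarrow> m \<le> m' \<Longrightarrow> nu_interp \<beta> N t m' f = nu_interp \<beta> N t m f"
  unfolding nu_interp_def by (rule Bochner_Integration.integral_cong[OF refl]) (rule gibbs_average_more_replicas)

lemma nu_interp_add: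
  "nu_interp \<beta> N t m (\<lambda>s. f s + h s) = nu_interp \<beta> N t m f + nu_interp \<beta> N t m h"
  unfolding nu_interp_def gibbs_average_add by simp

lemma nu_interp_cmult: "nu_interp \<beta> N t m (\<lambda>s. c * f s) = c * nu_interp \<beta> N t m f"
  unfolding nu_interp_def gibbs_average_cmult by simp

lemma nu_interp_sum:
  "nu_interp \<beta> N t m (\<lambda>s. \<Sum>i\<in>A. f i s) = (\<Sum>i\<in>A. nu_interp \<beta> N t m (f i))"
  unfolding nu_interp_def gibbs_average_sum by simp

lemma nu_interp_sum_list:
  "nu_interp \<beta> N t m (\<lambda>s. \<Sum>x\<leftarrow>L. f x s) = (\<Sum>x\<leftarrow>L. nu_interp \<beta> N t m (f x))"
proof (induction L)
  case Nil
  show ?case by (simp add: nu_interp_def)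
next
  case (Cons x L)
  then show ?case by (simp add: nu_interp_add)
qed

lemma nu_interp_const [simp]: "nu_interp \<beta> N t m (\<lambda>_. c) = c"
  unfolding nu_interp_def by (simp add: prob_space.prob_space[OF prob_space_gauss])

lemma nu_interp_mono:
  "(\<And>s. s \<in> replica_configs N m \<Longrightarrow> f s \<le> h s) \<Longrightarrow> nu_interp \<beta> N t m f \<le> nu_interp \<beta> N t m h"
  unfolding nu_interp_def by (intro integral_mono gibbs_average_mono) auto

lemma nu_interp_abs_le: "\<bar>nu_interp \<beta> N t m f\<bar> \<le> nu_interp \<beta> N t m (\<lambda>s. \<bar>f s\<bar>)"
proof -
  have "\<bar>nu_interp \<beta> N t m f\<bar> \<le> (\<integral>a. \<bar>gibbs_average \<beta> N (interp N t a) m f\<bar> \<partial>gauss (site_pairs N))"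
    unfolding nu_interp_def by (rule integral_abs_bound)
  also have "\<dots> \<le> nu_interp \<beta> N t m (\<lambda>s. \<bar>f s\<bar>)"
    unfolding nu_interp_def by (intro integral_mono gibbs_average_abs_le) auto
  finally show ?thesis .
qed

text \<open>Independence together with the Gaussian marginals identifies the joint law of the
  couplings with the product law. From \<open>N = 2\<close> on the index set is nonempty, as the
  characterisation of independence by product laws requires.\<close>

lemma nu_eq_nu_interp:
  assumes "gaussian_disorder N M g" and "2 \<le> N"
  shows "nu \<beta> N M g m f = nu_interp \<beta> N 1 m f"
proof -
  interpret prob_space M
    using assms by (simp add: gaussian_disorder_def)
  let ?P = "site_pairs N"
  have "(1, 2) \<in> ?P" using assms(2) by (simp add: site_pairs_def)
  then have ne: "?P \<noteq> {}" by blast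
  have rv: "random_variable borel (g p)" if "p \<in> ?P" for p
  proof -
    have "distributed M lborel (g p) (\<lambda>x. ennreal (std_normal_density x))"
      using assms(1) that by (simp add: gaussian_disorder_def)
    from distributed_measurable[OF this] show ?thesis by simp
  qed
  have distr: "distr M borel (g p) = std_gauss" if "p \<in> ?P" for p
  proof -
    have "distributed M lborel (g p) (\<lambda>x. ennreal (std_normal_density x))"
      using assms(1) that by (simp add: gaussian_disorder_def)
    then have "distr M lborel (g p) = std_gauss"
      unfolding std_gauss_def by (rule distributed_distr_eq_density)
    then show ?thesis
      by (simp cong: distr_cong)
  qed
  have "indep_vars (\<lambda>_. borel) g ?P"
    using assms(1) by (simp add: gaussian_disorder_def)
  then have "distr M (\<Pi>\<^sub>M p\<in>?P. borel) (\<lambda>w. \<lambda>p\<in>?P. g p w) = (\<Pi>\<^sub>M p\<in>?P. distr M borel (g p))"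
    using indep_vars_iff_distr_eq_PiM'[OF ne rv] by simp
  also have "\<dots> = gauss ?P"
    by (rule PiM_cong) (simp_all add: distr)
  finally have law: "gauss ?P = distr M (\<Pi>\<^sub>M p\<in>?P. borel) (\<lambda>w. \<lambda>p\<in>?P. g p w)" ..
  have sets: "sets (gauss ?P) = sets (\<Pi>\<^sub>M p\<in>?P. borel :: real measure)"
    by (rule sets_PiM_cong) auto
  have "nu_interp \<beta> N 1 m f = (\<integral>w. gibbs_average \<beta> N (\<lambda>p\<in>?P. g p w) m f \<partial>M)"
    unfolding nu_interp_def law
  proof (subst integral_distr)
    show "(\<lambda>w. \<lambda>p\<in>?P. g p w) \<in> measurable M (\<Pi>\<^sub>M p\<in>?P. borel)"
      using rv by (intro measurable_restrict)
    show "(\<lambda>a. gibbs_average \<beta> N (interp N 1 a) m f) \<in> borel_measurable (\<Pi>\<^sub>M p\<in>?P. borel)"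
      using measurable_gibbs_average_interp[of \<beta> N 1 m f] unfolding measurable_cong_sets[OF sets refl] .
  qed simp
  moreover have "gibbs_average \<beta> N (\<lambda>p\<in>?P. g p w) m f = gibbs_average \<beta> N (\<lambda>p. g p w) m f" for w
  proof -
    have "boltzmann \<beta> N (\<lambda>p\<in>?P. g p w) \<sigma> = boltzmann \<beta> N (\<lambda>p. g p w) \<sigma>" for \<sigma>
      unfolding boltzmann_eq by simp
    then show ?thesis
      unfolding gibbs_average_eq partition_function_eq by simp
  qed
  ultimately show ?thesis
    by (simp add: nu_def)
qed

text \<open>Needed for \<open>t = 0\<close>, where the square root has no derivative: bounds
  obtained for \<open>t > 0\<close> are carried there by continuity.\<close>

lemma continuous_on_nu_interp: "continuous_on S (\<lambda>t. nu_interp \<beta> N t m f)"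
proof (rule continuous_on_sequentiallyI)
  fix u :: "nat \<Rightarrow> real" and t assume u: "u \<longlonglongrightarrow> t"
  have cont: "continuous_on UNIV (\<lambda>t. gibbs_average \<beta> N (interp N t a) m f)" for a
  proof -
    have "continuous_on UNIV (\<lambda>t. interp N t a p)" for p
      unfolding interp_def by (cases "snd p = N") (auto intro!: continuous_intros)
    then have b: "continuous_on UNIV (\<lambda>t. boltzmann \<beta> N (interp N t a) \<sigma>)" for \<sigma>
      unfolding boltzmann_eq by (intro continuous_intros)
    have "partition_function \<beta> N (interp N t a) ^ m \<noteq> 0" for t
      by simp
    then show ?thesis
      unfolding gibbs_average_eq using b
      by (intro continuous_on_divide continuous_on_sum continuous_on_mult continuous_on_const
          continuous_on_prod continuous_on_power) (auto simp: partition_function_eq intro!: continuous_on_sum)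
  qed
  show "(\<lambda>n. nu_interp \<beta> N (u n) m f) \<longlonglongrightarrow> nu_interp \<beta> N t m f"
    unfolding nu_interp_def
  proof (rule integral_dominated_convergence[where w = "\<lambda>_. replica_sum_abs N m f"])
    show "AE a in gauss (site_pairs N).
        (\<lambda>n. gibbs_average \<beta> N (interp N (u n) a) m f) \<longlonglongrightarrow> gibbs_average \<beta> N (interp N t a) m f"
      using continuous_on_tendsto_compose[OF cont u] by simp
  qed (auto simp: gibbs_average_abs_bound gauss_prod.finite_measure)
qed

section \<open>Derivative of the interpolated average in \<open>t\<close>\<close>

definition last_pairs :: "nat \<Rightarrow> (nat \<times> nat) set" where
  "last_pairs N = {p\<in>site_pairs N. snd p = N}"

lemma gibbs_average_sum_replica_diff:
  assumes "finite P"
  shows "gibbs_average \<beta> N a m (replica_diff k (\<lambda>\<sigma>. \<Sum>p\<in>P. A p * S p \<sigma>) f)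
    = (\<Sum>p\<in>P. A p * gibbs_average \<beta> N a m (replica_diff k (S p) f))"
proof -
  have "replica_diff k (\<lambda>\<sigma>. \<Sum>p\<in>P. A p * S p \<sigma>) f s = (\<Sum>p\<in>P. A p * replica_diff k (S p) f s)" for s
  proof -
    have "(\<Sum>l=1..k. \<Sum>p\<in>P. A p * S p (s l)) = (\<Sum>p\<in>P. A p * (\<Sum>l=1..k. S p (s l)))"
      by (subst sum.swap) (simp add: sum_distrib_left)
    then show ?thesis
      unfolding replica_diff_def
      by (simp add: sum_distrib_left algebra_simps flip: sum_subtractf)
  qed
  then have "replica_diff k (\<lambda>\<sigma>. \<Sum>p\<in>P. A p * S p \<sigma>) f = (\<lambda>s. \<Sum>p\<in>P. A p * replica_diff k (S p) f s)"
    by (rule ext)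
  then show ?thesis
    by (simp add: gibbs_average_sum gibbs_average_cmult)
qed

text \<open>Moving \<open>a p\<close> moves the interpolated coupling at speed
  \<open>sqrt t\<close>, so integration by parts produces \<open>sqrt t * \<beta> / sqrt N\<close>
  and one further replica.\<close>

lemma nu_interp_integration_by_parts:
  assumes p: "p \<in> last_pairs N" and h: "depends_on_first m h"
  shows "(\<integral>a. a p * gibbs_average \<beta> N (interp N t a) m h \<partial>gauss (site_pairs N))
    = sqrt t * \<beta> / sqrt (real N) * nu_interp \<beta> N t (Suc m) (replica_diff m (pair_spin p) h)"
proof -
  define G' where "G' = (\<lambda>a. sqrt t * \<beta> / sqrt (real N) *
    gibbs_average \<beta> N (interp N t a) (Suc m) (replica_diff m (pair_spin p) h))"
  have p': "p \<in> site_pairs N" "snd p = N" using p by (auto simp: last_pairs_def)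
  have curve: "((\<lambda>x. interp N t (a(p := x)) q) has_real_derivative (if q = p then sqrt t else 0)) (at x)" for a q x
    using p' unfolding interp_def fun_upd_apply
    by (cases "q = p"; cases "snd q = N") (auto intro!: derivative_eq_intros)
  have V: "(\<lambda>\<sigma>. \<Sum>q\<in>site_pairs N. (if q = p then sqrt t else 0) * pair_spin q \<sigma>)
      = (\<lambda>\<sigma>. \<Sum>q\<in>{p}. sqrt t * pair_spin q \<sigma>)"
    using p' by (simp add: if_distrib[of "\<lambda>x. x * _"] cong: if_cong)
  have deriv: "((\<lambda>x. gibbs_average \<beta> N (interp N t (a(p := x))) m h) has_real_derivative G' (a(p := x))) (at x)" for a x
    using gibbs_average_has_derivative[where A = "\<lambda>x. interp N t (a(p := x))" and N = N, OF curve h, of \<beta>]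
    unfolding V G'_def gibbs_average_sum_replica_diff[of "{p}", OF finite.insertI[OF finite.emptyI]]
    by (simp add: mult_ac)
  have cont: "isCont (\<lambda>x. G' (a(p := x))) x" for a x
    unfolding G'_def
    by (intro continuous_intros DERIV_isCont[OF gibbs_average_has_derivative[OF curve depends_on_first_replica_diff[OF h]]])
  have "(\<integral>a. a p * gibbs_average \<beta> N (interp N t a) m h \<partial>gauss (site_pairs N)) = (\<integral>a. G' a \<partial>gauss (site_pairs N))"
  proof (rule gauss_integration_by_parts)
    let ?B1 = "replica_sum_abs N m h"
    let ?B2 = "\<bar>sqrt t * \<beta> / sqrt (real N)\<bar> * replica_sum_abs N (Suc m) (replica_diff m (pair_spin p) h)"
    show "\<bar>gibbs_average \<beta> N (interp N t a) m h\<bar> \<le> max ?B1 ?B2" for a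
      using gibbs_average_abs_bound[of \<beta> N "interp N t a" m h] by simp
    have "\<bar>G' a\<bar> \<le> ?B2" for a
      unfolding G'_def abs_mult by (intro mult_left_mono gibbs_average_abs_bound) auto
    then show "\<bar>G' a\<bar> \<le> max ?B1 ?B2" for a
      by (simp add: le_max_iff_disj)
    show "G' \<in> borel_measurable (gauss (site_pairs N))"
      unfolding G'_def by measurable
  qed (use p' deriv cont in auto)
  then show ?thesis
    by (simp add: G'_def nu_interp_def)
qed

text \<open>The chain rule yields \<open>a p / (2 * sqrt t)\<close> and one
  \<open>replica_diff\<close>; integrating \<open>a p\<close> by parts yields \<open>sqrt t\<close>
  and a second one. The singular factors cancel, leaving
  \<open>\<beta>\<^sup>2 / (2 * N)\<close>.\<close>

lemma nu_interp_has_derivative: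
  assumes t: "0 < t" and f: "depends_on_first m f"
  shows "((\<lambda>t. nu_interp \<beta> N t m f) has_real_derivative
    (\<Sum>p\<in>last_pairs N. \<beta>\<^sup>2 / (2 * real N) *
       nu_interp \<beta> N t (Suc (Suc m)) (replica_diff (Suc m) (pair_spin p) (replica_diff m (pair_spin p) f)))) (at t)"
proof -
  let ?M = "gauss (site_pairs N)"
  let ?c = "\<beta> / sqrt (real N)"
  define h where "h = (\<lambda>p. replica_diff m (pair_spin p) f)"
  define D where "D = (\<lambda>t a. ?c * (\<Sum>p\<in>last_pairs N. a p / (2 * sqrt t) * gibbs_average \<beta> N (interp N t a) (Suc m) (h p)))"
  have fin: "finite (last_pairs N)" by (simp add: last_pairs_def)
  have mem: "p \<in> site_pairs N" if "p \<in> last_pairs N" for p using that by (simp add: last_pairs_def)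
  have hdep: "depends_on_first (Suc m) (h p)" for p
    unfolding h_def by (rule depends_on_first_replica_diff[OF f])
  have intD: "integrable ?M (\<lambda>a. a p * gibbs_average \<beta> N (interp N x a) (Suc m) (h p))" if "p \<in> last_pairs N" for p x
  proof (rule Bochner_Integration.integrable_bound)
    show "integrable ?M (\<lambda>a. replica_sum_abs N (Suc m) (h p) * a p)"
      using integrable_gauss_component[OF mem[OF that]] by simp
    show "(\<lambda>a. a p * gibbs_average \<beta> N (interp N x a) (Suc m) (h p)) \<in> borel_measurable ?M"
      using mem[OF that] by measurable
    show "AE a in ?M. norm (a p * gibbs_average \<beta> N (interp N x a) (Suc m) (h p)) \<le> norm (replica_sum_abs N (Suc m) (h p) * a p)"
      using gibbs_average_abs_bound[of \<beta> N _ "Suc m" "h p"]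
      by (auto simp: abs_mult mult.commute[of "\<bar>replica_sum_abs _ _ _\<bar>"] intro!: always_eventually mult_left_mono intro: order_trans[OF _ abs_ge_self])
  qed
  have "((\<lambda>x. \<integral>a. gibbs_average \<beta> N (interp N x a) m f \<partial>?M) has_real_derivative (\<integral>a. D t a \<partial>?M)) (at t)"
  \<comment> \<open>Staying above \<open>t / 2\<close> bounds \<open>1 / sqrt x\<close> uniformly,
    which gives the dominating function.\<close>
  proof (rule has_derivative_integral_dominated[where S = "{t / 2<..}"
        and B = "\<lambda>a. \<bar>?c\<bar> * (\<Sum>p\<in>last_pairs N. \<bar>a p\<bar> / (2 * sqrt (t / 2)) * replica_sum_abs N (Suc m) (h p))"])
    show "D t \<in> borel_measurable ?M"
      unfolding D_def using mem by measurable
    show "((\<lambda>x. gibbs_average \<beta> N (interp N x a) m f) has_real_derivative D x a) (at x)"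
      if "x \<in> {t / 2<..}" for x a
    proof -
      have x: "x > 0" using that t by simp
      have curve: "((\<lambda>x. interp N x a p) has_real_derivative (if snd p = N then a p / (2 * sqrt x) else 0)) (at x)" for p
        using x by (auto simp: interp_def field_simps intro!: derivative_eq_intros)
      have V: "(\<lambda>\<sigma>. \<Sum>p\<in>site_pairs N. (if snd p = N then a p / (2 * sqrt x) else 0) * pair_spin p \<sigma>)
          = (\<lambda>\<sigma>. \<Sum>p\<in>last_pairs N. a p / (2 * sqrt x) * pair_spin p \<sigma>)"
        unfolding last_pairs_def
        by (rule ext, rule sum.mono_neutral_cong_right) auto
      show ?thesis
        using gibbs_average_has_derivative[where A = "\<lambda>x. interp N x a" and N = N, OF curve f, of \<beta>]
        unfolding V gibbs_average_sum_replica_diff[OF fin] D_def h_def .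
    qed
    show "\<bar>D x a\<bar> \<le> \<bar>?c\<bar> * (\<Sum>p\<in>last_pairs N. \<bar>a p\<bar> / (2 * sqrt (t / 2)) * replica_sum_abs N (Suc m) (h p))"
      if "x \<in> {t / 2<..}" for x a
      unfolding D_def abs_mult
    proof (intro mult_left_mono order_trans[OF sum_abs] sum_mono)
      fix p
      have "\<bar>a p / (2 * sqrt x)\<bar> \<le> \<bar>a p\<bar> / (2 * sqrt (t / 2))"
        using that t by (auto intro!: divide_left_mono)
      then show "\<bar>a p / (2 * sqrt x) * gibbs_average \<beta> N (interp N x a) (Suc m) (h p)\<bar>
          \<le> \<bar>a p\<bar> / (2 * sqrt (t / 2)) * replica_sum_abs N (Suc m) (h p)"
        using t unfolding abs_mult by (intro mult_mono gibbs_average_abs_bound) auto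
    qed auto
    show "integrable ?M (\<lambda>a. \<bar>?c\<bar> * (\<Sum>p\<in>last_pairs N. \<bar>a p\<bar> / (2 * sqrt (t / 2)) * replica_sum_abs N (Suc m) (h p)))"
      using integrable_gauss_component[OF mem]
      by (intro integrable_mult_right integrable_mult_left Bochner_Integration.integrable_sum integrable_divide_zero integrable_abs) auto
  qed (use t in auto)
  moreover have "(\<integral>a. D t a \<partial>?M) = (\<Sum>p\<in>last_pairs N. \<beta>\<^sup>2 / (2 * real N) *
      nu_interp \<beta> N t (Suc (Suc m)) (replica_diff (Suc m) (pair_spin p) (h p)))"
  proof -
    have "(\<integral>a. D t a \<partial>?M) = (\<integral>a. (\<Sum>p\<in>last_pairs N. ?c / (2 * sqrt t) *
        (a p * gibbs_average \<beta> N (interp N t a) (Suc m) (h p))) \<partial>?M)"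
      unfolding D_def sum_distrib_left by (simp add: mult_ac)
    also have "\<dots> = (\<Sum>p\<in>last_pairs N. ?c / (2 * sqrt t) *
        (\<integral>a. a p * gibbs_average \<beta> N (interp N t a) (Suc m) (h p) \<partial>?M))"
      using intD by (subst Bochner_Integration.integral_sum) (auto intro!: integrable_mult_right simp del: times_divide_eq_left)
    also have "\<dots> = (\<Sum>p\<in>last_pairs N. \<beta>\<^sup>2 / (2 * real N) *
        nu_interp \<beta> N t (Suc (Suc m)) (replica_diff (Suc m) (pair_spin p) (h p)))"
    proof (intro sum.cong refl)
      fix p assume p: "p \<in> last_pairs N"
      then have "0 < real N" by (auto simp: last_pairs_def site_pairs_def)
      then have "?c / (2 * sqrt t) * (sqrt t * \<beta> / sqrt (real N)) = \<beta>\<^sup>2 / (2 * real N)"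
        using t by (simp add: field_simps power2_eq_square)
      then show "?c / (2 * sqrt t) * (\<integral>a. a p * gibbs_average \<beta> N (interp N t a) (Suc m) (h p) \<partial>?M)
          = \<beta>\<^sup>2 / (2 * real N) * nu_interp \<beta> N t (Suc (Suc m)) (replica_diff (Suc m) (pair_spin p) (h p))"
        unfolding nu_interp_integration_by_parts[OF p hdep] by (simp only: mult.assoc[symmetric])
    qed
    finally show ?thesis .
  qed
  ultimately show ?thesis
    unfolding nu_interp_def[symmetric] h_def by simp
qed

section \<open>Large overlaps are exponentially unlikely\<close>

lemma pair_spin_square: "\<sigma> \<in> spin_configs N \<Longrightarrow> p \<in> site_pairs N \<Longrightarrow> (pair_spin p \<sigma>)\<^sup>2 = 1"
  using spin_configsD[of \<sigma> N "fst p"] spin_configsD[of \<sigma> N "snd p"]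
  by (auto simp: site_pairs_def pair_spin_def power2_eq_square)

lemma site_pairs_Suc: "site_pairs (Suc n) = site_pairs n \<union> (\<lambda>i. (i, Suc n)) ` {1..n}"
  by (auto simp: site_pairs_def)

lemma last_pairs_eq: "last_pairs N = (\<lambda>i. (i, N)) ` {1..<N}"
  by (auto simp: last_pairs_def site_pairs_def)

lemma sum_last_pairs: "(\<Sum>p\<in>last_pairs N. F p) = (\<Sum>i\<in>{1..<N}. F (i, N))"
  unfolding last_pairs_eq by (subst sum.reindex) (auto simp: inj_on_def)

lemma sum_site_pairs_Suc:
  "(\<Sum>p\<in>site_pairs (Suc n). F p) = (\<Sum>p\<in>site_pairs n. F p) + (\<Sum>i=1..n. F (i, Suc n))"
proof -
  have "site_pairs n \<inter> (\<lambda>i. (i, Suc n)) ` {1..n} = {}"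
    by (auto simp: site_pairs_def)
  then show ?thesis
    unfolding site_pairs_Suc by (subst sum.union_disjoint) (auto simp: sum.reindex inj_on_def)
qed

lemma square_sum_eq_site_pairs:
  fixes x :: "nat \<Rightarrow> real"
  shows "(\<Sum>i=1..n. x i)\<^sup>2 = (\<Sum>i=1..n. (x i)\<^sup>2) + 2 * (\<Sum>p\<in>site_pairs n. x (fst p) * x (snd p))"
proof (induction n)
  case 0
  have "site_pairs 0 = {}" by (auto simp: site_pairs_def)
  then show ?case by simp
next
  case (Suc n)
  have "(\<Sum>i=1..Suc n. x i)\<^sup>2 = (\<Sum>i=1..n. x i)\<^sup>2 + (x (Suc n))\<^sup>2 + 2 * (\<Sum>i=1..n. x i * x (Suc n))"
    by (simp add: power2_sum flip: sum_distrib_right)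
  then show ?case
    unfolding sum_site_pairs_Suc Suc by (simp add: algebra_simps)
qed

section \<open>Exponential moments of the squared overlap of two uniform configurations\<close>

lemma card_spin_configs: "card (spin_configs N) = 2 ^ N"
  unfolding spin_configs_def by (simp add: card_PiE numeral_2_eq_2)

lemma cosh_le_exp_half_square: "cosh x \<le> exp (x\<^sup>2 / 2)" for x :: real
proof -
  have "cosh y \<le> exp (y\<^sup>2 / 2)" if "y \<ge> 0" for y :: real
  proof -
    \<comment> \<open>Hoeffding's bound for the logarithmic moment generating function of a variable
      with two equally likely values at distance \<open>2 * y\<close>.\<close>
    have "- (2 * y) * (1 / 2) + ln (1 + 1 / 2 * (exp (2 * y) - 1)) \<le> (2 * y)\<^sup>2 / 8"
      by (rule Hoeffdings_lemma_aux) (use that in auto)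
    then have "ln ((1 + exp (2 * y)) / 2) \<le> y + y\<^sup>2 / 2"
      by (simp add: field_simps power2_eq_square)
    then have "(1 + exp (2 * y)) / 2 \<le> exp (y + y\<^sup>2 / 2)"
      by (metis add_pos_pos exp_gt_zero exp_le_cancel_iff exp_ln half_gt_zero zero_less_one)
    then have "exp (- y) * ((1 + exp (2 * y)) / 2) \<le> exp (- y) * exp (y + y\<^sup>2 / 2)"
      by (intro mult_left_mono) auto
    then show ?thesis
      by (simp add: cosh_def field_simps flip: exp_add)
  qed
  from this[of x] this[of "- x"] show ?thesis by (cases "x \<ge> 0") auto
qed

text \<open>Normalised by \<open>N\<close>, not by \<open>N - 1\<close>: it then appears without a
  factor in the derivative, and differs from the full overlap by exactly the product of the last
  spins over \<open>N\<close>.\<close>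

definition cavity_overlap :: "nat \<Rightarrow> (nat \<Rightarrow> real) \<Rightarrow> (nat \<Rightarrow> real) \<Rightarrow> real" where
  "cavity_overlap N \<sigma> \<tau> = 1 / real N * (\<Sum>i\<in>{1..<N}. \<sigma> i * \<tau> i)"

lemma exp_cavity_overlap_square_integral:
  assumes "0 \<le> \<mu>" "1 \<le> N"
  shows "exp (\<mu> * real N * (cavity_overlap N \<sigma> \<tau>)\<^sup>2 / 2)
    = (\<integral>z. exp (sqrt (\<mu> / real N) * z * (\<Sum>i\<in>{1..<N}. \<sigma> i * \<tau> i)) \<partial>std_gauss)"
proof -
  have "exp ((sqrt (\<mu> / real N) * (\<Sum>i\<in>{1..<N}. \<sigma> i * \<tau> i))\<^sup>2 / 2)
      = (\<integral>z. exp (sqrt (\<mu> / real N) * z * (\<Sum>i\<in>{1..<N}. \<sigma> i * \<tau> i)) \<partial>std_gauss)"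
    by (subst integral_std_gauss_exp[symmetric]) (simp add: mult_ac)
  moreover have "(sqrt (\<mu> / real N) * (\<Sum>i\<in>{1..<N}. \<sigma> i * \<tau> i))\<^sup>2 = \<mu> * real N * (cavity_overlap N \<sigma> \<tau>)\<^sup>2"
    using assms by (simp add: cavity_overlap_def power_mult_distrib power2_eq_square field_simps)
  ultimately show ?thesis by simp
qed

text \<open>After factorising over sites, \<open>\<tau>\<close> only affects the sign inside each
  cosh, which is even. The last site contributes a bare 2, so the exponent with \<open>N\<close> in
  place of \<open>N - 1\<close> is mere slack.\<close>

lemma sum_spin_configs_exp_le:
  assumes \<tau>: "\<tau> \<in> spin_configs N" and "1 \<le> N"
  shows "(\<Sum>\<sigma>\<in>spin_configs N. exp (b * (\<Sum>i\<in>{1..<N}. \<sigma> i * \<tau> i))) \<le> 2 ^ N * exp (real N * b\<^sup>2 / 2)"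
proof -
  define h where "h = (\<lambda>i x. if i < N then exp (b * (x * \<tau> i)) else 1)"
  have "exp (b * (\<Sum>i\<in>{1..<N}. \<sigma> i * \<tau> i)) = (\<Prod>i=1..N. h i (\<sigma> i))" for \<sigma>
  proof -
    have "(\<Prod>i=1..N. h i (\<sigma> i)) = (\<Prod>i\<in>{1..<N}. exp (b * (\<sigma> i * \<tau> i)))"
      by (rule prod.mono_neutral_cong_right) (auto simp: h_def)
    then show ?thesis
      by (simp add: sum_distrib_left exp_sum)
  qed
  then have "(\<Sum>\<sigma>\<in>spin_configs N. exp (b * (\<Sum>i\<in>{1..<N}. \<sigma> i * \<tau> i)))
      = (\<Prod>i=1..N. \<Sum>x\<in>{-1, 1}. h i x)"
    unfolding spin_configs_def by (subst prod_sum_PiE) auto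
  also have "\<dots> \<le> (\<Prod>i=1..N. 2 * exp (b\<^sup>2 / 2))"
  proof (rule prod_mono)
    fix i assume i: "i \<in> {1..N}"
    have "exp (b * \<tau> i) + exp (- (b * \<tau> i)) \<le> 2 * exp ((b * \<tau> i)\<^sup>2 / 2)"
      using cosh_le_exp_half_square[of "b * \<tau> i"] by (simp add: cosh_def)
    moreover have "(b * \<tau> i)\<^sup>2 = b\<^sup>2"
      using spin_configsD[OF \<tau> i] by (auto simp: power_mult_distrib)
    ultimately have "h i (-1) + h i 1 \<le> 2 * exp (b\<^sup>2 / 2)"
      by (auto simp: h_def)
    then show "0 \<le> (\<Sum>x\<in>{-1, 1}. h i x) \<and> (\<Sum>x\<in>{-1, 1}. h i x) \<le> 2 * exp (b\<^sup>2 / 2)"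
      by (auto simp: h_def add_nonneg_nonneg)
  qed
  also have "\<dots> = 2 ^ N * exp (real N * b\<^sup>2 / 2)"
    by (simp add: power_mult_distrib exp_of_nat_mult[symmetric])
  finally show ?thesis .
qed

text \<open>The quadratic tilt turns the standard density into a multiple of a normal density of
  variance \<open>1 / (1 - \<mu>)\<close>.\<close>

lemma integrable_std_gauss_exp_square:
  assumes "\<mu> < 1"
  shows "integrable std_gauss (\<lambda>z. exp (\<mu> * z\<^sup>2 / 2))"
proof -
  define v where "v = 1 / sqrt (1 - \<mu>)"
  have v: "v > 0" "1 / v\<^sup>2 = 1 - \<mu>"
    using assms by (auto simp: v_def power_divide)
  have "std_normal_density z * exp (\<mu> * z\<^sup>2 / 2) = v * normal_density 0 v z" for z
  proof -
    have "- z\<^sup>2 / 2 + \<mu> * z\<^sup>2 / 2 = - z\<^sup>2 * (1 - \<mu>) / 2"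
      by (simp add: field_simps)
    also have "\<dots> = - z\<^sup>2 / (2 * v\<^sup>2)"
      unfolding v(2)[symmetric] using v(1) by (simp add: field_simps)
    finally show ?thesis
      using v(1) by (simp add: normal_density_def exp_add[symmetric] real_sqrt_mult)
  qed
  then show ?thesis
    using v by (simp add: integrable_std_gauss_iff)
qed

text \<open>Hubbard--Stratonovich: a Gaussian average linearises the square of the overlap.\<close>

lemma sum_exp_cavity_overlap_square_le:
  assumes "0 \<le> \<mu>" "\<mu> < 1" "1 \<le> N"
  shows "(\<Sum>\<sigma>\<in>spin_configs N. \<Sum>\<tau>\<in>spin_configs N. exp (\<mu> * real N * (cavity_overlap N \<sigma> \<tau>)\<^sup>2 / 2))
    \<le> 4 ^ N * (\<integral>z. exp (\<mu> * z\<^sup>2 / 2) \<partial>std_gauss)"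
proof -
  let ?S = "spin_configs N"
  let ?e = "\<lambda>\<sigma> \<tau> z. exp (sqrt (\<mu> / real N) * z * (\<Sum>i\<in>{1..<N}. \<sigma> i * \<tau> i))"
  have int: "integrable std_gauss (?e \<sigma> \<tau>)" for \<sigma> \<tau>
    using integrable_std_gauss_exp[of "sqrt (\<mu> / real N) * (\<Sum>i\<in>{1..<N}. \<sigma> i * \<tau> i)"] by (simp add: mult_ac)
  have "(\<Sum>\<tau>\<in>?S. \<Sum>\<sigma>\<in>?S. \<integral>z. ?e \<sigma> \<tau> z \<partial>std_gauss) = (\<Sum>\<tau>\<in>?S. \<integral>z. (\<Sum>\<sigma>\<in>?S. ?e \<sigma> \<tau> z) \<partial>std_gauss)"
    by (simp only: Bochner_Integration.integral_sum[OF int])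
  also have "\<dots> \<le> (\<Sum>\<tau>\<in>?S. \<integral>z. 2 ^ N * exp (\<mu> * z\<^sup>2 / 2) \<partial>std_gauss)"
  proof (intro sum_mono integral_mono)
    fix \<tau> z assume \<tau>: "\<tau> \<in> ?S"
    have "real N * (sqrt (\<mu> / real N) * z)\<^sup>2 = \<mu> * z\<^sup>2"
      using assms by (simp add: power_mult_distrib)
    then show "(\<Sum>\<sigma>\<in>?S. ?e \<sigma> \<tau> z) \<le> 2 ^ N * exp (\<mu> * z\<^sup>2 / 2)"
      using sum_spin_configs_exp_le[OF \<tau> assms(3), of "sqrt (\<mu> / real N) * z"] by simp
  qed (use int integrable_std_gauss_exp_square[OF assms(2)] in \<open>auto intro!: Bochner_Integration.integrable_sum\<close>)
  also have "\<dots> = 4 ^ N * (\<integral>z. exp (\<mu> * z\<^sup>2 / 2) \<partial>std_gauss)"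
    by (simp add: card_spin_configs flip: power_mult_distrib mult.assoc)
  finally show ?thesis
    unfolding exp_cavity_overlap_square_integral[OF assms(1,3)] by (subst sum.swap)
qed

section \<open>Second moment of the partition function\<close>

definition coupling_scale :: "real \<Rightarrow> nat \<Rightarrow> real \<Rightarrow> nat \<times> nat \<Rightarrow> real" where
  "coupling_scale \<beta> N t p = \<beta> / sqrt (real N) * (if snd p = N then sqrt t else 1)"

lemma boltzmann_interp:
  "boltzmann \<beta> N (interp N t a) \<sigma> = exp (\<Sum>p\<in>site_pairs N. (coupling_scale \<beta> N t p * pair_spin p \<sigma>) * a p)"
  unfolding boltzmann_eq sum_distrib_left
  by (intro arg_cong[of _ _ exp] sum.cong) (auto simp: coupling_scale_def interp_def)

lemma integrable_boltzmann_interp [simp]: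
  "integrable (gauss (site_pairs N)) (\<lambda>a. boltzmann \<beta> N (interp N t a) \<sigma>)"
  unfolding boltzmann_interp by (rule integrable_gauss_exp_sum) simp

lemma boltzmann_interp_mult:
  "boltzmann \<beta> N (interp N t a) \<sigma> * boltzmann \<beta> N (interp N t a) \<tau>
    = exp (\<Sum>p\<in>site_pairs N. (coupling_scale \<beta> N t p * (pair_spin p \<sigma> + pair_spin p \<tau>)) * a p)"
  unfolding boltzmann_interp by (simp add: algebra_simps sum.distrib flip: exp_add)

lemma integrable_boltzmann_interp_mult [simp]:
  "integrable (gauss (site_pairs N)) (\<lambda>a. boltzmann \<beta> N (interp N t a) \<sigma> * boltzmann \<beta> N (interp N t a) \<tau>)"
  unfolding boltzmann_interp_mult by (rule integrable_gauss_exp_sum) simp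

text \<open>Variance of the Gaussian exponent of a Boltzmann weight. It is the same for every
  configuration because pair spins square to one.\<close>

definition energy_variance :: "real \<Rightarrow> nat \<Rightarrow> real \<Rightarrow> real" where
  "energy_variance \<beta> N t = (\<Sum>p\<in>site_pairs N. (coupling_scale \<beta> N t p)\<^sup>2)"

lemma integral_boltzmann_interp:
  assumes "\<sigma> \<in> spin_configs N"
  shows "(\<integral>a. boltzmann \<beta> N (interp N t a) \<sigma> \<partial>gauss (site_pairs N)) = exp (energy_variance \<beta> N t / 2)"
  unfolding boltzmann_interp energy_variance_def
  by (subst integral_gauss_exp_sum) (auto simp: power_mult_distrib pair_spin_square[OF assms])

text \<open>The square of a sum of two signs is
  \<open>2 * (1 + pair_spin p \<sigma> * pair_spin p \<tau>)\<close>, so the Gaussian moment splits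
  into the common variance and the covariance of the two energies.\<close>

lemma integral_boltzmann_interp_mult:
  assumes "\<sigma> \<in> spin_configs N" "\<tau> \<in> spin_configs N"
  shows "(\<integral>a. boltzmann \<beta> N (interp N t a) \<sigma> * boltzmann \<beta> N (interp N t a) \<tau> \<partial>gauss (site_pairs N))
    = exp (energy_variance \<beta> N t)
      * exp (\<Sum>p\<in>site_pairs N. (coupling_scale \<beta> N t p)\<^sup>2 * (pair_spin p \<sigma> * pair_spin p \<tau>))"
proof -
  have "(pair_spin p \<sigma> + pair_spin p \<tau>)\<^sup>2 = 2 * (1 + pair_spin p \<sigma> * pair_spin p \<tau>)" if "p \<in> site_pairs N" for p
    using pair_spin_square[OF assms(1) that] pair_spin_square[OF assms(2) that] by (simp add: power2_sum)
  then have "(\<Sum>p\<in>site_pairs N. (coupling_scale \<beta> N t p * (pair_spin p \<sigma> + pair_spin p \<tau>))\<^sup>2) / 2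
      = (\<Sum>p\<in>site_pairs N. (coupling_scale \<beta> N t p)\<^sup>2 * (1 + pair_spin p \<sigma> * pair_spin p \<tau>))"
    unfolding sum_divide_distrib by (intro sum.cong) (auto simp: power_mult_distrib)
  also have "\<dots> = (\<Sum>p\<in>site_pairs N. (coupling_scale \<beta> N t p)\<^sup>2)
      + (\<Sum>p\<in>site_pairs N. (coupling_scale \<beta> N t p)\<^sup>2 * (pair_spin p \<sigma> * pair_spin p \<tau>))"
    by (simp add: distrib_left sum.distrib)
  finally show ?thesis
    unfolding boltzmann_interp_mult energy_variance_def integral_gauss_exp_sum[OF finite_site_pairs]
    by (simp only: exp_add)
qed

text \<open>Pairs of sites below \<open>N\<close> form half of a squared sum minus its diagonal,
  which is the overlap term. The fewer than \<open>N\<close> pairs with the last site contribute at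
  most \<open>1 / N\<close> each, whence the summand 1, uniformly in \<open>t\<close>.\<close>

lemma energy_covariance_le:
  assumes s: "\<sigma> \<in> spin_configs N" "\<tau> \<in> spin_configs N" and \<beta>: "0 < \<beta>" "\<beta> < 1" and t: "0 \<le> t" "t \<le> 1" and N: "1 \<le> N"
  shows "(\<Sum>p\<in>site_pairs N. (coupling_scale \<beta> N t p)\<^sup>2 * (pair_spin p \<sigma> * pair_spin p \<tau>))
    \<le> 1 + \<beta>\<^sup>2 * real N * (cavity_overlap N \<sigma> \<tau>)\<^sup>2 / 2"
proof -
  define x where "x = (\<lambda>i. \<sigma> i * \<tau> i)"
  have ps: "pair_spin p \<sigma> * pair_spin p \<tau> = x (fst p) * x (snd p)" for p
    by (simp add: pair_spin_def x_def)
  have xN: "\<bar>x i\<bar> = 1" if "i \<in> {1..N}" for i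
    using abs_spin[OF s(1) that] abs_spin[OF s(2) that] by (simp add: x_def abs_mult)
  obtain n where n: "N = Suc n" using N by (cases N) auto
  have "(\<Sum>p\<in>site_pairs N. (coupling_scale \<beta> N t p)\<^sup>2 * (pair_spin p \<sigma> * pair_spin p \<tau>))
      = (\<Sum>p\<in>site_pairs n. (\<beta>\<^sup>2 / real N) * (x (fst p) * x (snd p))) + (\<Sum>i=1..n. \<beta>\<^sup>2 / real N * t * (x i * x N))"
    unfolding ps unfolding n sum_site_pairs_Suc unfolding n[symmetric]
    using t by (intro arg_cong2[of _ _ _ _ "(+)"] sum.cong)
      (auto simp: coupling_scale_def power_mult_distrib power_divide site_pairs_def n)
  also have "(\<Sum>i=1..n. \<beta>\<^sup>2 / real N * t * (x i * x N)) \<le> (\<Sum>i=1..n. 1 / real N)"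
  proof (rule sum_mono)
    fix i assume i: "i \<in> {1..n}"
    have "x i * x N \<le> \<bar>x i * x N\<bar>" by (rule abs_ge_self)
    also have "\<dots> = 1" using xN[of i] xN[of N] i n by (simp add: abs_mult)
    finally have "x i * x N \<le> 1" .
    moreover have "0 \<le> \<beta>\<^sup>2 * t" "\<beta>\<^sup>2 * t \<le> 1"
      using \<beta> t by (auto intro!: mult_le_one power_le_one)
    ultimately have "\<beta>\<^sup>2 * t * (x i * x N) \<le> 1"
      by (meson landau_o.R_trans mult_left_le)
    then show "\<beta>\<^sup>2 / real N * t * (x i * x N) \<le> 1 / real N"
      using N by (simp add: field_simps)
  qed
  also have "(\<Sum>i=1..n. 1 / real N) \<le> 1"
    by (simp add: n)
  also have "(\<Sum>p\<in>site_pairs n. (\<beta>\<^sup>2 / real N) * (x (fst p) * x (snd p)))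
      = \<beta>\<^sup>2 / real N * (((\<Sum>i=1..n. x i)\<^sup>2 - (\<Sum>i=1..n. (x i)\<^sup>2)) / 2)"
    unfolding square_sum_eq_site_pairs sum_distrib_left[symmetric] by simp
  also have "\<dots> \<le> \<beta>\<^sup>2 / real N * ((\<Sum>i=1..n. x i)\<^sup>2 / 2)"
    by (intro mult_left_mono) (auto intro!: sum_nonneg divide_right_mono)
  also have "(\<Sum>i=1..n. x i) = real N * cavity_overlap N \<sigma> \<tau>"
    using N by (simp add: cavity_overlap_def x_def n atLeastLessThanSuc_atLeastAtMost)
  finally show ?thesis
    using N by (simp add: power_mult_distrib power2_eq_square field_simps)
qed

text \<open>The exponent uses the midpoint \<open>(1 + \<beta>\<^sup>2) / 2\<close> between
  \<beta>^2 and 1, and \<open>exp 1\<close> pays for the couplings of the last site.\<close>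

definition second_moment_bound :: "real \<Rightarrow> real" where
  "second_moment_bound \<beta> = exp 1 * (\<integral>z. exp ((1 + \<beta>\<^sup>2) / 2 * z\<^sup>2 / 2) \<partial>std_gauss)"

text \<open>Raising the coefficient of the squared overlap from \<beta>^2 to
  \<open>(1 + \<beta>\<^sup>2) / 2\<close> keeps the exponential moment finite and frees
  \<open>(1 - \<beta>\<^sup>2) / 4 * N * R\<^sup>2\<close>, which is the gain where the overlap is
  at least \<open>\<delta>\<close>. The case \<open>\<delta> = 0\<close> bounds the full second
  moment.\<close>

lemma second_moment_large_overlap:
  assumes \<beta>: "0 < \<beta>" "\<beta> < 1" and t: "0 \<le> t" "t \<le> 1" and N: "1 \<le> N" and \<delta>: "0 \<le> \<delta>"
  shows "(\<integral>a. (\<Sum>\<sigma>\<in>spin_configs N. \<Sum>\<tau>\<in>spin_configs N. of_bool (\<delta> \<le> \<bar>cavity_overlap N \<sigma> \<tau>\<bar>) *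
      (boltzmann \<beta> N (interp N t a) \<sigma> * boltzmann \<beta> N (interp N t a) \<tau>)) \<partial>gauss (site_pairs N))
    \<le> second_moment_bound \<beta> * exp (- (1 - \<beta>\<^sup>2) / 4 * real N * \<delta>\<^sup>2) * (2 ^ N * exp (energy_variance \<beta> N t / 2))\<^sup>2"
proof -
  let ?S = "spin_configs N"
  let ?\<mu> = "(1 + \<beta>\<^sup>2) / 2"
  let ?R = "cavity_overlap N"
  let ?V = "energy_variance \<beta> N t"
  let ?g = "exp (- (1 - \<beta>\<^sup>2) / 4 * real N * \<delta>\<^sup>2)"
  have \<beta>2: "\<beta>\<^sup>2 < 1"
    using \<beta> by (simp add: power_less_one_iff abs_square_less_1)
  have *: "of_bool (\<delta> \<le> \<bar>?R \<sigma> \<tau>\<bar>) * (\<integral>a. boltzmann \<beta> N (interp N t a) \<sigma> * boltzmann \<beta> N (interp N t a) \<tau> \<partial>gauss (site_pairs N))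
      \<le> exp ?V * exp 1 * ?g * exp (?\<mu> * real N * (?R \<sigma> \<tau>)\<^sup>2 / 2)" if s: "\<sigma> \<in> ?S" "\<tau> \<in> ?S" for \<sigma> \<tau>
  proof (cases "\<delta> \<le> \<bar>?R \<sigma> \<tau>\<bar>")
    case True
    then have "\<delta>\<^sup>2 \<le> (?R \<sigma> \<tau>)\<^sup>2"
      using \<delta> power_mono[of \<delta> "\<bar>?R \<sigma> \<tau>\<bar>" 2] by simp
    then have "(1 - \<beta>\<^sup>2) / 4 * real N * \<delta>\<^sup>2 \<le> (1 - \<beta>\<^sup>2) / 4 * real N * (?R \<sigma> \<tau>)\<^sup>2"
      using \<beta>2 by (intro mult_left_mono) auto
    then have "1 + \<beta>\<^sup>2 * real N * (?R \<sigma> \<tau>)\<^sup>2 / 2 \<le> 1 + (- (1 - \<beta>\<^sup>2) / 4 * real N * \<delta>\<^sup>2) + ?\<mu> * real N * (?R \<sigma> \<tau>)\<^sup>2 / 2"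
      by (simp add: field_simps)
    from order_trans[OF energy_covariance_le[OF s \<beta> t N] this]
    have "exp (\<Sum>p\<in>site_pairs N. (coupling_scale \<beta> N t p)\<^sup>2 * (pair_spin p \<sigma> * pair_spin p \<tau>))
        \<le> exp (1 + (- (1 - \<beta>\<^sup>2) / 4 * real N * \<delta>\<^sup>2) + ?\<mu> * real N * (?R \<sigma> \<tau>)\<^sup>2 / 2)"
      by (simp only: exp_le_cancel_iff)
    then show ?thesis
      using True unfolding integral_boltzmann_interp_mult[OF s] exp_add by (simp add: mult.assoc)
  qed simp
  have "(\<integral>a. (\<Sum>\<sigma>\<in>?S. \<Sum>\<tau>\<in>?S. of_bool (\<delta> \<le> \<bar>?R \<sigma> \<tau>\<bar>) *
      (boltzmann \<beta> N (interp N t a) \<sigma> * boltzmann \<beta> N (interp N t a) \<tau>)) \<partial>gauss (site_pairs N))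
      = (\<Sum>\<sigma>\<in>?S. \<Sum>\<tau>\<in>?S. of_bool (\<delta> \<le> \<bar>?R \<sigma> \<tau>\<bar>) *
      (\<integral>a. boltzmann \<beta> N (interp N t a) \<sigma> * boltzmann \<beta> N (interp N t a) \<tau> \<partial>gauss (site_pairs N)))"
    by (simp only: Bochner_Integration.integral_sum Bochner_Integration.integrable_sum
        integrable_mult_right integral_mult_right_zero integrable_boltzmann_interp_mult)
  also have "\<dots> \<le> (\<Sum>\<sigma>\<in>?S. \<Sum>\<tau>\<in>?S. exp ?V * exp 1 * ?g * exp (?\<mu> * real N * (?R \<sigma> \<tau>)\<^sup>2 / 2))"
    by (intro sum_mono *)
  also have "\<dots> = exp ?V * exp 1 * ?g * (\<Sum>\<sigma>\<in>?S. \<Sum>\<tau>\<in>?S. exp (?\<mu> * real N * (?R \<sigma> \<tau>)\<^sup>2 / 2))"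
    by (simp only: sum_distrib_left)
  also have "\<dots> \<le> exp ?V * exp 1 * ?g * (4 ^ N * (\<integral>z. exp (?\<mu> * z\<^sup>2 / 2) \<partial>std_gauss))"
    using \<beta>2 N by (intro mult_left_mono sum_exp_cavity_overlap_square_le) auto
  also have "exp ?V * 4 ^ N = (2 ^ N * exp (?V / 2))\<^sup>2"
  proof -
    have "(4 :: real) ^ N = (2 ^ N)\<^sup>2"
      by (simp add: power2_eq_square flip: power_mult_distrib)
    moreover have "exp ?V = (exp (?V / 2))\<^sup>2"
      by (simp add: power2_eq_square flip: exp_add)
    ultimately show ?thesis
      by (simp add: power_mult_distrib)
  qed
  then have "exp ?V * exp 1 * ?g * (4 ^ N * (\<integral>z. exp (?\<mu> * z\<^sup>2 / 2) \<partial>std_gauss))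
      = second_moment_bound \<beta> * ?g * (2 ^ N * exp (?V / 2))\<^sup>2"
    by (simp add: second_moment_bound_def mult_ac)
  finally show ?thesis .
qed

lemma integral_partition_function_interp:
  "(\<integral>a. partition_function \<beta> N (interp N t a) \<partial>gauss (site_pairs N)) = 2 ^ N * exp (energy_variance \<beta> N t / 2)"
  unfolding partition_function_eq
  by (subst Bochner_Integration.integral_sum) (auto simp: integral_boltzmann_interp card_spin_configs)

lemma partition_function_square:
  "(partition_function \<beta> N a)\<^sup>2
     = (\<Sum>\<sigma>\<in>spin_configs N. \<Sum>\<tau>\<in>spin_configs N. boltzmann \<beta> N a \<sigma> * boltzmann \<beta> N a \<tau>)"
  unfolding partition_function_eq power2_eq_square by (rule sum_product)

lemma integral_partition_function_square_le:
  assumes "0 < \<beta>" "\<beta> < 1" "0 \<le> t" "t \<le> 1" "1 \<le> N"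
  shows "(\<integral>a. (partition_function \<beta> N (interp N t a))\<^sup>2 \<partial>gauss (site_pairs N))
    \<le> second_moment_bound \<beta> * (2 ^ N * exp (energy_variance \<beta> N t / 2))\<^sup>2"
  using second_moment_large_overlap[OF assms, of 0] unfolding partition_function_square by simp

section \<open>Negative moments of the partition function and the overlap tail\<close>

lemma partition_function_powr_ratio:
  assumes \<beta>: "0 < \<beta>" and t: "0 \<le> t" "t \<le> 1" and \<theta>: "0 \<le> \<theta>" and p: "p \<in> site_pairs N"
  shows "partition_function \<beta> N (interp N t (a(p := x))) powr \<theta>
    \<le> exp (\<theta> * \<beta> / sqrt (real N) * \<bar>x - y\<bar>) * partition_function \<beta> N (interp N t (a(p := y))) powr \<theta>"
proof -
  let ?c = "\<beta> / sqrt (real N)"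
  have b: "boltzmann \<beta> N (interp N t (a(p := x))) \<sigma> \<le> exp (?c * \<bar>x - y\<bar>) * boltzmann \<beta> N (interp N t (a(p := y))) \<sigma>"
    if \<sigma>: "\<sigma> \<in> spin_configs N" for \<sigma>
  proof -
    define k where "k = (\<lambda>q. coupling_scale \<beta> N t q * pair_spin q \<sigma>)"
    have bk: "boltzmann \<beta> N (interp N t a') \<sigma> = exp (\<Sum>q\<in>site_pairs N. k q * a' q)" for a'
      by (simp add: boltzmann_interp k_def)
    have "\<bar>pair_spin p \<sigma>\<bar> = 1"
      using pair_spin_square[OF \<sigma> p] by (auto simp: power2_eq_1_iff)
    moreover have "\<bar>coupling_scale \<beta> N t p\<bar> \<le> ?c"
      using \<beta> t by (auto simp: coupling_scale_def abs_mult intro!: divide_right_mono mult_left_le)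
    ultimately have "\<bar>k p\<bar> \<le> ?c"
      by (simp add: k_def abs_mult)
    have split: "(\<Sum>q\<in>site_pairs N. k q * (a(p := z)) q) = k p * z + (\<Sum>q\<in>site_pairs N - {p}. k q * a q)" for z
      using p by (subst sum.remove[of _ p]) auto
    have "k p * x - k p * y \<le> \<bar>k p\<bar> * \<bar>x - y\<bar>"
      by (metis abs_ge_self abs_mult right_diff_distrib)
    also have "\<dots> \<le> ?c * \<bar>x - y\<bar>"
      using \<open>\<bar>k p\<bar> \<le> ?c\<close> by (rule mult_right_mono) simp
    finally show ?thesis
      unfolding bk split exp_add[symmetric] by simp
  qed
  have "partition_function \<beta> N (interp N t (a(p := x))) \<le> exp (?c * \<bar>x - y\<bar>) * partition_function \<beta> N (interp N t (a(p := y)))"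
    unfolding partition_function_eq sum_distrib_left by (intro sum_mono b)
  then have "partition_function \<beta> N (interp N t (a(p := x))) powr \<theta>
      \<le> (exp (?c * \<bar>x - y\<bar>) * partition_function \<beta> N (interp N t (a(p := y)))) powr \<theta>"
    by (intro powr_mono2 \<theta>) (auto simp: less_imp_le)
  also have "\<dots> = exp (\<theta> * (?c * \<bar>x - y\<bar>)) * partition_function \<beta> N (interp N t (a(p := y))) powr \<theta>"
    by (subst powr_mult) (simp_all add: less_imp_le exp_powr_real mult.commute)
  finally show ?thesis by (simp add: mult.assoc)
qed

text \<open>There are at most N^2 couplings, each with squared constant
  \<open>\<theta>\<^sup>2 * \<beta>\<^sup>2 / N\<close>. The total is linear in \<open>N\<close> but
  quadratic in \<open>\<theta>\<close>, so a small \<open>\<theta>\<close> makes it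
  affordable.\<close>

lemma sum_squared_lipschitz_le:
  assumes "0 < \<beta>" "\<beta> < 1"
  shows "(\<Sum>p\<in>site_pairs N. (\<theta> * \<beta> / sqrt (real N))\<^sup>2) \<le> \<theta>\<^sup>2 * real N"
proof -
  have "card (site_pairs N) \<le> card ({1..N} \<times> {1..N})"
    by (intro card_mono) (auto simp: site_pairs_def)
  then have "real (card (site_pairs N)) \<le> real N * real N"
    by (simp flip: of_nat_mult)
  then have "real (card (site_pairs N)) * (\<theta>\<^sup>2 * \<beta>\<^sup>2 / real N) \<le> real N * real N * (\<theta>\<^sup>2 * \<beta>\<^sup>2 / real N)"
    by (rule mult_right_mono) simp
  also have "\<dots> = \<theta>\<^sup>2 * real N * \<beta>\<^sup>2"
    by (simp add: field_simps)
  also have "\<dots> \<le> \<theta>\<^sup>2 * real N * 1"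
    using assms by (intro mult_left_mono power_le_one) auto
  finally show ?thesis
    by (simp add: power_mult_distrib power_divide)
qed

text \<open>Up to \<open>2 * C\<close> the power \<open>z powr (1 - \<theta>)\<close> is at most
  \<open>2 * C\<close>; beyond it, \<open>z\<close> is dominated by its square. For \<open>z\<close>
  of mean one and second moment at most \<open>C\<close>, the last term costs at most one half,
  which leaves a lower bound for the mean of \<open>z powr \<theta>\<close>.\<close>

lemma le_powr_plus_square:
  fixes z \<theta> C :: real
  assumes "0 < z" "0 \<le> \<theta>" "\<theta> \<le> 1" "1 \<le> C"
  shows "z \<le> 2 * C * z powr \<theta> + z\<^sup>2 / (2 * C)"
proof (cases "z \<le> 2 * C")
  case True
  have "z = z powr \<theta> * z powr (1 - \<theta>)"
    using assms by (simp flip: powr_add)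
  also have "\<dots> \<le> z powr \<theta> * (2 * C) powr (1 - \<theta>)"
    using assms True by (intro mult_left_mono powr_mono2) auto
  also have "\<dots> \<le> z powr \<theta> * (2 * C) powr 1"
    using assms by (intro mult_left_mono powr_mono) auto
  finally show ?thesis
    using assms by (simp add: mult.commute add_increasing2)
next
  case False
  then have "z * (2 * C) \<le> z * z"
    using assms by (intro mult_left_mono) auto
  then have "z \<le> z\<^sup>2 / (2 * C)"
    using assms by (simp add: field_simps power2_eq_square)
  moreover have "0 \<le> 2 * C * z powr \<theta>"
    using assms by simp
  ultimately show ?thesis by linarith
qed

text \<open>Mean one and second moment at most \<open>C\<close> keep the mean of
  \<open>z powr \<theta>\<close> above \<open>1 / (4 * C)\<close>. The bound on its product with the
  mean of the inverse turns this into an upper bound for the negative moment.\<close>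

lemma normalized_partition_function_moments:
  assumes \<beta>: "0 < \<beta>" "\<beta> < 1" and t: "0 \<le> t" "t \<le> 1" and N: "1 \<le> N" and \<theta>: "0 \<le> \<theta>" "\<theta> \<le> 1"
    and C: "C = max 1 (second_moment_bound \<beta>)"
  defines "z \<equiv> \<lambda>a. partition_function \<beta> N (interp N t a) / (2 ^ N * exp (energy_variance \<beta> N t / 2))"
  shows "integrable (gauss (site_pairs N)) (\<lambda>a. 1 / z a powr \<theta>)"
    and "(\<integral>a. 1 / z a powr \<theta> \<partial>gauss (site_pairs N)) \<le> 4 * C * exp (\<theta>\<^sup>2 * real N)"
proof -
  let ?M = "gauss (site_pairs N)"
  define m where "m = 2 ^ N * exp (energy_variance \<beta> N t / 2)"
  have m: "m > 0" by (simp add: m_def)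
  have z_def: "z = (\<lambda>a. partition_function \<beta> N (interp N t a) / m)"
    by (simp add: z_def m_def)
  have z: "z a > 0" for a using m by (simp add: z_def)
  have zm [measurable]: "z \<in> borel_measurable ?M"
    unfolding z_def by measurable
  define c where "c = (\<lambda>p :: nat \<times> nat. \<theta> * \<beta> / sqrt (real N))"
  have c: "c p \<ge> 0" for p using \<theta> \<beta> by (simp add: c_def)
  have ratio: "z (a(p := x)) powr \<theta> \<le> exp (c p * \<bar>x - y\<bar>) * z (a(p := y)) powr \<theta>"
    if "p \<in> site_pairs N" for a p x y
  proof -
    have "partition_function \<beta> N (interp N t (a(p := x))) powr \<theta> / m powr \<theta>
      \<le> exp (c p * \<bar>x - y\<bar>) * partition_function \<beta> N (interp N t (a(p := y))) powr \<theta> / m powr \<theta>"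
      unfolding c_def by (intro divide_right_mono partition_function_powr_ratio \<beta> t \<theta> that) auto
    then show ?thesis
      using m by (simp add: z_def powr_divide less_imp_le)
  qed
  have ratio': "1 / z (a(p := x)) powr \<theta> \<le> exp (c p * \<bar>x - y\<bar>) * (1 / z (a(p := y)) powr \<theta>)"
    if "p \<in> site_pairs N" for a p x y
    using ratio[OF that, of a y x] z[of "a(p := x)"] z[of "a(p := y)"]
    by (simp add: field_simps abs_minus_commute)
  have pos: "z a powr \<theta> > 0" "1 / z a powr \<theta> > 0" for a
    using z[of a] by auto
  have int: "integrable ?M (\<lambda>a. z a powr \<theta>)"
    by (rule integrable_gauss_ratio[OF _ _ pos(1) ratio]) auto
  show int': "integrable ?M (\<lambda>a. 1 / z a powr \<theta>)"
    by (rule integrable_gauss_ratio[OF _ _ pos(2) ratio']) auto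
  have conc: "(\<integral>a. z a powr \<theta> \<partial>?M) * (\<integral>a. 1 / z a powr \<theta> \<partial>?M) \<le> exp (\<theta>\<^sup>2 * real N)"
  proof -
    have "(\<integral>a. z a powr \<theta> \<partial>?M) * (\<integral>a. 1 / z a powr \<theta> \<partial>?M) \<le> exp (\<Sum>p\<in>site_pairs N. (c p)\<^sup>2)"
      by (rule gauss_product_with_inverse[OF _ c _ pos(1) ratio]) auto
    also have "\<dots> \<le> exp (\<theta>\<^sup>2 * real N)"
      using sum_squared_lipschitz_le[OF \<beta>, of \<theta> N] by (simp add: c_def)
    finally show ?thesis .
  qed
  have C1: "C \<ge> 1" "second_moment_bound \<beta> \<le> C" by (simp_all add: C)
  have Z1: "integrable ?M (\<lambda>a. partition_function \<beta> N (interp N t a))"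
    unfolding partition_function_eq by simp
  have Z2: "integrable ?M (\<lambda>a. (partition_function \<beta> N (interp N t a))\<^sup>2)"
    unfolding partition_function_square by (intro Bochner_Integration.integrable_sum) simp
  have z2: "integrable ?M (\<lambda>a. (z a)\<^sup>2)"
    unfolding z_def power_divide using Z2 by simp
  have "1 = (\<integral>a. z a \<partial>?M)"
    using m by (simp add: z_def integral_partition_function_interp m_def)
  also have "\<dots> \<le> (\<integral>a. 2 * C * z a powr \<theta> + (z a)\<^sup>2 / (2 * C) \<partial>?M)"
  proof (intro integral_mono)
    show "integrable ?M z" unfolding z_def using Z1 by simp
    show "integrable ?M (\<lambda>a. 2 * C * z a powr \<theta> + (z a)\<^sup>2 / (2 * C))"
      using int z2 by simp
  qed (use le_powr_plus_square z \<theta> C1 in auto)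
  also have "\<dots> = 2 * C * (\<integral>a. z a powr \<theta> \<partial>?M) + (\<integral>a. (z a)\<^sup>2 \<partial>?M) / (2 * C)"
    using int z2 by simp
  also have "(\<integral>a. (z a)\<^sup>2 \<partial>?M) \<le> C"
  proof -
    have "(\<integral>a. (z a)\<^sup>2 \<partial>?M) = (\<integral>a. (partition_function \<beta> N (interp N t a))\<^sup>2 \<partial>?M) / m\<^sup>2"
      by (simp add: z_def power_divide)
    also have "\<dots> \<le> second_moment_bound \<beta> * m\<^sup>2 / m\<^sup>2"
      unfolding m_def by (intro divide_right_mono integral_partition_function_square_le \<beta> t N) simp
    also have "\<dots> \<le> C" using m C1 by simp
    finally show ?thesis .
  qed
  then have "2 * C * (\<integral>a. z a powr \<theta> \<partial>?M) + (\<integral>a. (z a)\<^sup>2 \<partial>?M) / (2 * C) \<le> 2 * C * (\<integral>a. z a powr \<theta> \<partial>?M) + C / (2 * C)"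
    using C1 by (intro add_left_mono divide_right_mono) auto
  finally have low: "1 \<le> 4 * C * (\<integral>a. z a powr \<theta> \<partial>?M)"
    using C1 by (simp add: field_simps)
  have nn: "0 \<le> (\<integral>a. 1 / z a powr \<theta> \<partial>?M)" by simp
  have "(\<integral>a. 1 / z a powr \<theta> \<partial>?M) \<le> 4 * C * (\<integral>a. z a powr \<theta> \<partial>?M) * (\<integral>a. 1 / z a powr \<theta> \<partial>?M)"
    using mult_right_mono[OF low nn] by simp
  also have "\<dots> \<le> 4 * C * exp (\<theta>\<^sup>2 * real N)"
    using conc C1 by (simp add: mult.assoc)
  finally show "(\<integral>a. 1 / z a powr \<theta> \<partial>?M) \<le> 4 * C * exp (\<theta>\<^sup>2 * real N)" .
qed

text \<open>With \<open>z\<close> the partition function and \<open>b\<close> the restricted double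
  sum, both normalised, the Gibbs probability is \<open>b / z\<^sup>2\<close>. Where
  \<open>z \<ge> u\<close> it is at most \<open>b / u\<^sup>2\<close>; elsewhere, being at most 1,
  it is at most \<open>(u / z) powr \<theta>\<close>. The two cases contribute \<open>C\<close> and
  \<open>4 * C\<close>.\<close>

lemma nu_interp_large_overlap_le:
  assumes \<beta>: "0 < \<beta>" "\<beta> < 1" and t: "0 \<le> t" "t \<le> 1" and N: "1 \<le> N" and \<delta>: "0 \<le> \<delta>" "\<delta> \<le> 1"
    and xy: "x \<in> {1..m}" "y \<in> {1..m}" "x \<noteq> y"
    and C: "C = max 1 (second_moment_bound \<beta>)" and \<kappa>: "\<kappa> = (1 - \<beta>\<^sup>2) / 4"
  shows "nu_interp \<beta> N t m (\<lambda>s. of_bool (\<delta> \<le> \<bar>cavity_overlap N (s x) (s y)\<bar>))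
    \<le> 5 * C * exp (- (\<kappa>\<^sup>2 / 64 * \<delta> ^ 4 * real N))"
proof -
  let ?M = "gauss (site_pairs N)"
  let ?S = "spin_configs N"
  let ?f = "\<lambda>\<sigma> \<tau>. of_bool (\<delta> \<le> \<bar>cavity_overlap N \<sigma> \<tau>\<bar>) :: real"
  define G where "G = (\<lambda>a. gibbs_average \<beta> N (interp N t a) m (\<lambda>s. ?f (s x) (s y)))"
  define Z where "Z = (\<lambda>a. partition_function \<beta> N (interp N t a))"
  define mz where "mz = 2 ^ N * exp (energy_variance \<beta> N t / 2)"
  define B where "B = (\<lambda>a. \<Sum>\<sigma>\<in>?S. \<Sum>\<tau>\<in>?S. ?f \<sigma> \<tau> * (boltzmann \<beta> N (interp N t a) \<sigma> * boltzmann \<beta> N (interp N t a) \<tau>))"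
  define z where "z = (\<lambda>a. Z a / mz)"
  define b where "b = (\<lambda>a. B a / mz\<^sup>2)"
  \<comment> \<open>The minimiser of \<open>- \<theta> * \<kappa> * \<delta>\<^sup>2 / 4 +
    \<theta>\<^sup>2\<close>; the minimum is
    \<open>- \<kappa>\<^sup>2 * \<delta> ^ 4 / 64\<close>.\<close>
  define \<theta> where "\<theta> = \<kappa> * \<delta>\<^sup>2 / 8"
  \<comment> \<open>The mean of \<open>b\<close> decays like
    \<open>exp (- \<kappa> * N * \<delta>\<^sup>2)\<close>, and \<open>u\<^sup>2\<close> spends half
    of that exponent.\<close>
  define u where "u = exp (- (\<kappa> * real N * \<delta>\<^sup>2 / 4))"
  have "\<beta>\<^sup>2 < 1" "0 < \<beta>\<^sup>2"
    using \<beta> by (auto simp: power_less_one_iff abs_square_less_1)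
  then have \<kappa>01: "0 < \<kappa>" "\<kappa> \<le> 1 / 4" by (auto simp: \<kappa>)
  have C1: "C \<ge> 1" "second_moment_bound \<beta> \<le> C" by (simp_all add: C)
  have \<delta>2: "\<delta>\<^sup>2 \<le> 1" "0 \<le> \<delta>\<^sup>2" using \<delta> by (auto simp: power_le_one)
  have "\<kappa> * \<delta>\<^sup>2 \<le> 1 / 4 * 1"
    using \<kappa>01 \<delta>2 by (intro mult_mono) auto
  then have \<theta>: "0 \<le> \<theta>" "\<theta> \<le> 1"
    using \<kappa>01 \<delta>2 by (auto simp: \<theta>_def)
  have mz: "mz > 0" by (simp add: mz_def)
  have z: "z a > 0" for a using mz by (simp add: z_def Z_def)
  have b: "b a \<ge> 0" for a unfolding b_def B_def by (intro divide_nonneg_nonneg sum_nonneg) auto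
  have u: "u > 0" by (simp add: u_def)
  have G: "G a = b a / (z a)\<^sup>2" for a
    using mz by (simp add: G_def gibbs_average_two[OF xy, where F = ?f] b_def z_def B_def Z_def power_divide)
  have G1: "G a \<le> 1" for a
  proof -
    have "G a \<le> gibbs_average \<beta> N (interp N t a) m (\<lambda>_. 1)"
      unfolding G_def by (rule gibbs_average_mono) auto
    then show ?thesis by simp
  qed
  have pointwise: "G a \<le> b a / u\<^sup>2 + u powr \<theta> * (1 / z a powr \<theta>)" for a
  proof (cases "u \<le> z a")
    case True
    then have "b a / (z a)\<^sup>2 \<le> b a / u\<^sup>2"
      using u b[of a] by (intro divide_left_mono power_mono) (auto simp: z)
    then show ?thesis using G[of a] by (simp add: add_increasing2)
  next
    case False
    then have "z a powr \<theta> \<le> u powr \<theta>"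
      using z[of a] \<theta> by (intro powr_mono2) auto
    then have "1 \<le> u powr \<theta> * (1 / z a powr \<theta>)"
      using z[of a] by simp
    then show ?thesis
      using G1[of a] b[of a] u by (smt (verit) divide_nonneg_pos zero_less_power)
  qed
  note moments = normalized_partition_function_moments[OF \<beta> t N \<theta> C, folded mz_def]
  have int_z: "integrable ?M (\<lambda>a. 1 / z a powr \<theta>)"
    and z_le: "(\<integral>a. 1 / z a powr \<theta> \<partial>?M) \<le> 4 * C * exp (\<theta>\<^sup>2 * real N)"
    using moments by (simp_all add: z_def Z_def)
  have int_B: "integrable ?M B"
    unfolding B_def by (intro Bochner_Integration.integrable_sum integrable_mult_right) simp
  have int_b: "integrable ?M b"
    unfolding b_def using int_B by simp
  have b_le: "(\<integral>a. b a \<partial>?M) \<le> C * u\<^sup>2 * exp (- (\<kappa> * real N * \<delta>\<^sup>2 / 2))"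
  proof -
    have "(\<integral>a. B a \<partial>?M) \<le> second_moment_bound \<beta> * exp (- (1 - \<beta>\<^sup>2) / 4 * real N * \<delta>\<^sup>2) * mz\<^sup>2"
      unfolding B_def mz_def by (rule second_moment_large_overlap[OF \<beta> t N \<delta>(1)])
    also have "\<dots> \<le> C * exp (- (1 - \<beta>\<^sup>2) / 4 * real N * \<delta>\<^sup>2) * mz\<^sup>2"
      using C1 by (intro mult_right_mono) auto
    also have "exp (- (1 - \<beta>\<^sup>2) / 4 * real N * \<delta>\<^sup>2) = u\<^sup>2 * exp (- (\<kappa> * real N * \<delta>\<^sup>2 / 2))"
      by (simp add: u_def \<kappa> power2_eq_square field_simps flip: exp_add)
    finally show ?thesis
      using mz by (simp add: b_def field_simps)
  qed
  define w where "w = \<kappa>\<^sup>2 / 64 * \<delta> ^ 4 * real N"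
  have "w \<le> \<kappa> * real N * \<delta>\<^sup>2 / 2"
  proof -
    have "w = (\<kappa> * \<delta>\<^sup>2) / 64 * (\<kappa> * \<delta>\<^sup>2 * real N)"
      by (simp add: w_def power2_eq_square power4_eq_xxxx)
    also have "\<dots> \<le> 1 / 2 * (\<kappa> * \<delta>\<^sup>2 * real N)"
      using \<open>\<kappa> * \<delta>\<^sup>2 \<le> 1 / 4 * 1\<close> \<kappa>01 \<delta>2 by (intro mult_right_mono) auto
    finally show ?thesis by (simp add: mult_ac)
  qed
  then have first: "(\<integral>a. b a \<partial>?M) / u\<^sup>2 \<le> C * exp (- w)"
  proof -
    have "(\<integral>a. b a \<partial>?M) / u\<^sup>2 \<le> C * exp (- (\<kappa> * real N * \<delta>\<^sup>2 / 2))"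
      using b_le u by (simp add: field_simps)
    also have "\<dots> \<le> C * exp (- w)"
      using C1 \<open>w \<le> _\<close> by (intro mult_left_mono) auto
    finally show ?thesis .
  qed
  have second: "u powr \<theta> * (\<integral>a. 1 / z a powr \<theta> \<partial>?M) \<le> 4 * C * exp (- w)"
  proof -
    have up: "u powr \<theta> = exp (- (\<theta> * (\<kappa> * real N * \<delta>\<^sup>2 / 4)))"
      by (simp add: u_def powr_def)
    have "u powr \<theta> * (\<integral>a. 1 / z a powr \<theta> \<partial>?M) \<le> u powr \<theta> * (4 * C * exp (\<theta>\<^sup>2 * real N))"
      by (intro mult_left_mono z_le) simp
    also have "\<dots> = 4 * C * exp (- (\<theta> * (\<kappa> * real N * \<delta>\<^sup>2 / 4)) + \<theta>\<^sup>2 * real N)"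
      by (simp only: up exp_add mult_ac)
    also have "- (\<theta> * (\<kappa> * real N * \<delta>\<^sup>2 / 4)) + \<theta>\<^sup>2 * real N = - w"
      by (simp add: w_def \<theta>_def field_simps power2_eq_square power4_eq_xxxx)
    finally show ?thesis .
  qed
  have "(\<integral>a. G a \<partial>?M) \<le> (\<integral>a. b a / u\<^sup>2 + u powr \<theta> * (1 / z a powr \<theta>) \<partial>?M)"
  proof (rule integral_mono)
    show "integrable ?M G" unfolding G_def by simp
    show "integrable ?M (\<lambda>a. b a / u\<^sup>2 + u powr \<theta> * (1 / z a powr \<theta>))"
      by (intro Bochner_Integration.integrable_add integrable_divide_zero integrable_mult_right int_b int_z)
  qed (rule pointwise)
  also have "\<dots> = (\<integral>a. b a \<partial>?M) / u\<^sup>2 + u powr \<theta> * (\<integral>a. 1 / z a powr \<theta> \<partial>?M)"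
    by (simp only: Bochner_Integration.integral_add integrable_divide_zero integrable_mult_right int_b int_z
        integral_divide_zero integral_mult_right_zero)
  also have "\<dots> \<le> 5 * C * exp (- w)"
    using first second by simp
  finally show ?thesis
    by (simp add: nu_interp_def G_def w_def)
qed

section \<open>Differentiation and Taylor expansion along the interpolation\<close>

definition cavity_prod :: "nat \<Rightarrow> (nat \<times> nat) list \<Rightarrow> (nat \<Rightarrow> nat \<Rightarrow> real) \<Rightarrow> real" where
  "cavity_prod N I s = (\<Prod>(j, l)\<leftarrow>I. s j N * s l N * cavity_overlap N (s j) (s l))"

text \<open>Coefficients of the usual cavity derivative for a function of \<open>m\<close> replicas,
  with the two fresh replicas kept apart. Identifying them by exchangeability would add the second
  and third coefficients to the familiar \<open>- m * \<beta>\<^sup>2\<close>.\<close>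

definition pair_coeff :: "real \<Rightarrow> nat \<Rightarrow> nat \<times> nat \<Rightarrow> real" where
  "pair_coeff \<beta> m q =
     (if snd q \<le> m then \<beta>\<^sup>2
      else if snd q = Suc m then (1 - real m) * \<beta>\<^sup>2 / 2
      else if fst q \<le> m then - (real m + 1) * \<beta>\<^sup>2 / 2
      else real m * (real m + 1) * \<beta>\<^sup>2 / 2)"

lemma num_replicas_Cons: "num_replicas (q # I) = max (snd q) (num_replicas I)"
  unfolding num_replicas_def by (subst Max_insert[symmetric]) (auto simp: insert_commute)

lemma num_replicas_ge: "(j, l) \<in> set I \<Longrightarrow> l \<le> num_replicas I"
  unfolding num_replicas_def by (intro Max_ge) force+

lemma num_replicas_mono: "set J \<subseteq> set I \<Longrightarrow> num_replicas J \<le> num_replicas I"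
  unfolding num_replicas_def by (intro Max_mono) auto

lemma replica_pairsD: "replica_pairs I \<Longrightarrow> (j, l) \<in> set I \<Longrightarrow> 1 \<le> j \<and> j < l"
  by (auto simp: replica_pairs_def)

lemma replica_pairs_Cons: "replica_pairs (q # I) \<longleftrightarrow> 1 \<le> fst q \<and> fst q < snd q \<and> replica_pairs I"
  by (auto simp: replica_pairs_def)

lemma depends_on_first_prod_list:
  assumes "replica_pairs I" "num_replicas I \<le> m"
  shows "depends_on_first m (\<lambda>s. \<Prod>(j, l)\<leftarrow>I. F (s j) (s l))"
  unfolding depends_on_first_def
proof (intro allI impI arg_cong[of _ _ prod_list] map_cong refl)
  fix s s' :: "nat \<Rightarrow> nat \<Rightarrow> real" and q
  assume *: "\<forall>l\<in>{1..m}. s l = s' l" and q: "q \<in> set I"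
  obtain j l where [simp]: "q = (j, l)" by (cases q)
  have "1 \<le> j" "j < l" "l \<le> m"
    using replica_pairsD[OF assms(1)] num_replicas_ge[of j l I] q assms(2) by auto
  then show "(case q of (j, l) \<Rightarrow> F (s j) (s l)) = (case q of (j, l) \<Rightarrow> F (s' j) (s' l))"
    using * by simp
qed

lemma depends_on_first_cavity_prod:
  "replica_pairs I \<Longrightarrow> num_replicas I \<le> m \<Longrightarrow> depends_on_first m (cavity_prod N I)"
  unfolding cavity_prod_def
  by (rule depends_on_first_prod_list[where F = "\<lambda>\<sigma> \<tau>. \<sigma> N * \<tau> N * cavity_overlap N \<sigma> \<tau>"])

text \<open>Here \<open>site_pairs\<close> indexes pairs of replicas. In the product of the two
  differences the diagonal \<open>m\<close> from the squared sum cancels against \<open>m\<close>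
  times the square on replica \<open>m + 1\<close>, so only products over distinct replicas
  survive.\<close>

lemma replica_diff_twice:
  assumes "\<And>l. l \<in> {1..Suc (Suc m)} \<Longrightarrow> (V (s l))\<^sup>2 = 1"
  shows "\<beta>\<^sup>2 / 2 * replica_diff (Suc m) V (replica_diff m V f) s
    = f s * (\<Sum>q\<in>site_pairs (Suc (Suc m)). pair_coeff \<beta> m q * (V (s (fst q)) * V (s (snd q))))"
proof -
  define y where "y = (\<lambda>l. V (s l))"
  define A where "A = (\<Sum>l=1..m. y l)"
  define P where "P = (\<Sum>q\<in>site_pairs m. y (fst q) * y (snd q))"
  have A2: "A * A = real m + 2 * P"
    using square_sum_eq_site_pairs[of y m] assms by (simp add: A_def P_def y_def power2_eq_square)
  have u: "y (Suc m) * y (Suc m) = 1"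
    using assms[of "Suc m"] by (simp add: y_def power2_eq_square)
  have e1: "(\<Sum>q\<in>site_pairs m. pair_coeff \<beta> m q * (y (fst q) * y (snd q))) = \<beta>\<^sup>2 * P"
    unfolding P_def sum_distrib_left by (intro sum.cong) (auto simp: pair_coeff_def site_pairs_def)
  have e2: "(\<Sum>i=1..m. pair_coeff \<beta> m (i, Suc m) * (y i * y (Suc m))) = (1 - real m) * \<beta>\<^sup>2 / 2 * A * y (Suc m)"
    unfolding A_def sum_distrib_left sum_distrib_right by (intro sum.cong) (auto simp: pair_coeff_def)
  have e3: "(\<Sum>i=1..m. pair_coeff \<beta> m (i, Suc (Suc m)) * (y i * y (Suc (Suc m)))) = - (real m + 1) * \<beta>\<^sup>2 / 2 * A * y (Suc (Suc m))"
    unfolding A_def sum_distrib_left sum_distrib_right by (intro sum.cong) (auto simp: pair_coeff_def)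
  have e4: "pair_coeff \<beta> m (Suc m, Suc (Suc m)) = real m * (real m + 1) * \<beta>\<^sup>2 / 2"
    by (simp add: pair_coeff_def)
  have split: "(\<Sum>i=1..Suc m. G i) = (\<Sum>i=1..m. G i) + G (Suc m)" for G :: "nat \<Rightarrow> real"
    by simp
  have "(\<Sum>q\<in>site_pairs (Suc (Suc m)). pair_coeff \<beta> m q * (y (fst q) * y (snd q)))
      = \<beta>\<^sup>2 * P + (1 - real m) * \<beta>\<^sup>2 / 2 * A * y (Suc m) - (real m + 1) * \<beta>\<^sup>2 / 2 * A * y (Suc (Suc m))
        + real m * (real m + 1) * \<beta>\<^sup>2 / 2 * (y (Suc m) * y (Suc (Suc m)))"
    unfolding sum_site_pairs_Suc split fst_conv snd_conv e1 e2 e3 e4 by (simp add: field_simps)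
  also have "\<dots> = \<beta>\<^sup>2 / 2 * ((A - real m * y (Suc m)) * (A + y (Suc m) - real (Suc m) * y (Suc (Suc m))))"
  proof -
    have "(A - real m * y (Suc m)) * (A + y (Suc m) - real (Suc m) * y (Suc (Suc m)))
      = A * A + (1 - real m) * A * y (Suc m) - (real m + 1) * A * y (Suc (Suc m)) - real m * (y (Suc m) * y (Suc m))
        + real m * (real m + 1) * (y (Suc m) * y (Suc (Suc m)))"
      by (simp add: algebra_simps)
    also have "\<dots> = 2 * P + (1 - real m) * A * y (Suc m) - (real m + 1) * A * y (Suc (Suc m))
        + real m * (real m + 1) * (y (Suc m) * y (Suc (Suc m)))"
      unfolding A2 u by simp
    finally show ?thesis by (simp add: algebra_simps add_divide_distrib diff_divide_distrib)
  qed
  finally have sum: "(\<Sum>q\<in>site_pairs (Suc (Suc m)). pair_coeff \<beta> m q * (y (fst q) * y (snd q)))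
      = \<beta>\<^sup>2 / 2 * ((A - real m * y (Suc m)) * (A + y (Suc m) - real (Suc m) * y (Suc (Suc m))))" .
  have "replica_diff (Suc m) V (replica_diff m V f) s
      = f s * ((A - real m * y (Suc m)) * (A + y (Suc m) - real (Suc m) * y (Suc (Suc m))))"
    by (simp add: replica_diff_def A_def y_def mult.assoc)
  then show ?thesis
    using sum by (simp add: y_def mult.left_commute)
qed

text \<open>On the pair \<open>(i, N)\<close> two replicas contribute their last spins times their
  spins at \<open>i\<close>. Averaging over \<open>i\<close> turns this into exactly one more factor
  of \<open>cavity_prod\<close>.\<close>

lemma cavity_derivative_identity:
  assumes s: "s \<in> replica_configs N (Suc (Suc m))" and N: "1 \<le> N"
  shows "(\<Sum>p\<in>last_pairs N. \<beta>\<^sup>2 / (2 * real N) * replica_diff (Suc m) (pair_spin p) (replica_diff m (pair_spin p) (cavity_prod N I)) s)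
    = (\<Sum>q\<in>site_pairs (Suc (Suc m)). pair_coeff \<beta> m q * cavity_prod N (q # I) s)"
proof -
  have sq: "(pair_spin p (s l))\<^sup>2 = 1" if "p \<in> last_pairs N" "l \<in> {1..Suc (Suc m)}" for p l
    using pair_spin_square[OF replica_configsD[OF s that(2)], of p] that(1) by (simp add: last_pairs_def)
  have "(\<Sum>p\<in>last_pairs N. \<beta>\<^sup>2 / (2 * real N) * replica_diff (Suc m) (pair_spin p) (replica_diff m (pair_spin p) (cavity_prod N I)) s)
      = (\<Sum>p\<in>last_pairs N. 1 / real N * (\<beta>\<^sup>2 / 2 * replica_diff (Suc m) (pair_spin p) (replica_diff m (pair_spin p) (cavity_prod N I)) s))"
    by (simp add: mult.commute)
  also have "\<dots> = (\<Sum>p\<in>last_pairs N. 1 / real N * (cavity_prod N I s *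
      (\<Sum>q\<in>site_pairs (Suc (Suc m)). pair_coeff \<beta> m q * (pair_spin p (s (fst q)) * pair_spin p (s (snd q))))))"
    by (intro sum.cong refl arg_cong2[of _ _ _ _ "(*)"] replica_diff_twice sq)
  also have "\<dots> = (\<Sum>q\<in>site_pairs (Suc (Suc m)). pair_coeff \<beta> m q * (cavity_prod N I s *
      (1 / real N * (\<Sum>p\<in>last_pairs N. pair_spin p (s (fst q)) * pair_spin p (s (snd q))))))"
    unfolding sum_distrib_left by (subst sum.swap) (simp add: mult_ac)
  also have "\<dots> = (\<Sum>q\<in>site_pairs (Suc (Suc m)). pair_coeff \<beta> m q * cavity_prod N (q # I) s)"
  proof (intro sum.cong refl arg_cong2[of _ _ _ _ "(*)"])
    fix q :: "nat \<times> nat"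
    have "(\<Sum>p\<in>last_pairs N. pair_spin p (s (fst q)) * pair_spin p (s (snd q)))
        = s (fst q) N * s (snd q) N * (\<Sum>i\<in>{1..<N}. s (fst q) i * s (snd q) i)"
      unfolding sum_last_pairs sum_distrib_left by (simp add: pair_spin_def mult_ac)
    then show "cavity_prod N I s * (1 / real N * (\<Sum>p\<in>last_pairs N. pair_spin p (s (fst q)) * pair_spin p (s (snd q))))
        = cavity_prod N (q # I) s"
      by (simp add: cavity_prod_def cavity_overlap_def case_prod_unfold mult_ac)
  qed
  finally show ?thesis .
qed

section \<open>Iterated derivatives and the Taylor bound\<close>

definition cavity_nu :: "real \<Rightarrow> nat \<Rightarrow> real \<Rightarrow> (nat \<times> nat) list \<Rightarrow> real" where
  "cavity_nu \<beta> N t I = nu_interp \<beta> N t (num_replicas I) (cavity_prod N I)"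

lemma cavity_nu_eq:
  "replica_pairs I \<Longrightarrow> num_replicas I \<le> m \<Longrightarrow> nu_interp \<beta> N t m (cavity_prod N I) = cavity_nu \<beta> N t I"
  unfolding cavity_nu_def by (rule nu_interp_more_replicas[OF depends_on_first_cavity_prod]) auto

lemma replica_pairs_Cons_site_pairs:
  "replica_pairs I \<Longrightarrow> q \<in> site_pairs m \<Longrightarrow> replica_pairs (q # I)"
  by (auto simp: replica_pairs_Cons site_pairs_def)

text \<open>Any sufficiently large \<open>m\<close> is allowed: idle replicas do not change the
  average, but they do change which pairs appear in its derivative.\<close>

lemma cavity_nu_has_derivative:
  assumes I: "replica_pairs I" "num_replicas I \<le> m" and t: "0 < t" and N: "1 \<le> N"
  shows "((\<lambda>t. cavity_nu \<beta> N t I) has_real_derivative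
    (\<Sum>q\<in>site_pairs (Suc (Suc m)). pair_coeff \<beta> m q * cavity_nu \<beta> N t (q # I))) (at t)"
proof -
  have "(\<Sum>p\<in>last_pairs N. \<beta>\<^sup>2 / (2 * real N) *
       nu_interp \<beta> N t (Suc (Suc m)) (replica_diff (Suc m) (pair_spin p) (replica_diff m (pair_spin p) (cavity_prod N I))))
      = nu_interp \<beta> N t (Suc (Suc m)) (\<lambda>s. \<Sum>p\<in>last_pairs N. \<beta>\<^sup>2 / (2 * real N) *
        replica_diff (Suc m) (pair_spin p) (replica_diff m (pair_spin p) (cavity_prod N I)) s)"
    by (simp only: nu_interp_sum nu_interp_cmult)
  also have "\<dots> = nu_interp \<beta> N t (Suc (Suc m)) (\<lambda>s. \<Sum>q\<in>site_pairs (Suc (Suc m)). pair_coeff \<beta> m q * cavity_prod N (q # I) s)"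
    by (intro nu_interp_cong cavity_derivative_identity N)
  also have "\<dots> = (\<Sum>q\<in>site_pairs (Suc (Suc m)). pair_coeff \<beta> m q * nu_interp \<beta> N t (Suc (Suc m)) (cavity_prod N (q # I)))"
    by (simp only: nu_interp_sum nu_interp_cmult)
  also have "\<dots> = (\<Sum>q\<in>site_pairs (Suc (Suc m)). pair_coeff \<beta> m q * cavity_nu \<beta> N t (q # I))"
  proof (intro sum.cong refl arg_cong2[of _ _ _ _ "(*)"])
    fix q assume q: "q \<in> site_pairs (Suc (Suc m))"
    show "nu_interp \<beta> N t (Suc (Suc m)) (cavity_prod N (q # I)) = cavity_nu \<beta> N t (q # I)"
      by (rule cavity_nu_eq[OF replica_pairs_Cons_site_pairs[OF I(1) q]])
         (use I q in \<open>auto simp: num_replicas_Cons site_pairs_def\<close>)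
  qed
  finally show ?thesis
    using nu_interp_has_derivative[OF t depends_on_first_cavity_prod[OF I], of \<beta> N N]
    unfolding cavity_nu_eq[OF I] by simp
qed

lemma continuous_on_cavity_nu: "continuous_on S (\<lambda>t. cavity_nu \<beta> N t I)"
  unfolding cavity_nu_def by (rule continuous_on_nu_interp)

text \<open>The parameter \<open>m0\<close> forces all pairs of replicas up to \<open>m0\<close> to occur
  in the derivative, even those that exceed \<open>num_replicas I\<close>.\<close>

primrec cavity_nu_deriv ::
    "real \<Rightarrow> nat \<Rightarrow> nat \<Rightarrow> nat \<Rightarrow> real \<Rightarrow> (nat \<times> nat) list \<Rightarrow> real" where
  "cavity_nu_deriv \<beta> N m0 0 t I = cavity_nu \<beta> N t I"
| "cavity_nu_deriv \<beta> N m0 (Suc i) t I =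
     (\<Sum>q\<in>site_pairs (Suc (Suc (max m0 (num_replicas I)))).
        pair_coeff \<beta> (max m0 (num_replicas I)) q * cavity_nu_deriv \<beta> N m0 i t (q # I))"

lemma cavity_nu_deriv_has_derivative:
  assumes "0 < t" "1 \<le> N" "replica_pairs I"
  shows "((\<lambda>t. cavity_nu_deriv \<beta> N m0 i t I) has_real_derivative cavity_nu_deriv \<beta> N m0 (Suc i) t I) (at t)"
  using assms(3)
proof (induction i arbitrary: I)
  case 0
  then show ?case
    using cavity_nu_has_derivative[OF 0 _ assms(1,2), of "max m0 (num_replicas I)"] by simp
next
  case (Suc i)
  let ?m = "max m0 (num_replicas I)"
  have "((\<lambda>t. \<Sum>q\<in>site_pairs (Suc (Suc ?m)). pair_coeff \<beta> ?m q * cavity_nu_deriv \<beta> N m0 i t (q # I)) has_real_derivative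
      (\<Sum>q\<in>site_pairs (Suc (Suc ?m)). pair_coeff \<beta> ?m q * cavity_nu_deriv \<beta> N m0 (Suc i) t (q # I))) (at t)"
    by (intro DERIV_sum DERIV_cmult Suc.IH) (rule replica_pairs_Cons_site_pairs[OF Suc.prems])
  then show ?case
    unfolding cavity_nu_deriv.simps(2)[of _ _ _ i] cavity_nu_deriv.simps(2)[of _ _ _ "Suc i" _ I] .
qed

lemma continuous_on_cavity_nu_deriv: "continuous_on S (\<lambda>t. cavity_nu_deriv \<beta> N m0 i t I)"
  by (induction i arbitrary: I) (auto intro!: continuous_intros continuous_on_cavity_nu)

text \<open>Derivatives exist only for \<open>t > 0\<close>, so Taylor's formula is used between 1
  and a positive point and the bound passes to 0 by continuity. The factorial and the power of the
  distance are simply bounded by one.\<close>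

lemma taylor_expansion_at_1:
  fixes F :: "nat \<Rightarrow> real \<Rightarrow> real"
  assumes deriv: "\<And>i t. 0 < t \<Longrightarrow> t \<le> 1 \<Longrightarrow> (F i has_real_derivative F (Suc i) t) (at t)"
    and cont: "continuous_on {0..1} (F 0)" and P: "0 < P"
    and bound: "\<And>t. 0 \<le> t \<Longrightarrow> t \<le> 1 \<Longrightarrow> \<bar>F P t\<bar> \<le> B"
  shows "\<bar>F 0 0 - (\<Sum>i<P. (-1) ^ i / fact i * F i 1)\<bar> \<le> B"
proof -
  define D where "D = (\<lambda>x. F 0 x - (\<Sum>i<P. F i 1 / fact i * (x - 1) ^ i))"
  have D: "\<bar>D x\<bar> \<le> B" if x: "0 < x" "x < 1" for x
  proof -
    have "\<exists>t>x. t < 1 \<and> F 0 x = (\<Sum>i<P. F i 1 / fact i * (x - 1) ^ i) + F P t / fact P * (x - 1) ^ P"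
      by (rule Taylor_down[of P F "F 0" x 1 1]) (use deriv P x in auto)
    then obtain t where t: "x < t" "t < 1" "D x = F P t / fact P * (x - 1) ^ P"
      by (auto simp: D_def)
    have "\<bar>D x\<bar> = \<bar>F P t\<bar> / fact P * \<bar>x - 1\<bar> ^ P"
      by (simp add: t(3) abs_mult power_abs)
    also have "\<dots> \<le> \<bar>F P t\<bar> / 1 * 1"
      using x by (intro mult_mono divide_left_mono power_le_one) (auto simp: fact_ge_1)
    finally show ?thesis using bound[of t] x t by simp
  qed
  have "continuous_on {0..1} D"
    unfolding D_def by (intro continuous_intros cont)
  then have "(D \<longlongrightarrow> D 0) (at 0 within {0..1})"
    by (simp add: continuous_on_def)
  then have "(D \<longlongrightarrow> D 0) (at_right 0)"
    by (simp add: at_within_Icc_at_right)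
  then have "((\<lambda>x. \<bar>D x\<bar>) \<longlongrightarrow> \<bar>D 0\<bar>) (at_right 0)"
    by (rule tendsto_rabs)
  moreover have "eventually (\<lambda>x. \<bar>D x\<bar> \<le> B) (at_right 0)"
    using eventually_at_right_less[of "0 :: real"] eventually_at_rightI[of 0 1 "\<lambda>x. x < 1"]
    by (rule eventually_elim2[OF _ _ D]) auto
  ultimately have "\<bar>D 0\<bar> \<le> B"
    by (intro tendsto_upperbound[of _ _ "at_right 0"]) auto
  then show ?thesis
    by (simp add: D_def mult.commute)
qed

section \<open>Size of the Taylor remainder\<close>

lemma abs_cavity_overlap_le_1:
  assumes "\<sigma> \<in> spin_configs N" "\<tau> \<in> spin_configs N"
  shows "\<bar>cavity_overlap N \<sigma> \<tau>\<bar> \<le> 1"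
proof -
  have "\<bar>\<Sum>i\<in>{1..<N}. \<sigma> i * \<tau> i\<bar> \<le> (\<Sum>i\<in>{1..<N}. \<bar>\<sigma> i * \<tau> i\<bar>)"
    by (rule sum_abs)
  also have "\<dots> = (\<Sum>i\<in>{1..<N}. 1)"
    by (intro sum.cong) (auto simp: abs_mult abs_spin[OF assms(1)] abs_spin[OF assms(2)])
  also have "\<dots> \<le> real N" by simp
  finally show ?thesis
    by (cases "N = 0") (auto simp: cavity_overlap_def abs_mult divide_le_eq)
qed

text \<open>Either all overlaps are below \<open>\<delta>\<close>, which gives the power, or some
  indicator equals 1 and already dominates the product, which never exceeds 1.\<close>

lemma abs_cavity_prod_le:
  assumes s: "s \<in> replica_configs N m" and N: "1 \<le> N" and \<delta>: "0 \<le> \<delta>"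
    and I: "replica_pairs I" "num_replicas I \<le> m"
  shows "\<bar>cavity_prod N I s\<bar>
    \<le> \<delta> ^ length I + (\<Sum>q\<leftarrow>I. of_bool (\<delta> \<le> \<bar>cavity_overlap N (s (fst q)) (s (snd q))\<bar>))"
proof -
  define R where "R = (\<lambda>q. \<bar>cavity_overlap N (s (fst q)) (s (snd q))\<bar>)"
  have sp: "s (fst q) \<in> spin_configs N \<and> s (snd q) \<in> spin_configs N" if "q \<in> set I" for q
    using replica_pairsD[OF I(1), of "fst q" "snd q"] num_replicas_ge[of "fst q" "snd q" I] I(2) that
    by (auto intro!: replica_configsD[OF s])
  have "\<bar>cavity_prod N I s\<bar> = (\<Prod>q\<leftarrow>I. \<bar>s (fst q) N * s (snd q) N * cavity_overlap N (s (fst q)) (s (snd q))\<bar>)"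
    unfolding cavity_prod_def by (induction I) (auto simp: abs_mult case_prod_unfold)
  also have "\<dots> = (\<Prod>q\<leftarrow>I. R q)"
    using sp N by (intro arg_cong[of _ _ prod_list] map_cong) (auto simp: R_def abs_mult abs_spin[where N = N])
  finally have abs: "\<bar>cavity_prod N I s\<bar> = (\<Prod>q\<leftarrow>I. R q)" .
  have R: "0 \<le> R q \<and> R q \<le> 1" if "q \<in> set I" for q
    using sp[OF that] abs_cavity_overlap_le_1 by (simp add: R_def)
  have "(\<Prod>q\<leftarrow>I. R q) \<le> 1 \<and> 0 \<le> (\<Prod>q\<leftarrow>I. R q) \<and> (\<Prod>q\<leftarrow>I. R q) \<le> \<delta> ^ length I + (\<Sum>q\<leftarrow>I. of_bool (\<delta> \<le> R q))"
    using R
  proof (induction I)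
    case (Cons q I)
    let ?P = "\<Prod>q\<leftarrow>I. R q" and ?S = "\<Sum>q\<leftarrow>I. of_bool (\<delta> \<le> R q) :: real"
    have IH: "?P \<le> 1" "0 \<le> ?P" "?P \<le> \<delta> ^ length I + ?S" and q: "0 \<le> R q" "R q \<le> 1"
      using Cons by auto
    have S: "0 \<le> ?S" by (induction I) auto
    have le1: "R q * ?P \<le> 1"
      using IH q by (intro mult_le_one)
    have "R q * ?P \<le> \<delta> ^ length (q # I) + (of_bool (\<delta> \<le> R q) + ?S)"
    proof (cases "\<delta> \<le> R q")
      case True
      then show ?thesis
        using le1 S \<delta> by (simp add: add_increasing)
    next
      case False
      have "R q * ?P \<le> R q * (\<delta> ^ length I + ?S)"
        using IH q by (intro mult_left_mono)
      also have "\<dots> = R q * \<delta> ^ length I + R q * ?S"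
        by (simp add: distrib_left)
      also have "\<dots> \<le> \<delta> * \<delta> ^ length I + 1 * ?S"
        using False q S \<delta> by (intro add_mono mult_right_mono) auto
      finally show ?thesis using False by simp
    qed
    then show ?case
      using le1 IH q by simp
  qed simp
  then show ?thesis
    using abs by (simp add: R_def)
qed

text \<open>The exponent 1/8 balances two demands: eight factors below the threshold must gain
  \<open>1 / N\<close>, while \<open>\<delta> ^ 4 * N\<close> must still grow like a power of
  \<open>N\<close> for the exponential tail to beat every power.\<close>

lemma cavity_nu_remainder_bound:
  assumes \<beta>: "0 < \<beta>" "\<beta> < 1" and I: "replica_pairs I" and len: "8 * (n + 1) \<le> length I"
  shows "\<exists>K. \<forall>N\<ge>1. \<forall>t\<in>{0..1}. \<bar>cavity_nu \<beta> N t I\<bar> \<le> K / real N ^ (n + 1)"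
proof -
  define C where "C = max 1 (second_moment_bound \<beta>)"
  define \<kappa> where "\<kappa> = (1 - \<beta>\<^sup>2) / 4"
  define c where "c = \<kappa>\<^sup>2 / 64"
  have "\<beta>\<^sup>2 < 1"
    using \<beta> by (simp add: power_less_one_iff abs_square_less_1)
  then have c: "c > 0" by (simp add: c_def \<kappa>_def)
  have C1: "C \<ge> 1" by (simp add: C_def)
  \<comment> \<open>The tail decays in \<open>sqrt N\<close>, so a term of order
    \<open>2 * (n + 1)\<close> of the exponential series is needed to reach
    \<open>N ^ (n + 1)\<close>.\<close>
  define p where "p = 2 * (n + 1)"
  define K where "K = 1 + real (length I) * (5 * C * (fact p / c ^ p))"
  show ?thesis
  proof (intro exI[of _ K] allI impI ballI)
    fix N :: nat and t :: real assume N: "1 \<le> N" and t: "t \<in> {0..1}"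
    define \<delta> where "\<delta> = real N powr (- 1 / 8)"
    have \<delta>: "0 \<le> \<delta>" "\<delta> \<le> 1"
      using N powr_mono[of "- 1 / 8" 0 "real N"] by (auto simp: \<delta>_def)
    have "\<delta> ^ length I \<le> \<delta> ^ (8 * (n + 1))"
      using \<delta> len by (intro power_decreasing) auto
    also have "\<delta> ^ (8 * (n + 1)) = 1 / real N ^ (n + 1)"
    proof -
      have "\<delta> ^ 8 = real N powr (- 1)"
        using N by (simp add: \<delta>_def powr_power)
      then have "\<delta> ^ 8 = 1 / real N"
        using N by (simp add: powr_minus_divide)
      then show ?thesis by (simp only: power_mult power_one_over)
    qed
    finally have pow: "\<delta> ^ length I \<le> 1 / real N ^ (n + 1)" .
    have \<delta>4: "\<delta> ^ 4 * real N = sqrt (real N)"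
    proof -
      have "\<delta> ^ 4 * real N = real N powr (- 1 / 2) * real N powr 1"
        using N by (simp add: \<delta>_def powr_power)
      also have "\<dots> = sqrt (real N)"
        using N by (simp only: powr_add[symmetric]) (simp add: powr_half_sqrt)
      finally show ?thesis .
    qed
    have expb: "exp (- (c * sqrt (real N))) \<le> (fact p / c ^ p) / real N ^ (n + 1)"
    proof -
      let ?x = "c * sqrt (real N)"
      have x: "?x > 0" using c N by simp
      have "?x ^ p / fact p \<le> exp ?x"
        using x sum_le_suminf[OF summable_exp_generic[of ?x], of "{p}"]
        by (simp add: exp_def divide_inverse mult.commute)
      then have "exp (- ?x) \<le> fact p / ?x ^ p"
        using zero_less_power[OF x, of p] by (simp add: exp_minus field_simps del: zero_less_power)
      also have "?x ^ p = c ^ p * real N ^ (n + 1)"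
        unfolding power_mult_distrib p_def power_mult[of "sqrt _"] by simp
      finally show ?thesis by simp
    qed
    let ?m = "num_replicas I"
    have pair: "nu_interp \<beta> N t ?m (\<lambda>s. of_bool (\<delta> \<le> \<bar>cavity_overlap N (s (fst q)) (s (snd q))\<bar>))
        \<le> 5 * C * (fact p / c ^ p) / real N ^ (n + 1)" if q: "q \<in> set I" for q
    proof -
      have "fst q \<in> {1..?m}" "snd q \<in> {1..?m}" "fst q \<noteq> snd q"
        using replica_pairsD[OF I, of "fst q" "snd q"] num_replicas_ge[of "fst q" "snd q" I] q by auto
      then have "nu_interp \<beta> N t ?m (\<lambda>s. of_bool (\<delta> \<le> \<bar>cavity_overlap N (s (fst q)) (s (snd q))\<bar>))
          \<le> 5 * C * exp (- (\<kappa>\<^sup>2 / 64 * \<delta> ^ 4 * real N))"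
        using t by (intro nu_interp_large_overlap_le \<beta> N \<delta> C_def \<kappa>_def) auto
      also have "\<kappa>\<^sup>2 / 64 * \<delta> ^ 4 * real N = c * sqrt (real N)"
        using \<delta>4 by (simp add: c_def)
      also have "5 * C * exp (- (c * sqrt (real N))) \<le> 5 * C * ((fact p / c ^ p) / real N ^ (n + 1))"
        using C1 by (intro mult_left_mono expb) auto
      finally show ?thesis by simp
    qed
    have "\<bar>cavity_nu \<beta> N t I\<bar> \<le> nu_interp \<beta> N t ?m (\<lambda>s. \<bar>cavity_prod N I s\<bar>)"
      unfolding cavity_nu_def by (rule nu_interp_abs_le)
    also have "\<dots> \<le> nu_interp \<beta> N t ?m (\<lambda>s. \<delta> ^ length I +
        (\<Sum>q\<leftarrow>I. of_bool (\<delta> \<le> \<bar>cavity_overlap N (s (fst q)) (s (snd q))\<bar>)))"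
      by (intro nu_interp_mono abs_cavity_prod_le N \<delta> I) auto
    also have "\<dots> = \<delta> ^ length I +
        (\<Sum>q\<leftarrow>I. nu_interp \<beta> N t ?m (\<lambda>s. of_bool (\<delta> \<le> \<bar>cavity_overlap N (s (fst q)) (s (snd q))\<bar>)))"
      by (simp only: nu_interp_add nu_interp_const nu_interp_sum_list)
    also have "\<dots> \<le> 1 / real N ^ (n + 1) + (\<Sum>q\<leftarrow>I. 5 * C * (fact p / c ^ p) / real N ^ (n + 1))"
      by (intro add_mono pow sum_list_mono pair)
    also have "\<dots> = K / real N ^ (n + 1)"
      by (simp add: K_def sum_list_triv add_divide_distrib)
    finally show "\<bar>cavity_nu \<beta> N t I\<bar> \<le> K / real N ^ (n + 1)" .
  qed
qed

text \<open>An \<open>i\<close>-th derivative is a finite combination, with coefficients free of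
  \<open>N\<close>, of averages with \<open>i\<close> more factors; missing factors can thus be
  supplied by differentiation.\<close>

lemma cavity_nu_deriv_remainder_bound:
  assumes \<beta>: "0 < \<beta>" "\<beta> < 1" and I: "replica_pairs I" and len: "8 * (n + 1) \<le> length I + i"
  shows "\<exists>K. \<forall>N\<ge>1. \<forall>t\<in>{0..1}. \<bar>cavity_nu_deriv \<beta> N m0 i t I\<bar> \<le> K / real N ^ (n + 1)"
  using I len
proof (induction i arbitrary: I)
  case 0
  then show ?case using cavity_nu_remainder_bound[OF \<beta>] by simp
next
  case (Suc i)
  let ?m = "max m0 (num_replicas I)"
  let ?P = "site_pairs (Suc (Suc ?m))"
  have "\<forall>q\<in>?P. \<exists>K. \<forall>N\<ge>1. \<forall>t\<in>{0..1}. \<bar>cavity_nu_deriv \<beta> N m0 i t (q # I)\<bar> \<le> K / real N ^ (n + 1)"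
    using Suc.prems by (intro ballI Suc.IH replica_pairs_Cons_site_pairs[of I]) auto
  then obtain K where K: "\<And>q N t. q \<in> ?P \<Longrightarrow> 1 \<le> N \<Longrightarrow> t \<in> {0..1} \<Longrightarrow>
      \<bar>cavity_nu_deriv \<beta> N m0 i t (q # I)\<bar> \<le> K q / real N ^ (n + 1)"
    by metis
  show ?case
  proof (intro exI allI impI ballI)
    fix N :: nat and t :: real assume N: "1 \<le> N" and t: "t \<in> {0..1}"
    have "\<bar>cavity_nu_deriv \<beta> N m0 (Suc i) t I\<bar>
        \<le> (\<Sum>q\<in>?P. \<bar>pair_coeff \<beta> ?m q\<bar> * \<bar>cavity_nu_deriv \<beta> N m0 i t (q # I)\<bar>)"
      unfolding cavity_nu_deriv.simps(2) abs_mult[symmetric] by (rule sum_abs)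
    also have "\<dots> \<le> (\<Sum>q\<in>?P. \<bar>pair_coeff \<beta> ?m q\<bar> * (K q / real N ^ (n + 1)))"
      by (intro sum_mono mult_left_mono K N t) auto
    also have "\<dots> = (\<Sum>q\<in>?P. \<bar>pair_coeff \<beta> ?m q\<bar> * K q) / real N ^ (n + 1)"
      by (simp add: sum_divide_distrib)
    finally show "\<bar>cavity_nu_deriv \<beta> N m0 (Suc i) t I\<bar>
        \<le> (\<Sum>q\<in>?P. \<bar>pair_coeff \<beta> ?m q\<bar> * K q) / real N ^ (n + 1)" .
  qed
qed

lemma cavity_nu_taylor:
  assumes \<beta>: "0 < \<beta>" "\<beta> < 1" and I: "replica_pairs I" and P: "0 < P" "8 * (n + 1) \<le> length I + P"
  shows "\<exists>K. \<forall>N\<ge>1.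
    \<bar>cavity_nu \<beta> N 0 I - (\<Sum>i<P. (-1) ^ i / fact i * cavity_nu_deriv \<beta> N m0 i 1 I)\<bar> \<le> K / real N ^ (n + 1)"
proof -
  obtain K where K: "\<And>N t. 1 \<le> N \<Longrightarrow> t \<in> {0..1} \<Longrightarrow> \<bar>cavity_nu_deriv \<beta> N m0 P t I\<bar> \<le> K / real N ^ (n + 1)"
    using cavity_nu_deriv_remainder_bound[OF \<beta> I P(2), of m0] by metis
  show ?thesis
  proof (intro exI allI impI)
    fix N :: nat assume N: "1 \<le> N"
    show "\<bar>cavity_nu \<beta> N 0 I - (\<Sum>i<P. (-1) ^ i / fact i * cavity_nu_deriv \<beta> N m0 i 1 I)\<bar> \<le> K / real N ^ (n + 1)"
      using taylor_expansion_at_1[where F = "\<lambda>i t. cavity_nu_deriv \<beta> N m0 i t I",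
          OF cavity_nu_deriv_has_derivative[OF _ N I] continuous_on_cavity_nu_deriv P(1) K[OF N]]
      by simp
  qed
qed

section \<open>Symmetries of the replicas and of the sites\<close>

text \<open>The exponent of the last spin of replica \<open>a\<close> in the product over
  \<open>I\<close>. Its parity is what matters, since that spin squares to one.\<close>

definition replica_count :: "nat \<Rightarrow> (nat \<times> nat) list \<Rightarrow> nat" where
  "replica_count a I = (\<Sum>q\<leftarrow>I. of_bool (fst q = a) + of_bool (snd q = a))"

lemma replica_count_Cons:
  "replica_count a (q # I) = of_bool (fst q = a) + of_bool (snd q = a) + replica_count a I"
  by (simp add: replica_count_def)

lemma replica_count_odd_mem:
  assumes "odd (replica_count a I)" "replica_pairs I"
  shows "a \<in> {1..num_replicas I}"
proof -
  have "replica_count a I \<noteq> 0" using assms(1) by (metis even_zero)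
  then have "\<exists>q\<in>set I. fst q = a \<or> snd q = a"
    unfolding replica_count_def by (induction I) (auto split: if_splits)
  then obtain q where q: "q \<in> set I" "fst q = a \<or> snd q = a" by blast
  then show ?thesis
    using replica_pairsD[OF assms(2), of "fst q" "snd q"] num_replicas_ge[of "fst q" "snd q" I] by auto
qed

definition flip_spin :: "nat \<Rightarrow> nat \<Rightarrow> (nat \<Rightarrow> nat \<Rightarrow> real) \<Rightarrow> nat \<Rightarrow> nat \<Rightarrow> real" where
  "flip_spin N a s = s(a := (s a)(N := - s a N))"

lemma flip_spin_flip_spin [simp]: "flip_spin N a (flip_spin N a s) = s"
  by (simp add: flip_spin_def)

lemma flip_spin_in_replica_configs:
  assumes "s \<in> replica_configs N m" "a \<in> {1..m}" "1 \<le> N"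
  shows "flip_spin N a s \<in> replica_configs N m"
proof -
  have "s a \<in> spin_configs N" using assms replica_configsD by blast
  then have "(s a)(N := - s a N) \<in> spin_configs N"
    using spin_configsD[of "s a" N N] assms(3)
    unfolding spin_configs_def by (auto simp: PiE_def extensional_def Pi_def)
  then show ?thesis
    using assms unfolding replica_configs_def flip_spin_def
    by (auto simp: PiE_def extensional_def Pi_def)
qed

lemma boltzmann_interp_0_flip:
  "boltzmann \<beta> N (interp N 0 a) (\<sigma>(N := x)) = boltzmann \<beta> N (interp N 0 a) \<sigma>"
proof -
  have "(\<Sum>p\<in>site_pairs N. interp N 0 a p * pair_spin p (\<sigma>(N := x))) = (\<Sum>p\<in>site_pairs N. interp N 0 a p * pair_spin p \<sigma>)"
    by (rule sum.cong) (auto simp: interp_def pair_spin_def site_pairs_def)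
  then show ?thesis by (simp add: boltzmann_eq)
qed

lemma cavity_overlap_upd [simp]:
  "cavity_overlap N (\<sigma>(N := x)) \<tau> = cavity_overlap N \<sigma> \<tau>"
  "cavity_overlap N \<sigma> (\<tau>(N := x)) = cavity_overlap N \<sigma> \<tau>"
  by (simp_all add: cavity_overlap_def)

lemma cavity_prod_flip_spin:
  assumes "replica_pairs I"
  shows "cavity_prod N I (flip_spin N a s) = (-1) ^ replica_count a I * cavity_prod N I s"
  using assms
proof (induction I)
  case Nil
  then show ?case by (simp add: cavity_prod_def replica_count_def)
next
  case (Cons q I)
  obtain j l where q: "q = (j, l)" by (cases q)
  with Cons.prems have "j \<noteq> l" "replica_pairs I"
    by (auto simp: replica_pairs_Cons)
  moreover have "cavity_prod N (q # I) s' = s' j N * s' l N * cavity_overlap N (s' j) (s' l) * cavity_prod N I s'" for s'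
    by (simp add: cavity_prod_def q)
  ultimately show ?case
    using Cons.IH by (auto simp: replica_count_Cons q flip_spin_def)
qed

lemma cavity_nu_0_odd:
  assumes "odd (replica_count a I)" "replica_pairs I" "1 \<le> N"
  shows "cavity_nu \<beta> N 0 I = 0"
proof -
  let ?m = "num_replicas I"
  have a: "a \<in> {1..?m}" by (rule replica_count_odd_mem[OF assms(1,2)])
  have "gibbs_average \<beta> N (interp N 0 g) ?m (cavity_prod N I) = 0" for g
  proof -
    let ?w = "\<lambda>s. \<Prod>l=1..?m. boltzmann \<beta> N (interp N 0 g) (s l)"
    have w: "?w (flip_spin N a s) = ?w s" for s
      by (intro prod.cong refl) (simp add: flip_spin_def boltzmann_interp_0_flip)
    have "(\<Sum>s\<in>replica_configs N ?m. cavity_prod N I s * ?w s)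
        = (\<Sum>s\<in>replica_configs N ?m. cavity_prod N I (flip_spin N a s) * ?w (flip_spin N a s))"
      by (rule sum.reindex_bij_witness[of _ "flip_spin N a" "flip_spin N a"])
         (auto intro: flip_spin_in_replica_configs a assms(3))
    also have "\<dots> = - (\<Sum>s\<in>replica_configs N ?m. cavity_prod N I s * ?w s)"
      unfolding w cavity_prod_flip_spin[OF assms(2)] using assms(1) by (simp add: sum_negf)
    finally show ?thesis by (simp add: gibbs_average_eq)
  qed
  then show ?thesis by (simp add: cavity_nu_def nu_interp_def)
qed

section \<open>Exchanging a site with the last one\<close>

lemma transpose_in_sites_iff:
  fixes i N x :: nat
  assumes "i \<in> {1..N}"
  shows "Transposition.transpose i N x \<in> {1..N} \<longleftrightarrow> x \<in> {1..N}"
  using assms by (auto simp: Transposition.transpose_def)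

text \<open>Couplings are stored only for increasing pairs, so the image of a pair under the
  transposition is sorted again.\<close>

definition swap_pair :: "nat \<Rightarrow> nat \<Rightarrow> nat \<times> nat \<Rightarrow> nat \<times> nat" where
  "swap_pair i N p = (let j = Transposition.transpose i N (fst p); l = Transposition.transpose i N (snd p) in (min j l, max j l))"

lemma swap_pair_in_site_pairs:
  assumes "p \<in> site_pairs N" "i \<in> {1..N}"
  shows "swap_pair i N p \<in> site_pairs N"
proof -
  have p: "fst p \<in> {1..N}" "snd p \<in> {1..N}" "fst p \<noteq> snd p"
    using assms(1) by (auto simp: site_pairs_def)
  then have "Transposition.transpose i N (fst p) \<in> {1..N}" "Transposition.transpose i N (snd p) \<in> {1..N}"
    "Transposition.transpose i N (fst p) \<noteq> Transposition.transpose i N (snd p)"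
    using transpose_in_sites_iff[OF assms(2)] by (auto dest: injD[OF inj_transpose])
  then show ?thesis
    by (auto simp: swap_pair_def site_pairs_def Let_def min_def max_def)
qed

lemma swap_pair_swap_pair:
  assumes "p \<in> site_pairs N"
  shows "swap_pair i N (swap_pair i N p) = p"
proof -
  obtain x y where p: "p = (x, y)" "x < y"
    using assms by (auto simp: site_pairs_def)
  show ?thesis
    by (cases "Transposition.transpose i N x \<le> Transposition.transpose i N y") (use p in \<open>auto simp: swap_pair_def Let_def min_def max_def\<close>)
qed

lemma pair_spin_swap_pair: "pair_spin (swap_pair i N p) \<sigma> = pair_spin p (\<sigma> \<circ> Transposition.transpose i N)"
  by (auto simp: pair_spin_def swap_pair_def Let_def min_def max_def)

lemma boltzmann_swap:
  assumes "i \<in> {1..N}"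
  shows "boltzmann \<beta> N (\<lambda>p. a (swap_pair i N p)) (\<sigma> \<circ> Transposition.transpose i N) = boltzmann \<beta> N a \<sigma>"
proof -
  have "(\<Sum>p\<in>site_pairs N. a (swap_pair i N p) * pair_spin p (\<sigma> \<circ> Transposition.transpose i N)) = (\<Sum>p\<in>site_pairs N. a p * pair_spin p \<sigma>)"
    by (rule sum.reindex_bij_witness[of _ "swap_pair i N" "swap_pair i N"])
       (auto simp: swap_pair_in_site_pairs[OF _ assms] swap_pair_swap_pair pair_spin_swap_pair)
  then show ?thesis by (simp add: boltzmann_eq)
qed

lemma comp_transpose_spin_configs:
  assumes "i \<in> {1..N}" "\<sigma> \<in> spin_configs N"
  shows "\<sigma> \<circ> Transposition.transpose i N \<in> spin_configs N"
  using assms(2) transpose_in_sites_iff[OF assms(1)] unfolding spin_configs_def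
  by (auto simp: PiE_iff extensional_def)

text \<open>The restriction to \<open>{1..m}\<close> keeps the result in the extensional space of
  replica configurations, on which the map is an involution.\<close>

definition swap_sites :: "nat \<Rightarrow> nat \<Rightarrow> nat \<Rightarrow> (nat \<Rightarrow> nat \<Rightarrow> real) \<Rightarrow> nat \<Rightarrow> nat \<Rightarrow> real" where
  "swap_sites i N m s = (\<lambda>l\<in>{1..m}. s l \<circ> Transposition.transpose i N)"

lemma comp_transpose_twice [simp]: "f \<circ> Transposition.transpose i N \<circ> Transposition.transpose i N = f"
  by (simp add: comp_assoc)

lemma swap_sites_swap_sites:
  assumes "s \<in> replica_configs N m"
  shows "swap_sites i N m (swap_sites i N m s) = s"
  using assms by (auto simp: swap_sites_def replica_configs_def PiE_def extensional_def fun_eq_iff)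

lemma swap_sites_in_replica_configs:
  assumes "i \<in> {1..N}" "s \<in> replica_configs N m"
  shows "swap_sites i N m s \<in> replica_configs N m"
  using assms comp_transpose_spin_configs[OF assms(1)]
  unfolding swap_sites_def replica_configs_def by auto

text \<open>The energy is unchanged when sites and couplings are exchanged together, so a
  relabelling of the couplings can be moved onto the observable.\<close>

lemma gibbs_average_swap_sites:
  assumes "i \<in> {1..N}"
  shows "gibbs_average \<beta> N (\<lambda>p. a (swap_pair i N p)) m f = gibbs_average \<beta> N a m (\<lambda>s. f (swap_sites i N m s))"
proof -
  let ?a = "\<lambda>p. a (swap_pair i N p)"
  have Z: "partition_function \<beta> N ?a = partition_function \<beta> N a"
    unfolding partition_function_eq
    by (rule sum.reindex_bij_witness[of _ "\<lambda>\<sigma>. \<sigma> \<circ> Transposition.transpose i N" "\<lambda>\<sigma>. \<sigma> \<circ> Transposition.transpose i N"])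
       (auto simp: comp_transpose_spin_configs[OF assms] boltzmann_swap[OF assms, of \<beta> a "_ \<circ> Transposition.transpose i N", simplified])
  have w: "(\<Prod>l=1..m. boltzmann \<beta> N ?a (swap_sites i N m s l)) = (\<Prod>l=1..m. boltzmann \<beta> N a (s l))" for s
    by (intro prod.cong refl) (simp add: swap_sites_def boltzmann_swap[OF assms])
  have "(\<Sum>s\<in>replica_configs N m. f (swap_sites i N m s) * (\<Prod>l=1..m. boltzmann \<beta> N ?a (swap_sites i N m s l)))
      = (\<Sum>s\<in>replica_configs N m. f s * (\<Prod>l=1..m. boltzmann \<beta> N ?a (s l)))"
    by (rule sum.reindex_bij_witness[of _ "swap_sites i N m" "swap_sites i N m"])
       (auto simp: swap_sites_in_replica_configs[OF assms] swap_sites_swap_sites)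
  then show ?thesis
    unfolding gibbs_average_eq Z w by simp
qed

text \<open>At \<open>t = 1\<close> all couplings are independent with one common law, so
  relabelling them preserves the joint law. For other \<open>t\<close> the last site is
  distinguished by its scaling.\<close>

lemma nu_interp_swap_sites:
  assumes "i \<in> {1..N}"
  shows "nu_interp \<beta> N 1 m (\<lambda>s. f (swap_sites i N m s)) = nu_interp \<beta> N 1 m f"
proof -
  let ?P = "site_pairs N"
  let ?r = "\<lambda>a. \<lambda>p\<in>?P. a (swap_pair i N p)"
  have inj: "inj_on (swap_pair i N) ?P"
    by (rule inj_on_inverseI[of _ "swap_pair i N"]) (rule swap_pair_swap_pair)
  have law: "distr (gauss ?P) (gauss ?P) ?r = gauss ?P"
    by (rule distr_PiM_reindex[OF _ inj])
       (auto simp: swap_pair_in_site_pairs[OF _ assms] std_gauss.prob_space_axioms)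
  have meas: "?r \<in> measurable (gauss ?P) (gauss ?P)"
    by (rule measurable_restrict) (auto intro!: measurable_component_singleton swap_pair_in_site_pairs[OF _ assms])
  have restr: "gibbs_average \<beta> N (restrict a ?P) m f = gibbs_average \<beta> N a m f" for a
  proof -
    have "boltzmann \<beta> N (restrict a ?P) \<sigma> = boltzmann \<beta> N a \<sigma>" for \<sigma>
      unfolding boltzmann_eq by simp
    then show ?thesis
      unfolding gibbs_average_eq partition_function_eq by simp
  qed
  have "nu_interp \<beta> N 1 m f = (\<integral>a. gibbs_average \<beta> N a m f \<partial>distr (gauss ?P) (gauss ?P) ?r)"
    unfolding law by (simp add: nu_interp_def)
  also have "\<dots> = (\<integral>a. gibbs_average \<beta> N (?r a) m f \<partial>gauss ?P)"
    using measurable_gibbs_average_interp[of \<beta> N 1 m f] by (intro integral_distr[OF meas]) simp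
  also have "\<dots> = nu_interp \<beta> N 1 m (\<lambda>s. f (swap_sites i N m s))"
    unfolding restr gibbs_average_swap_sites[OF assms] by (simp add: nu_interp_def)
  finally show ?thesis ..
qed

section \<open>Dropping a factor when every replica occurs evenly\<close>

definition overlap_nu :: "real \<Rightarrow> nat \<Rightarrow> (nat \<times> nat) list \<Rightarrow> real" where
  "overlap_nu \<beta> N I = nu_interp \<beta> N 1 (num_replicas I) (spin_overlap_prod N I)"

lemma depends_on_first_spin_overlap_prod:
  "replica_pairs I \<Longrightarrow> num_replicas I \<le> m \<Longrightarrow> depends_on_first m (spin_overlap_prod N I)"
  unfolding spin_overlap_prod_def
  by (rule depends_on_first_prod_list[where F = "\<lambda>\<sigma> \<tau>. \<sigma> N * \<tau> N * overlap N \<sigma> \<tau>"])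

lemma overlap_nu_eq:
  "replica_pairs I \<Longrightarrow> num_replicas I \<le> m \<Longrightarrow> nu_interp \<beta> N 1 m (spin_overlap_prod N I) = overlap_nu \<beta> N I"
  unfolding overlap_nu_def by (rule nu_interp_more_replicas[OF depends_on_first_spin_overlap_prod]) auto

lemma overlap_swap_sites:
  assumes "i \<in> {1..N}" "j \<in> {1..m}" "l \<in> {1..m}"
  shows "overlap N (swap_sites i N m s j) (swap_sites i N m s l) = overlap N (s j) (s l)"
proof -
  have "(\<Sum>k=1..N. s j (Transposition.transpose i N k) * s l (Transposition.transpose i N k)) = (\<Sum>k=1..N. s j k * s l k)"
    by (rule sum.reindex_bij_witness[of _ "Transposition.transpose i N" "Transposition.transpose i N"])
       (use transpose_in_sites_iff[OF assms(1)] in auto)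
  then show ?thesis
    using assms by (simp add: overlap_def swap_sites_def)
qed

text \<open>Regroups the last spins by replica, so that parity alone decides whether they
  cancel.\<close>

lemma prod_list_spins_eq:
  fixes s :: "nat \<Rightarrow> nat \<Rightarrow> real"
  assumes "replica_pairs I" "num_replicas I \<le> m"
  shows "(\<Prod>(j, l)\<leftarrow>I. s j N * s l N) = (\<Prod>a=1..m. (s a N) ^ replica_count a I)"
  using assms
proof (induction I)
  case Nil
  then show ?case by (simp add: replica_count_def)
next
  case (Cons q I)
  obtain j l where q: "q = (j, l)" by (cases q)
  have jl: "j \<in> {1..m}" "l \<in> {1..m}" and I: "replica_pairs I" "num_replicas I \<le> m"
    using Cons.prems by (auto simp: q replica_pairs_Cons num_replicas_Cons)
  have "(\<Prod>a=1..m. (s a N) ^ replica_count a (q # I))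
      = (\<Prod>a=1..m. if j = a then s a N else 1) * (\<Prod>a=1..m. if l = a then s a N else 1)
        * (\<Prod>a=1..m. (s a N) ^ replica_count a I)"
    unfolding prod.distrib[symmetric] by (intro prod.cong refl) (auto simp: replica_count_Cons q)
  then show ?case
    using jl Cons.IH[OF I] by (simp add: q)
qed

text \<open>When every replica occurs an even number of times, the last spins cancel from the product;
  site symmetry then trades the first overlap for the last spins of its two replicas, which are
  the ones missing from the remaining factors.\<close>

lemma overlap_nu_even:
  assumes I: "replica_pairs (q # I)" and even: "\<And>a. even (replica_count a (q # I))" and N: "1 \<le> N"
  shows "overlap_nu \<beta> N (q # I) = overlap_nu \<beta> N I"
proof -
  let ?m = "num_replicas (q # I)"
  obtain j l where q: "q = (j, l)" by (cases q)
  have jl: "j \<in> {1..?m}" "l \<in> {1..?m}" and I': "replica_pairs I" "num_replicas I \<le> ?m"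
    using I by (auto simp: q replica_pairs_Cons num_replicas_Cons)
  define R where "R = (\<lambda>s. \<Prod>(a, b)\<leftarrow>I. overlap N (s a) (s b))"
  have split: "spin_overlap_prod N J s = (\<Prod>(a, b)\<leftarrow>J. s a N * s b N) * (\<Prod>(a, b)\<leftarrow>J. overlap N (s a) (s b))" for J s
    unfolding spin_overlap_prod_def by (induction J) (auto simp: mult_ac)
  have one: "s j N * s l N * (\<Prod>(a, b)\<leftarrow>I. s a N * s b N) = 1" if s: "s \<in> replica_configs N ?m" for s
  proof -
    have "s j N * s l N * (\<Prod>(a, b)\<leftarrow>I. s a N * s b N) = (\<Prod>(a, b)\<leftarrow>q # I. s a N * s b N)"
      by (simp add: q)
    also have "\<dots> = (\<Prod>a=1..?m. (s a N) ^ replica_count a (q # I))"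
      by (rule prod_list_spins_eq[OF I]) simp
    also have "\<dots> = 1"
    proof (rule prod.neutral, rule ballI)
      fix a assume "a \<in> {1..?m}"
      then have "s a N = -1 \<or> s a N = 1"
        using spin_configsD[OF replica_configsD[OF s]] N by auto
      then show "(s a N) ^ replica_count a (q # I) = 1"
        using even[of a] by auto
    qed
    finally show ?thesis .
  qed
  have "overlap_nu \<beta> N (q # I) = nu_interp \<beta> N 1 ?m (\<lambda>s. \<Sum>i=1..N. 1 / real N * (s j i * s l i * R s))"
    unfolding overlap_nu_def
  proof (rule nu_interp_cong)
    fix s assume s: "s \<in> replica_configs N ?m"
    have "spin_overlap_prod N (q # I) s = overlap N (s j) (s l) * R s"
      unfolding split[of "q # I"] using one[OF s] by (simp add: q R_def)
    then show "spin_overlap_prod N (q # I) s = (\<Sum>i=1..N. 1 / real N * (s j i * s l i * R s))"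
      by (simp add: overlap_def sum_distrib_left sum_distrib_right sum_divide_distrib)
  qed
  also have "\<dots> = (\<Sum>i=1..N. 1 / real N * nu_interp \<beta> N 1 ?m (\<lambda>s. s j i * s l i * R s))"
    by (simp only: nu_interp_sum nu_interp_cmult)
  also have "\<dots> = (\<Sum>i=1..N. 1 / real N * nu_interp \<beta> N 1 ?m (\<lambda>s. s j N * s l N * R s))"
  proof (intro sum.cong refl arg_cong2[of _ _ _ _ "(*)"])
    fix i assume i: "i \<in> {1..N}"
    have R: "R (swap_sites i N ?m s) = R s" for s
      unfolding R_def
    proof (intro arg_cong[of _ _ prod_list] map_cong refl)
      fix p assume p: "p \<in> set I"
      obtain a b where ab: "p = (a, b)" by (cases p)
      have "a \<in> {1..?m}" "b \<in> {1..?m}"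
        using replica_pairsD[OF I'(1), of a b] num_replicas_ge[of a b I] p I'(2) by (auto simp: ab)
      then show "(case p of (a, b) \<Rightarrow> overlap N (swap_sites i N ?m s a) (swap_sites i N ?m s b))
          = (case p of (a, b) \<Rightarrow> overlap N (s a) (s b))"
        by (simp add: ab overlap_swap_sites[OF i])
    qed
    have "(\<lambda>s. s j i * s l i * R s) = (\<lambda>s. (\<lambda>s. s j N * s l N * R s) (swap_sites i N ?m s))"
      using jl by (simp add: R fun_eq_iff) (simp add: swap_sites_def)
    then show "nu_interp \<beta> N 1 ?m (\<lambda>s. s j i * s l i * R s) = nu_interp \<beta> N 1 ?m (\<lambda>s. s j N * s l N * R s)"
      using nu_interp_swap_sites[OF i, of \<beta> ?m "\<lambda>s. s j N * s l N * R s"] by simp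
  qed
  also have "\<dots> = nu_interp \<beta> N 1 ?m (\<lambda>s. s j N * s l N * R s)"
    using N by simp
  also have "\<dots> = nu_interp \<beta> N 1 ?m (spin_overlap_prod N I)"
  proof (rule nu_interp_cong)
    fix s assume s: "s \<in> replica_configs N ?m"
    let ?e = "\<Prod>(a, b)\<leftarrow>I. s a N * s b N"
    have sq: "(s j N * s l N)\<^sup>2 = 1"
      using spin_configsD[OF replica_configsD[OF s jl(1)], of N] spin_configsD[OF replica_configsD[OF s jl(2)], of N] N
      by auto
    have "?e = (s j N * s l N)\<^sup>2 * ?e"
      unfolding sq by simp
    also have "\<dots> = s j N * s l N * (s j N * s l N * ?e)"
      by (simp only: power2_eq_square mult.assoc)
    finally have "?e = s j N * s l N"
      unfolding one[OF s] by simp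
    then show "s j N * s l N * R s = spin_overlap_prod N I s"
      unfolding split R_def by simp
  qed
  also have "\<dots> = overlap_nu \<beta> N I"
    by (rule overlap_nu_eq[OF I'])
  finally show ?thesis .
qed

section \<open>Expandable sequences\<close>

text \<open>The nontrivial terms in expanding a product in which each factor is either kept or
  replaced by \<open>- 1 / N\<close>. A triple holds the sign, the number of replaced factors and
  the list of kept ones; the term that keeps all factors is left out.\<close>

primrec overlap_corrections :: "(nat \<times> nat) list \<Rightarrow> (real \<times> nat \<times> (nat \<times> nat) list) list" where
  "overlap_corrections [] = []"
| "overlap_corrections (q # I) =
     map (\<lambda>(K, j, J). (K, j, q # J)) (overlap_corrections I)
     @ (-1, 1, I) # map (\<lambda>(K, j, J). (- K, Suc j, J)) (overlap_corrections I)"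

text \<open>A correction trades a positive number \<open>j\<close> of factors for as many powers of
  \<open>1 / N\<close>, so its weight \<open>2 * j + length J\<close> is
  \<open>length I + j\<close>.\<close>

lemma overlap_corrections_props:
  "(K, j, J) \<in> set (overlap_corrections I) \<Longrightarrow> 0 < j \<and> j + length J = length I \<and> set J \<subseteq> set I"
  by (induction I arbitrary: K j J) fastforce+

lemma sum_list_case_mult:
  "(c :: real) * (\<Sum>(K, j, J)\<leftarrow>L. f K j J) = (\<Sum>(K, j, J)\<leftarrow>L. c * f K j J)"
  by (induction L) (auto simp: algebra_simps)

text \<open>Last spins square to one, so each cavity factor is the corresponding overlap factor
  minus exactly \<open>1 / N\<close>.\<close>

lemma cavity_prod_eq_overlap_prod:
  assumes s: "s \<in> replica_configs N m" and N: "1 \<le> N" and I: "replica_pairs I" "num_replicas I \<le> m"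
  shows "cavity_prod N I s = spin_overlap_prod N I s
    + (\<Sum>(K, j, J)\<leftarrow>overlap_corrections I. K * (1 / real N ^ j) * spin_overlap_prod N J s)"
  using I
proof (induction I)
  case Nil
  then show ?case by (simp add: cavity_prod_def spin_overlap_prod_def)
next
  case (Cons q I)
  obtain a b where q: "q = (a, b)" by (cases q)
  have ab: "a \<in> {1..m}" "b \<in> {1..m}" and I: "replica_pairs I" "num_replicas I \<le> m"
    using Cons.prems by (auto simp: q replica_pairs_Cons num_replicas_Cons)
  define x where "x = s a N * s b N * overlap N (s a) (s b)"
  define F where "F = (\<lambda>J. spin_overlap_prod N J s)"
  define L where "L = (\<Sum>(K, j, J)\<leftarrow>overlap_corrections I. K * (1 / real N ^ j) * F J)"
  have F: "F (q # J) = x * F J" for J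
    by (simp add: F_def spin_overlap_prod_def q x_def)
  have e: "(s a N * s b N) * (s a N * s b N) = 1"
    using spin_square[OF replica_configsD[OF s ab(1)], of N] spin_square[OF replica_configsD[OF s ab(2)], of N] N
    by (simp add: mult.left_commute mult.assoc)
  have "{1..N} = insert N {1..<N}" using N by auto
  then have "overlap N (s a) (s b) = cavity_overlap N (s a) (s b) + 1 / real N * (s a N * s b N)"
    by (simp add: overlap_def cavity_overlap_def distrib_left)
  then have "x = s a N * s b N * cavity_overlap N (s a) (s b) + 1 / real N * ((s a N * s b N) * (s a N * s b N))"
    unfolding x_def by (simp add: algebra_simps)
  then have x: "s a N * s b N * cavity_overlap N (s a) (s b) = x - 1 / real N"
    unfolding e by simp
  have "cavity_prod N (q # I) s = (x - 1 / real N) * cavity_prod N I s"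
    by (simp add: cavity_prod_def q flip: x)
  also have "cavity_prod N I s = F I + L"
    unfolding Cons.IH[OF I] F_def L_def ..
  also have "(x - 1 / real N) * (F I + L) = F (q # I) + (x * L - 1 / real N * F I - 1 / real N * L)"
    by (simp add: F algebra_simps add_divide_distrib)
  also have "x * L = (\<Sum>(K, j, J)\<leftarrow>overlap_corrections I. K * (1 / real N ^ j) * F (q # J))"
    unfolding L_def sum_list_case_mult by (simp add: F mult_ac)
  also have "1 / real N * L = - (\<Sum>(K, j, J)\<leftarrow>overlap_corrections I. - K * (1 / real N ^ Suc j) * F J)"
    unfolding L_def sum_list_case_mult by (induction "overlap_corrections I") (auto simp: case_prod_unfold uminus_sum_list_map o_def)
  finally show ?case
    by (simp add: F_def o_def case_prod_unfold)
qed

lemma cavity_nu_eq_overlap_nu: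
  assumes I: "replica_pairs I" and N: "1 \<le> N"
  shows "cavity_nu \<beta> N 1 I = overlap_nu \<beta> N I
    + (\<Sum>(K, j, J)\<leftarrow>overlap_corrections I. K * (1 / real N ^ j) * overlap_nu \<beta> N J)"
proof -
  let ?m = "num_replicas I"
  have "cavity_nu \<beta> N 1 I = nu_interp \<beta> N 1 ?m (\<lambda>s. spin_overlap_prod N I s
    + (\<Sum>x\<leftarrow>overlap_corrections I. (fst x * (1 / real N ^ fst (snd x))) * spin_overlap_prod N (snd (snd x)) s))"
    unfolding cavity_nu_def
    by (rule nu_interp_cong) (subst cavity_prod_eq_overlap_prod[OF _ N I], auto simp: case_prod_unfold)
  also have "\<dots> = overlap_nu \<beta> N I + (\<Sum>x\<leftarrow>overlap_corrections I.
      fst x * (1 / real N ^ fst (snd x)) * nu_interp \<beta> N 1 ?m (spin_overlap_prod N (snd (snd x))))"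
    by (simp only: nu_interp_add nu_interp_sum_list nu_interp_cmult overlap_nu_def)
  also have "(\<Sum>x\<leftarrow>overlap_corrections I.
      fst x * (1 / real N ^ fst (snd x)) * nu_interp \<beta> N 1 ?m (spin_overlap_prod N (snd (snd x))))
    = (\<Sum>x\<leftarrow>overlap_corrections I. fst x * (1 / real N ^ fst (snd x)) * overlap_nu \<beta> N (snd (snd x)))"
  proof (intro arg_cong[of _ _ sum_list] map_cong refl)
    fix x assume "x \<in> set (overlap_corrections I)"
    then have sub: "set (snd (snd x)) \<subseteq> set I"
      using overlap_corrections_props[of "fst x" "fst (snd x)" "snd (snd x)" I] by simp
    then have "replica_pairs (snd (snd x))"
      using I by (auto simp: replica_pairs_def)
    then show "fst x * (1 / real N ^ fst (snd x)) * nu_interp \<beta> N 1 ?m (spin_overlap_prod N (snd (snd x)))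
      = fst x * (1 / real N ^ fst (snd x)) * overlap_nu \<beta> N (snd (snd x))"
      using overlap_nu_eq num_replicas_mono[OF sub] by simp
  qed
  finally show ?thesis by (simp add: case_prod_unfold)
qed

text \<open>The conclusion of the theorem for an arbitrary sequence, with both weight conditions
  doubled to stay in the naturals. As a predicate it is closed under finite linear combinations, so
  lists of terms need not be carried through the proof.\<close>

definition expandable :: "real \<Rightarrow> nat \<Rightarrow> nat \<Rightarrow> (nat \<Rightarrow> real) \<Rightarrow> bool" where
  "expandable \<beta> n k u \<longleftrightarrow> (\<exists>ts.
     (\<forall>(K, j, I)\<in>set ts. replica_pairs I \<and> k \<le> 2 * j + length I \<and> (2 * j + length I = k \<longrightarrow> 0 < j)) \<and>
     (\<lambda>N. u N - (\<Sum>(K, j, I)\<leftarrow>ts. K * (1 / real N ^ j) * overlap_nu \<beta> N I))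
       \<in> O(\<lambda>N. 1 / real N powr (real n + 1 / 2)))"

section \<open>Closure properties\<close>

lemma expandable_bigo:
  "u \<in> O(\<lambda>N. 1 / real N powr (real n + 1 / 2)) \<Longrightarrow> expandable \<beta> n k u"
  unfolding expandable_def by (intro exI[of _ "[]"]) simp

lemma expandable_term:
  assumes "replica_pairs I" "k \<le> 2 * j + length I" "2 * j + length I = k \<Longrightarrow> 0 < j"
  shows "expandable \<beta> n k (\<lambda>N. K * (1 / real N ^ j) * overlap_nu \<beta> N I)"
  unfolding expandable_def by (intro exI[of _ "[(K, j, I)]"]) (use assms in auto)

lemma expandable_add:
  assumes "expandable \<beta> n k u" "expandable \<beta> n k v"
  shows "expandable \<beta> n k (\<lambda>N. u N + v N)"
proof -
  let ?S = "\<lambda>ts N. \<Sum>(K, j, I)\<leftarrow>ts. K * (1 / real N ^ j) * overlap_nu \<beta> N I"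
  let ?ok = "\<lambda>ts. \<forall>(K, j, I)\<in>set ts. replica_pairs I \<and> k \<le> 2 * j + length I \<and> (2 * j + length I = k \<longrightarrow> 0 < j)"
  let ?g = "\<lambda>N. 1 / real N powr (real n + 1 / 2)"
  obtain ts ts' where ts: "?ok ts" "(\<lambda>N. u N - ?S ts N) \<in> O(?g)" "?ok ts'" "(\<lambda>N. v N - ?S ts' N) \<in> O(?g)"
    using assms unfolding expandable_def by blast
  have "(\<lambda>N. (u N - ?S ts N) + (v N - ?S ts' N)) \<in> O(?g)"
    by (rule sum_in_bigo(1)[OF ts(2,4)])
  then have "(\<lambda>N. u N + v N - ?S (ts @ ts') N) \<in> O(?g)"
    by (simp add: algebra_simps)
  moreover have "?ok (ts @ ts')" using ts by auto
  ultimately show ?thesis unfolding expandable_def by blast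
qed

lemma expandable_cmult:
  assumes "expandable \<beta> n k u"
  shows "expandable \<beta> n k (\<lambda>N. c * u N)"
proof -
  let ?S = "\<lambda>ts N. \<Sum>(K, j, I)\<leftarrow>ts. K * (1 / real N ^ j) * overlap_nu \<beta> N I"
  let ?ok = "\<lambda>ts. \<forall>(K, j, I)\<in>set ts. replica_pairs I \<and> k \<le> 2 * j + length I \<and> (2 * j + length I = k \<longrightarrow> 0 < j)"
  let ?g = "\<lambda>N. 1 / real N powr (real n + 1 / 2)"
  obtain ts where ts: "?ok ts" "(\<lambda>N. u N - ?S ts N) \<in> O(?g)"
    using assms unfolding expandable_def by blast
  let ?ts = "map (\<lambda>(K, j, I). (c * K, j, I)) ts"
  have "c * ?S ts N = ?S ?ts N" for N
    by (induction ts) (auto simp: algebra_simps)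
  then have "(\<lambda>N. c * u N - ?S ?ts N) = (\<lambda>N. c * (u N - ?S ts N))"
    by (simp add: right_diff_distrib)
  then have "(\<lambda>N. c * u N - ?S ?ts N) \<in> O(?g)"
    using ts(2) by (cases "c = 0") auto
  moreover have "?ok ?ts" using ts(1) by auto
  ultimately show ?thesis unfolding expandable_def by blast
qed

lemma expandable_cong:
  assumes "expandable \<beta> n k u" "\<And>N. 1 \<le> N \<Longrightarrow> v N = u N"
  shows "expandable \<beta> n k v"
proof -
  have "eventually (\<lambda>N. v N - u N = 0) sequentially"
    using assms(2) by (auto intro: eventually_sequentiallyI[of 1])
  then have "(\<lambda>N. v N - u N) \<in> O(\<lambda>N. 1 / real N powr (real n + 1 / 2))"
    using landau_o.big.in_cong[of "\<lambda>N. v N - u N" "\<lambda>_. 0" sequentially] by simp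
  from expandable_add[OF assms(1) expandable_bigo[OF this]] show ?thesis
    by simp
qed

lemma expandable_zero: "expandable \<beta> n k (\<lambda>_. 0)"
  by (rule expandable_bigo) simp

lemma expandable_sum:
  assumes "\<And>x. x \<in> A \<Longrightarrow> expandable \<beta> n k (u x)"
  shows "expandable \<beta> n k (\<lambda>N. \<Sum>x\<in>A. u x N)"
  using assms
  by (induction A rule: infinite_finite_induct) (auto intro: expandable_add expandable_zero)

lemma expandable_diff:
  assumes "expandable \<beta> n k u" "expandable \<beta> n k v"
  shows "expandable \<beta> n k (\<lambda>N. u N - v N)"
  using expandable_add[OF assms(1) expandable_cmult[OF assms(2), of "-1"]] by simp

lemma expandable_sum_list:
  assumes "\<And>x. x \<in> set L \<Longrightarrow> expandable \<beta> n k (u x)"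
  shows "expandable \<beta> n k (\<lambda>N. \<Sum>x\<leftarrow>L. u x N)"
  using assms by (induction L) (auto intro: expandable_add expandable_zero)

text \<open>A correction has weight \<open>length I + j\<close> with \<open>j > 0\<close>. Even for
  \<open>k = length I + 1\<close> it is admissible, with equality precisely at
  \<open>j = 1\<close>.\<close>

lemma expandable_cavity_nu_minus_overlap_nu:
  assumes I: "replica_pairs I" and k: "k \<le> length I + 1"
  shows "expandable \<beta> n k (\<lambda>N. cavity_nu \<beta> N 1 I - overlap_nu \<beta> N I)"
proof (rule expandable_cong)
  show "expandable \<beta> n k (\<lambda>N. \<Sum>x\<leftarrow>overlap_corrections I.
      fst x * (1 / real N ^ fst (snd x)) * overlap_nu \<beta> N (snd (snd x)))"
  proof (rule expandable_sum_list)
    fix x assume "x \<in> set (overlap_corrections I)"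
    then have "0 < fst (snd x)" "fst (snd x) + length (snd (snd x)) = length I" "set (snd (snd x)) \<subseteq> set I"
      using overlap_corrections_props[of "fst x" "fst (snd x)" "snd (snd x)" I] by simp_all
    then show "expandable \<beta> n k (\<lambda>N. fst x * (1 / real N ^ fst (snd x)) * overlap_nu \<beta> N (snd (snd x)))"
      using I k by (intro expandable_term) (auto simp: replica_pairs_def)
  qed
qed (use cavity_nu_eq_overlap_nu[OF I] in \<open>simp add: case_prod_unfold\<close>)

text \<open>A product with more than \<open>k\<close> factors exceeds the weight \<open>k\<close>
  strictly, so it may stay as a term with \<open>j = 0\<close>.\<close>

lemma expandable_cavity_nu:
  assumes I: "replica_pairs I" and k: "k < length I"
  shows "expandable \<beta> n k (\<lambda>N. cavity_nu \<beta> N 1 I)"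
proof -
  have "expandable \<beta> n k (\<lambda>N. 1 * (1 / real N ^ 0) * overlap_nu \<beta> N I)"
    by (rule expandable_term) (use assms in auto)
  from expandable_add[OF this expandable_cavity_nu_minus_overlap_nu[OF I]] show ?thesis
    using k by simp
qed

lemma expandable_cavity_nu_deriv:
  assumes "replica_pairs I" and "k < length I + i"
  shows "expandable \<beta> n k (\<lambda>N. cavity_nu_deriv \<beta> N m0 i 1 I)"
  using assms
proof (induction i arbitrary: I)
  case 0
  then show ?case by (simp add: expandable_cavity_nu)
next
  case (Suc i)
  show ?case
    unfolding cavity_nu_deriv.simps
    by (intro expandable_sum expandable_cmult Suc.IH) (use Suc.prems in \<open>auto intro: replica_pairs_Cons_site_pairs\<close>)
qed

text \<open>At \<open>t = 0\<close> the last spin is decoupled, so that an odd replica makes \<open>cavity_nu\<close> vanish and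
  the expansion at \<open>t = 1\<close> sums to a negligible quantity.\<close>

lemma expandable_taylor_sum:
  assumes \<beta>: "0 < \<beta>" "\<beta> < 1" and I: "replica_pairs I" and odd: "odd (replica_count a I)"
    and P: "8 * (n + 1) \<le> P"
  shows "expandable \<beta> n k (\<lambda>N. \<Sum>i<P. (-1) ^ i / fact i * cavity_nu_deriv \<beta> N m0 i 1 I)"
proof -
  have "0 < P" "8 * (n + 1) \<le> length I + P" using P by auto
  then obtain K where K: "\<And>N. 1 \<le> N \<Longrightarrow>
      \<bar>cavity_nu \<beta> N 0 I - (\<Sum>i<P. (-1) ^ i / fact i * cavity_nu_deriv \<beta> N m0 i 1 I)\<bar> \<le> K / real N ^ (n + 1)"
    using cavity_nu_taylor[OF \<beta> I] by blast
  have "(\<lambda>N. \<Sum>i<P. (-1) ^ i / fact i * cavity_nu_deriv \<beta> N m0 i 1 I) \<in> O(\<lambda>N. 1 / real N powr (real n + 1 / 2))"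
  proof (rule bigoI[of _ "\<bar>K\<bar>"], rule eventually_sequentiallyI[of 1])
    fix N :: nat assume N: "1 \<le> N"
    have "real N powr (real n + 1 / 2) \<le> real N powr real (n + 1)"
      using N by (intro powr_mono) auto
    also have "\<dots> = real N ^ (n + 1)"
      using N by (subst powr_realpow) auto
    finally have "1 / real N ^ (n + 1) \<le> 1 / real N powr (real n + 1 / 2)"
      using N by (intro divide_left_mono) auto
    then have "\<bar>K\<bar> * (1 / real N ^ (n + 1)) \<le> \<bar>K\<bar> * (1 / real N powr (real n + 1 / 2))"
      by (rule mult_left_mono) simp
    moreover have "K / real N ^ (n + 1) \<le> \<bar>K\<bar> * (1 / real N ^ (n + 1))"
      using N by (simp add: divide_right_mono)
    ultimately show "norm (\<Sum>i<P. (-1) ^ i / fact i * cavity_nu_deriv \<beta> N m0 i 1 I)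
        \<le> \<bar>K\<bar> * norm (1 / real N powr (real n + 1 / 2))"
      using K[OF N] cavity_nu_0_odd[OF odd I N, of \<beta>] by simp
  qed
  then show ?thesis by (rule expandable_bigo)
qed

text \<open>In the negligible Taylor sum the order-zero term is the product itself up to
  corrections, and every later term has more factors; it remains to solve for the first.\<close>

lemma expandable_overlap_nu_odd:
  assumes \<beta>: "0 < \<beta>" "\<beta> < 1" and I: "replica_pairs I" and odd: "odd (replica_count a I)"
  shows "expandable \<beta> n (length I) (\<lambda>N. overlap_nu \<beta> N I)"
proof -
  let ?k = "length I"
  let ?T = "\<lambda>N i. (-1) ^ i / fact i * cavity_nu_deriv \<beta> N 0 i 1 I"
  define P where "P = 8 * (n + 1)"
  have all: "expandable \<beta> n ?k (\<lambda>N. \<Sum>i<Suc P. ?T N i)"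
    by (rule expandable_taylor_sum[OF \<beta> I odd]) (simp add: P_def)
  have higher: "expandable \<beta> n ?k (\<lambda>N. \<Sum>i<P. ?T N (Suc i))"
    by (intro expandable_sum expandable_cmult expandable_cavity_nu_deriv I) simp
  have corr: "expandable \<beta> n ?k (\<lambda>N. cavity_nu \<beta> N 1 I - overlap_nu \<beta> N I)"
    by (rule expandable_cavity_nu_minus_overlap_nu[OF I]) simp
  show ?thesis
    by (rule expandable_cong[OF expandable_diff[OF expandable_diff[OF all higher] corr]])
       (simp only: sum.lessThan_Suc_shift, simp)
qed

text \<open>Replacing \<open>p\<close> by \<open>q\<close> changes the parity exactly on the
  symmetric difference of their endpoint sets, which is nonempty because distinct increasing pairs
  have distinct endpoint sets.\<close>

lemma odd_replica_count_exchange: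
  assumes even: "\<And>a. even (replica_count a (p # I))"
    and "fst p < snd p" "fst q < snd q" "p \<noteq> q"
  shows "\<exists>a. odd (replica_count a (q # I))"
proof -
  have parity: "odd (replica_count a (q # I)) \<longleftrightarrow> (fst p = a \<or> snd p = a) \<noteq> (fst q = a \<or> snd q = a)" for a
    using even[of a] assms(2,3) by (auto simp: replica_count_Cons)
  consider "fst q \<notin> {fst p, snd p}" | "snd q \<notin> {fst p, snd p}" | "fst q \<in> {fst p, snd p}" "snd q \<in> {fst p, snd p}"
    by blast
  then show ?thesis
  proof cases
    case 1
    then show ?thesis by (intro exI[of _ "fst q"]) (auto simp: parity)
  next
    case 2
    then show ?thesis by (intro exI[of _ "snd q"]) (auto simp: parity)
  next
    case 3
    then have "p = q" using assms(2,3) by (auto simp: prod_eq_iff)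
    with assms(4) show ?thesis by simp
  qed
qed

text \<open>Removing \<open>p\<close> makes both of its replicas odd, so the Taylor sum of the
  shorter \<open>I\<close> is the negligible one. Its orders from two on exceed
  \<open>length (p # I)\<close> factors; its corrections with \<open>j = 1\<close> have weight
  exactly that length and are the boundary terms of the final claim.\<close>

lemma expandable_overlap_nu_even:
  assumes \<beta>: "0 < \<beta>" "\<beta> < 1" and I: "replica_pairs (p # I)"
    and even: "\<And>a. even (replica_count a (p # I))"
  shows "expandable \<beta> n (length (p # I)) (\<lambda>N. overlap_nu \<beta> N (p # I))"
proof -
  let ?k = "length (p # I)"
  let ?V = "\<lambda>N. overlap_nu \<beta> N (p # I)"
  \<comment> \<open>With at least \<open>snd p\<close> replicas, \<open>p\<close> is an old pair of
    the derivative and its coefficient is exactly \<beta>^2.\<close>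
  let ?m = "max (snd p) (num_replicas I)"
  let ?P = "site_pairs (Suc (Suc ?m))"
  let ?T = "\<lambda>N i. (-1) ^ i / fact i * cavity_nu_deriv \<beta> N (snd p) i 1 I"
  let ?rest = "\<lambda>N. \<Sum>q\<in>?P - {p}. pair_coeff \<beta> ?m q * cavity_nu \<beta> N 1 (q # I)"
  have p: "1 \<le> fst p" "fst p < snd p" and I': "replica_pairs I"
    using I by (auto simp: replica_pairs_Cons)
  have odd: "odd (replica_count (fst p) I)"
    using even[of "fst p"] p by (simp add: replica_count_Cons)
  have pP: "p \<in> ?P" using p by (auto simp: site_pairs_def case_prod_unfold)
  define Q where "Q = 8 * (n + 1)"
  have all: "expandable \<beta> n ?k (\<lambda>N. \<Sum>i<Suc (Suc Q). ?T N i)"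
    by (rule expandable_taylor_sum[OF \<beta> I' odd]) (simp add: Q_def)
  have higher: "expandable \<beta> n ?k (\<lambda>N. \<Sum>i<Q. ?T N (Suc (Suc i)))"
    by (intro expandable_sum expandable_cmult expandable_cavity_nu_deriv I') simp
  have corr: "expandable \<beta> n ?k (\<lambda>N. cavity_nu \<beta> N 1 I - overlap_nu \<beta> N I)"
    by (rule expandable_cavity_nu_minus_overlap_nu[OF I']) simp
  have corr': "expandable \<beta> n ?k (\<lambda>N. cavity_nu \<beta> N 1 (p # I) - overlap_nu \<beta> N (p # I))"
    by (rule expandable_cavity_nu_minus_overlap_nu[OF I]) simp
  have rest: "expandable \<beta> n ?k ?rest"
  proof (intro expandable_sum expandable_cmult)
    fix q assume q: "q \<in> ?P - {p}"
    then have qI: "replica_pairs (q # I)" and "p \<noteq> q"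
      using replica_pairs_Cons_site_pairs[OF I', of q "Suc (Suc ?m)"] by auto
    then have "fst q < snd q" by (simp add: replica_pairs_Cons)
    with \<open>p \<noteq> q\<close> obtain a where a: "odd (replica_count a (q # I))"
      using odd_replica_count_exchange[OF even p(2)] by blast
    \<comment> \<open>\<open>q # I\<close> has the same length as \<open>p # I\<close> but an odd
      replica, so the odd case already supplies an expansion for the same \<open>k\<close>.\<close>
    have "expandable \<beta> n ?k (\<lambda>N. overlap_nu \<beta> N (q # I))"
      using expandable_overlap_nu_odd[OF \<beta> qI a, of n] by simp
    moreover have "expandable \<beta> n ?k (\<lambda>N. cavity_nu \<beta> N 1 (q # I) - overlap_nu \<beta> N (q # I))"
      by (rule expandable_cavity_nu_minus_overlap_nu[OF qI]) simp
    ultimately show "expandable \<beta> n ?k (\<lambda>N. cavity_nu \<beta> N 1 (q # I))"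
      using expandable_add by fastforce
  qed
  \<comment> \<open>Removing the higher orders and the corrections, and adding back the other pairs,
    leaves \<open>overlap_nu\<close> of \<open>I\<close> minus \<beta>^2 times that of
    \<open>p # I\<close>. The two averages agree, so this is \<open>1 - \<beta>\<^sup>2\<close>
    times the wanted one.\<close>
  let ?u = "\<lambda>N. (((\<Sum>i<Suc (Suc Q). ?T N i) - (\<Sum>i<Q. ?T N (Suc (Suc i)))) - (cavity_nu \<beta> N 1 I - overlap_nu \<beta> N I))
      + (\<beta>\<^sup>2 * (cavity_nu \<beta> N 1 (p # I) - overlap_nu \<beta> N (p # I)) + ?rest N)"
  have "expandable \<beta> n ?k ?u"
    by (intro expandable_add expandable_diff expandable_cmult all higher corr corr' rest)
  then have "expandable \<beta> n ?k (\<lambda>N. (1 - \<beta>\<^sup>2) * ?V N)"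
  proof (rule expandable_cong)
    fix N :: nat assume N: "1 \<le> N"
    have "cavity_nu_deriv \<beta> N (snd p) (Suc 0) 1 I = \<beta>\<^sup>2 * cavity_nu \<beta> N 1 (p # I) + ?rest N"
      using sum.remove[OF finite_site_pairs pP, of "\<lambda>q. pair_coeff \<beta> ?m q * cavity_nu \<beta> N 1 (q # I)"]
      by (simp add: pair_coeff_def)
    then have "(\<Sum>i<Suc (Suc Q). ?T N i)
        = cavity_nu \<beta> N 1 I - (\<beta>\<^sup>2 * cavity_nu \<beta> N 1 (p # I) + ?rest N) + (\<Sum>i<Q. ?T N (Suc (Suc i)))"
      by (simp only: sum.lessThan_Suc_shift) simp
    moreover have "overlap_nu \<beta> N I = ?V N"
      using overlap_nu_even[OF I even N] by simp
    ultimately show "(1 - \<beta>\<^sup>2) * ?V N = ?u N"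
      by (simp add: algebra_simps)
  qed
  from expandable_cmult[OF this, of "1 / (1 - \<beta>\<^sup>2)"] show ?thesis
    using \<beta> by (simp add: power_less_one_iff abs_square_eq_1 power2_eq_1_iff)
qed

theorem proposition1p4:
  fixes \<beta> :: real and k n :: nat and I :: "(nat \<times> nat) list"
  assumes "0 < \<beta>" and "\<beta> < 1"
    and "1 \<le> k" and "length I = k" and "replica_pairs I"
    and "(k + 1) div 2 \<le> n"
  shows "\<exists>ts :: (real \<times> nat \<times> (nat \<times> nat) list) list.
    (\<forall>(K, j, I')\<in>set ts. replica_pairs I' \<and>
       real j + real (length I') / 2 \<ge> real k / 2 \<and>
       (real j + real (length I') / 2 = real k / 2 \<longrightarrow> j > 0)) \<and>
    (\<forall>(M :: nat \<Rightarrow> 'w measure) (g :: nat \<Rightarrow> nat \<times> nat \<Rightarrow> 'w \<Rightarrow> real).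
       (\<forall>N\<ge>1. gaussian_disorder N (M N) (g N)) \<longrightarrow>
       (\<lambda>N. nu_prod \<beta> N (M N) (g N) I -
             (\<Sum>(K, j, I')\<leftarrow>ts. K * (1 / real N ^ j) * nu_prod \<beta> N (M N) (g N) I'))
         \<in> O(\<lambda>N. 1 / real N powr (real n + 1 / 2)))"
proof -
  have "expandable \<beta> n k (\<lambda>N. overlap_nu \<beta> N I)"
  proof (cases "\<exists>a. odd (replica_count a I)")
    case True
    then show ?thesis
      using expandable_overlap_nu_odd[OF assms(1,2,5)] assms(4) by blast
  next
    case False
    obtain p J where "I = p # J"
      using assms(3,4) by (cases I) auto
    then show ?thesis
      using expandable_overlap_nu_even[OF assms(1,2), of p J n] False assms(4,5) by auto
  qed
  \<comment> \<open>The list is fixed before any probability space is introduced, so the same terms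
    serve every realisation of the disorder.\<close>
  then obtain ts where ts:
      "\<forall>(K, j, J)\<in>set ts. replica_pairs J \<and> k \<le> 2 * j + length J \<and> (2 * j + length J = k \<longrightarrow> 0 < j)"
      "(\<lambda>N. overlap_nu \<beta> N I - (\<Sum>(K, j, J)\<leftarrow>ts. K * (1 / real N ^ j) * overlap_nu \<beta> N J))
         \<in> O(\<lambda>N. 1 / real N powr (real n + 1 / 2))"
    unfolding expandable_def by blast
  show ?thesis
  proof (intro exI[of _ ts] conjI allI impI)
    have "real k / 2 \<le> real j + real r / 2 \<longleftrightarrow> k \<le> 2 * j + r"
      "real j + real r / 2 = real k / 2 \<longleftrightarrow> 2 * j + r = k" for j r
      by linarith+
    then show "\<forall>(K, j, I')\<in>set ts. replica_pairs I' \<and>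
       real j + real (length I') / 2 \<ge> real k / 2 \<and>
       (real j + real (length I') / 2 = real k / 2 \<longrightarrow> j > 0)"
      using ts(1) by simp
  next
    fix M :: "nat \<Rightarrow> 'w measure" and g :: "nat \<Rightarrow> nat \<times> nat \<Rightarrow> 'w \<Rightarrow> real"
    assume "\<forall>N\<ge>1. gaussian_disorder N (M N) (g N)"
    then have eq: "nu_prod \<beta> N (M N) (g N) J = overlap_nu \<beta> N J" if "2 \<le> N" for N J
      using nu_eq_nu_interp[of N "M N" "g N"] that by (simp add: nu_prod_def overlap_nu_def)
    have "eventually (\<lambda>N. nu_prod \<beta> N (M N) (g N) I -
          (\<Sum>(K, j, J)\<leftarrow>ts. K * (1 / real N ^ j) * nu_prod \<beta> N (M N) (g N) J)
        = overlap_nu \<beta> N I - (\<Sum>(K, j, J)\<leftarrow>ts. K * (1 / real N ^ j) * overlap_nu \<beta> N J)) sequentially"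
      using eq by (intro eventually_sequentiallyI[of 2]) simp
    then show "(\<lambda>N. nu_prod \<beta> N (M N) (g N) I -
             (\<Sum>(K, j, I')\<leftarrow>ts. K * (1 / real N ^ j) * nu_prod \<beta> N (M N) (g N) I'))
         \<in> O(\<lambda>N. 1 / real N powr (real n + 1 / 2))"
      using ts(2) by (subst landau_o.big.in_cong)
  qed
qed

end
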